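(* Let $\mathbf{k}$ be a field which is uncountable or of characteristic zero. Let $f$ be a birational transformation of $\mathbb{P}^m$ defined over $\mathbf{k}$, i.e. the formulas defining $f$ have coefficients in $\mathbf{k}$. Then there exists an element $A$ of $\mathrm{PGL}_{m+1}(\mathbf{k})$ such that $\deg((A\circ f)^n)=\deg(f)^n$ for all $n\geq 1$.
   Context: For a birational transformation $g$ of $\mathbb{P}^m$, $\deg(g)$ denotes its degree with respect to $\mathcal{O}(1)$: the common degree of homogeneous polynomials $g_0,\dots,g_m$ without common factor such that $g=[g_0:\cdots:g_m]$. The group $\mathrm{PGL}_{m+1}(\mathbf{k})$ acts on $\mathbb{P}^m$ by linear projective automorphisms, and $A\circ f$ is the composition; powers denote iterates. *)

theory Defs
  imports
    "HOL-Library.Poly_Mapping"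
    "HOL-Library.Countable_Set"
    "HOL-Algebra.Coset"
    "Jordan_Normal_Form.Matrix"
begin

text \<open>
  Polynomials in the variables \<open>x\<^sub>0, x\<^sub>1, \<dots>\<close> are finitely supported functions from monomials
  (finitely supported exponent vectors) to coefficients. The polynomial ring
  \<open>k[x\<^sub>0, \<dots>, x\<^sub>m]\<close> is the subring of those polynomials in which only variables of index
  at most \<open>m\<close> occur; this is part of the predicate \<open>homogeneous m d\<close>.
\<close>

type_synonym 'k mpoly = "(nat \<Rightarrow>\<^sub>0 nat) \<Rightarrow>\<^sub>0 'k"

definition Const :: "'k::field \<Rightarrow> 'k mpoly" where
  "Const c = Poly_Mapping.single 0 c"

definition Var :: "nat \<Rightarrow> 'k::field mpoly" where
  "Var i = Poly_Mapping.single (Poly_Mapping.single i 1) 1"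

definition homogeneous :: "nat \<Rightarrow> nat \<Rightarrow> 'k::field mpoly \<Rightarrow> bool" where
  "homogeneous m d p \<longleftrightarrow>
     (\<forall>t\<in>Poly_Mapping.keys p. Poly_Mapping.keys t \<subseteq> {..m} \<and>
        (\<Sum>i\<in>Poly_Mapping.keys t. Poly_Mapping.lookup t i) = d)"

text \<open>\<open>subst g p\<close> is \<open>p(g\<^sub>0, g\<^sub>1, \<dots>)\<close>.\<close>

definition subst :: "(nat \<Rightarrow> 'k::field mpoly) \<Rightarrow> 'k mpoly \<Rightarrow> 'k mpoly" where
  "subst g p = (\<Sum>t\<in>Poly_Mapping.keys p. Const (Poly_Mapping.lookup p t) *
     (\<Prod>i\<in>Poly_Mapping.keys t. g i ^ Poly_Mapping.lookup t i))"

text \<open>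
  A tuple \<open>(g\<^sub>0, \<dots>, g\<^sub>m)\<close> is a function on indices of which only the values at \<open>i \<le> m\<close> matter:
  tuples differing only beyond \<open>m\<close> are identified by \<open>proj_rel m\<close>. A rational self-map of
  \<open>\<bbbP>\<^sup>m\<close> is the class \<open>[g\<^sub>0 : \<dots> : g\<^sub>m]\<close> of all tuples proportional over \<open>k(x\<^sub>0, \<dots>, x\<^sub>m)\<close>.
\<close>

definition hom_tuples_deg :: "nat \<Rightarrow> nat \<Rightarrow> (nat \<Rightarrow> 'k::field mpoly) set" where
  "hom_tuples_deg m d = {g. (\<forall>i\<le>m. homogeneous m d (g i)) \<and> (\<exists>i\<le>m. g i \<noteq> 0)}"

definition hom_tuples :: "nat \<Rightarrow> (nat \<Rightarrow> 'k::field mpoly) set" where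
  "hom_tuples m = (\<Union>d. hom_tuples_deg m d)"

definition proj_rel :: "nat \<Rightarrow> ((nat \<Rightarrow> 'k::field mpoly) \<times> (nat \<Rightarrow> 'k mpoly)) set" where
  "proj_rel m = {(g, h). g \<in> hom_tuples m \<and> h \<in> hom_tuples m \<and>
     (\<forall>i\<le>m. \<forall>j\<le>m. g i * h j = g j * h i)}"

definition rational_maps :: "nat \<Rightarrow> (nat \<Rightarrow> 'k::field mpoly) set set" where
  "rational_maps m = hom_tuples m // proj_rel m"

text \<open>
  Representatives for which substitution gives the zero tuple are discarded: the relation
  \<open>proj_rel m\<close> only involves nonzero tuples. If no pair of representatives can be composed (which
  does not happen for dominant maps), the composite is undefined and \<open>rat_comp\<close> yields the
  empty set, which is not a rational map.
\<close>

definition rat_comp :: "nat \<Rightarrow> (nat \<Rightarrow> 'k::field mpoly) set \<Rightarrow> (nat \<Rightarrow> 'k mpoly) set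
    \<Rightarrow> (nat \<Rightarrow> 'k mpoly) set" where
  "rat_comp m F G = {h. \<exists>f\<in>F. \<exists>g\<in>G. ((\<lambda>i. subst g (f i)), h) \<in> proj_rel m}"

definition rat_id :: "nat \<Rightarrow> (nat \<Rightarrow> 'k::field mpoly) set" where
  "rat_id m = proj_rel m `` {Var}"

definition Bir :: "nat \<Rightarrow> (nat \<Rightarrow> 'k::field mpoly) set monoid" where
  "Bir m = \<lparr>carrier = {F \<in> rational_maps m. \<exists>G\<in>rational_maps m.
                rat_comp m F G = rat_id m \<and> rat_comp m G F = rat_id m},
            monoid.mult = rat_comp m, one = rat_id m\<rparr>"

definition no_common_factor :: "nat \<Rightarrow> (nat \<Rightarrow> 'k::field mpoly) \<Rightarrow> bool" where
  "no_common_factor m g \<longleftrightarrow> (\<forall>p. (\<forall>i\<le>m. p dvd g i) \<longrightarrow> p dvd 1)"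

definition rat_degree :: "nat \<Rightarrow> (nat \<Rightarrow> 'k::field mpoly) set \<Rightarrow> nat" where
  "rat_degree m F = (THE d. \<exists>g\<in>F. g \<in> hom_tuples_deg m d \<and> no_common_factor m g)"

definition GL :: "nat \<Rightarrow> 'k::field mat monoid" where
  "GL n = units_of (ring_mat TYPE('k) n ())"

definition PGL :: "nat \<Rightarrow> 'k::field mat set monoid" where
  "PGL n = GL n Mod {c \<cdot>\<^sub>m 1\<^sub>m n | c. c \<noteq> 0}"

definition linear_tuple :: "nat \<Rightarrow> 'k::field mat \<Rightarrow> nat \<Rightarrow> 'k mpoly" where
  "linear_tuple m M i = (\<Sum>j\<le>m. Const (M $$ (i, j)) * Var j)"

text \<open>The automorphism of \<open>\<bbbP>\<^sup>m\<close> given by an element of \<open>PGL (Suc m)\<close>, a coset of matrices.\<close>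

definition proj_aut :: "nat \<Rightarrow> 'k::field mat set \<Rightarrow> (nat \<Rightarrow> 'k mpoly) set" where
  "proj_aut m A = (\<Union>M\<in>A. proj_rel m `` {linear_tuple m M})"

end

theory Submission
  imports Defs "HOL-Algebra.Algebraic_Closure_Type"
begin

text \<open>
  Let \<open>F\<close> and \<open>G\<close> be tuples of forms without common factor that represent \<open>f\<close> and its inverse, and let
  \<open>d = deg f\<close>. For an invertible matrix \<open>M\<close> the \<open>n\<close>-fold substitution of \<open>\<Phi> = M F\<close> into itself has
  degree \<open>d\<^sup>n\<close>, so the degree of \<open>(A \<circ> f)\<^sup>n\<close> is \<open>d\<^sup>n\<close> as long as no common factor appears. The proof finds
  one \<open>M\<close> for which no iterate acquires a common factor.

  Reduction to finitely many hypersurfaces. Birationality gives a form \<open>P\<close> with \<open>G(F(x)) = P x\<close>, and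
  replacing \<open>F\<close> by \<open>M F\<close> and \<open>G\<close> by \<open>G \<circ> M\<^sup>-\<^sup>1\<close> does not change \<open>P\<close> (lemma \<open>twist_inverse\<close>). A
  hypersurface \<open>q = 0\<close> with \<open>q\<close> prime to \<open>P\<close> is not contracted by \<open>\<Phi>\<close>; if an iterate vanishes on it, then
  the previous iterate vanishes on its image, which is again a hypersurface. So the first common factor
  that appears divides \<open>P\<close> (lemma \<open>iterate_reduced\<close>, an argument with divisibility only). It is
  therefore enough to find, for each of the finitely many primes \<open>q\<close> dividing \<open>P\<close>, a point \<open>z\<close> with
  \<open>q(z) = 0\<close>, over the algebraic closure, at which no iterate of \<open>\<Phi>\<close> vanishes.

  Choice of the matrix. Since \<open>F\<close> has no common factor, there is a point \<open>z\<close> on \<open>q = 0\<close> with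
  \<open>F(z) \<noteq> 0\<close> (lemma \<open>zero_point\<close>). Take a vector \<open>v\<close> with \<open>F(v) \<noteq> 0\<close>, a linear form \<open>l\<close> that does not
  vanish at \<open>F(v)\<close> nor at the finitely many vectors \<open>F(z)\<close>, and \<open>M = s I + v l\<^sup>T\<close>. For \<open>s = 0\<close> the map
  \<open>\<Phi>\<close> is constant with value \<open>v\<close> in projective space. For \<open>s\<close> small but nonzero \<open>M\<close> is invertible, \<open>\<Phi>\<close>
  sends each \<open>z\<close> close to \<open>v\<close> and maps a neighbourhood of \<open>v\<close>, on which \<open>F\<close> has no zero, into itself
  (lemma \<open>attraction\<close>). One \<open>s\<close> thus serves for all iterates simultaneously.

  Small elements. Smallness refers to a valuation ring \<open>R\<close> of the algebraic closure in which a chosen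
  \<open>t\<close> of the base field is a nonzero non-unit; it is a maximal subring that contains \<open>t\<close> but not its
  inverse. The hypothesis on the field provides \<open>t\<close>: in characteristic zero \<open>t = 2\<close>, in an uncountable
  field an element transcendental over the prime field. As the closure is algebraic over the base field,
  every element of it lands in \<open>t R\<close> after multiplication with a suitable nonzero \<open>s\<close> from the base
  field (lemma \<open>small_multiple\<close>).

  The divisibility arguments rest on unique factorization in the polynomial ring
  (theorem \<open>irreducible_imp_prime\<close>).
\<close>

section \<open>Evaluation homomorphisms\<close>

text \<open>The one evaluation map behind all homomorphisms out of the polynomial ring that occur below:
  substitution of tuples, evaluation at points of the algebraic closure, the grading, and reading a
  polynomial as a univariate one.\<close>

definition ev :: "('k::field \<Rightarrow> 'b::comm_ring_1) \<Rightarrow> (nat \<Rightarrow> 'b) \<Rightarrow> 'k mpoly \<Rightarrow> 'b" where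
  "ev \<phi> g p = (\<Sum>t\<in>Poly_Mapping.keys p. \<phi> (Poly_Mapping.lookup p t) *
     (\<Prod>i\<in>Poly_Mapping.keys t. g i ^ Poly_Mapping.lookup t i))"

definition vars :: "'k::field mpoly \<Rightarrow> nat set" where
  "vars p = (\<Union>t\<in>Poly_Mapping.keys p. Poly_Mapping.keys t)"

lemma subst_eq_ev: "subst = ev Const"
  by (simp add: fun_eq_iff subst_def ev_def)

lemma finite_vars [simp]: "finite (vars p)"
  by (simp add: vars_def)

lemma comm_ring_hom_Const: "comm_ring_hom (Const :: 'k::field \<Rightarrow> _)"
  by unfold_locales (simp_all add: Const_def single_add mult_single)

lemma comm_ring_hom_to_ac: "comm_ring_hom to_ac"
  by unfold_locales simp_all

interpretation Const: comm_ring_hom "Const :: 'k::field \<Rightarrow> _"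
  by (rule comm_ring_hom_Const)

lemma Const_eq_iff [simp]: "Const a = Const b \<longleftrightarrow> a = b"
  by (simp add: Const_def inj_eq[OF inj_single])

lemma Const_eq_0_iff [simp]: "Const a = 0 \<longleftrightarrow> a = 0"
  using Const_eq_iff[of a 0] by (simp del: Const_eq_iff)

lemma comm_ring_hom_comp:
  "comm_ring_hom f \<Longrightarrow> comm_ring_hom g \<Longrightarrow> comm_ring_hom (\<lambda>x. g (f x))"
proof -
  assume "comm_ring_hom f" "comm_ring_hom g"
  then interpret f: comm_ring_hom f + g: comm_ring_hom g .
  show ?thesis
    by unfold_locales (simp_all add: f.hom_add f.hom_mult f.hom_one f.hom_zero
        g.hom_add g.hom_mult g.hom_one g.hom_zero)
qed

lemma mpoly_expand: "p = (\<Sum>t\<in>Poly_Mapping.keys p. Poly_Mapping.single t (Poly_Mapping.lookup p t))"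
  by (rule poly_mapping_eqI)
     (auto simp: lookup_sum lookup_single when_def sum.delta' in_keys_iff)

lemma monomial_mult:
  fixes g :: "nat \<Rightarrow> 'b::comm_ring_1"
  shows "(\<Prod>i\<in>Poly_Mapping.keys (s + t). g i ^ Poly_Mapping.lookup (s + t) i) =
    (\<Prod>i\<in>Poly_Mapping.keys s. g i ^ Poly_Mapping.lookup s i) *
    (\<Prod>i\<in>Poly_Mapping.keys t. g i ^ Poly_Mapping.lookup t i)"
proof -
  have ext: "(\<Prod>i\<in>Poly_Mapping.keys u. g i ^ Poly_Mapping.lookup u i) =
      (\<Prod>i\<in>Poly_Mapping.keys s \<union> Poly_Mapping.keys t. g i ^ Poly_Mapping.lookup u i)"
    if "Poly_Mapping.keys u \<subseteq> Poly_Mapping.keys s \<union> Poly_Mapping.keys t" for u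
    by (rule prod.mono_neutral_left) (use that in \<open>auto simp: in_keys_iff\<close>)
  show ?thesis
    by (subst (1 2 3) ext) (auto simp: lookup_add power_add prod.distrib dest: keys_add[THEN subsetD])
qed

lemma ev_single:
  "comm_ring_hom \<phi> \<Longrightarrow> ev \<phi> g (Poly_Mapping.single t c) =
    \<phi> c * (\<Prod>i\<in>Poly_Mapping.keys t. g i ^ Poly_Mapping.lookup t i)"
proof -
  assume "comm_ring_hom \<phi>"
  then interpret comm_ring_hom \<phi> .
  show ?thesis by (cases "c = 0") (simp_all add: ev_def hom_zero)
qed

lemma ev_add: 
  assumes "comm_ring_hom \<phi>"
  shows "ev \<phi> g (p + q) = ev \<phi> g p + ev \<phi> g q"
proof -
  interpret comm_ring_hom \<phi> by fact
  have ext: "ev \<phi> g r = (\<Sum>t\<in>Poly_Mapping.keys p \<union> Poly_Mapping.keys q. \<phi> (Poly_Mapping.lookup r t) *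
     (\<Prod>i\<in>Poly_Mapping.keys t. g i ^ Poly_Mapping.lookup t i))"
    if "Poly_Mapping.keys r \<subseteq> Poly_Mapping.keys p \<union> Poly_Mapping.keys q" for r
    unfolding ev_def
    by (rule sum.mono_neutral_left) (use that in \<open>auto simp: in_keys_iff hom_zero\<close>)
  show ?thesis
    by (subst (1 2 3) ext)
       (auto simp: lookup_add hom_add distrib_right sum.distrib dest: keys_add[THEN subsetD])
qed

lemma ev_zero [simp]: "ev \<phi> g 0 = 0"
  by (simp add: ev_def)

lemma ev_sum:
  assumes "comm_ring_hom \<phi>"
  shows "ev \<phi> g (\<Sum>a\<in>A. f a) = (\<Sum>a\<in>A. ev \<phi> g (f a))"
  by (induction A rule: infinite_finite_induct) (simp_all add: ev_add[OF assms])

lemma ev_mult: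
  assumes "comm_ring_hom \<phi>"
  shows "ev \<phi> g (p * q) = ev \<phi> g p * ev \<phi> g q"
proof -
  interpret comm_ring_hom \<phi> by fact
  have single: "ev \<phi> g (Poly_Mapping.single s a * Poly_Mapping.single t b) =
      ev \<phi> g (Poly_Mapping.single s a) * ev \<phi> g (Poly_Mapping.single t b)" for s t a b
    by (simp add: mult_single ev_single[OF assms] hom_mult monomial_mult mult_ac)
  have "ev \<phi> g (p * q) = ev \<phi> g ((\<Sum>s\<in>Poly_Mapping.keys p. Poly_Mapping.single s (Poly_Mapping.lookup p s)) *
      (\<Sum>t\<in>Poly_Mapping.keys q. Poly_Mapping.single t (Poly_Mapping.lookup q t)))"
    by (simp flip: mpoly_expand)
  also have "\<dots> = ev \<phi> g (\<Sum>s\<in>Poly_Mapping.keys p. Poly_Mapping.single s (Poly_Mapping.lookup p s)) *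
      ev \<phi> g (\<Sum>t\<in>Poly_Mapping.keys q. Poly_Mapping.single t (Poly_Mapping.lookup q t))"
    by (simp add: sum_product ev_sum[OF assms] single)
  finally show ?thesis by (simp flip: mpoly_expand)
qed

lemma ev_Const [simp]: "comm_ring_hom \<phi> \<Longrightarrow> ev \<phi> g (Const c) = \<phi> c"
  by (simp add: Const_def ev_single)

lemma ev_Var [simp]: "comm_ring_hom \<phi> \<Longrightarrow> ev \<phi> g (Var i) = g i"
proof -
  assume "comm_ring_hom \<phi>"
  then interpret comm_ring_hom \<phi> .
  show ?thesis using \<open>comm_ring_hom \<phi>\<close> by (simp add: Var_def ev_single hom_one)
qed

lemma comm_ring_hom_ev:
  assumes "comm_ring_hom \<phi>"
  shows "comm_ring_hom (ev \<phi> g)"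
proof -
  interpret comm_ring_hom \<phi> by fact
  show ?thesis
    using ev_Const[OF assms, of g 1] assms
    by unfold_locales (simp_all add: ev_add ev_mult hom_one Const.hom_one)
qed

lemma ev_Const_Var [simp]: "ev Const Var p = p"
proof -
  have "ev Const Var (Poly_Mapping.single t c) = Poly_Mapping.single t c" for t :: "nat \<Rightarrow>\<^sub>0 nat" and c :: 'a
  proof -
    have pow: "Var i ^ n = Poly_Mapping.single (Poly_Mapping.single i n) (1::'a)" for i n
    proof (induction n)
      case (Suc n)
      then show ?case 
        by (simp add: Var_def mult_single flip: single_add)
    qed simp
    have "(\<Prod>i\<in>I. Poly_Mapping.single (Poly_Mapping.single i (f i)) (1::'a)) =
        Poly_Mapping.single (\<Sum>i\<in>I. Poly_Mapping.single i (f i)) 1" for I :: "nat set" and f :: "nat \<Rightarrow> nat"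
      by (induction I rule: infinite_finite_induct) (simp_all add: mult_single)
    moreover have "(\<Sum>i\<in>Poly_Mapping.keys t. Poly_Mapping.single i (Poly_Mapping.lookup t i)) = t"
      by (rule poly_mapping_eqI)
         (auto simp: lookup_sum lookup_single when_def sum.delta' in_keys_iff)
    ultimately show ?thesis
      by (simp add: ev_single[OF comm_ring_hom_Const] pow Const_def mult_single)
  qed
  then have "ev Const Var (\<Sum>t\<in>Poly_Mapping.keys p. Poly_Mapping.single t (Poly_Mapping.lookup p t)) = 
     (\<Sum>t\<in>Poly_Mapping.keys p. Poly_Mapping.single t (Poly_Mapping.lookup p t))"
    by (simp add: ev_sum[OF comm_ring_hom_Const])
  then show ?thesis by (simp flip: mpoly_expand)
qed

text \<open>The universal property in the form in which compositions of substitutions and evaluations are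
  computed.\<close>

lemma hom_ev:
  assumes "comm_ring_hom h"
  shows "h (ev \<phi> g p) = ev (\<lambda>c. h (\<phi> c)) (\<lambda>i. h (g i)) p"
proof -
  interpret comm_ring_hom h by fact
  show ?thesis by (simp add: ev_def hom_sum hom_mult hom_prod hom_power)
qed

lemma ev_cong:
  assumes "\<And>i. i \<in> vars p \<Longrightarrow> g i = g' i"
  shows "ev \<phi> g p = ev \<phi> g' p"
proof -
  have "g i = g' i" if "t \<in> Poly_Mapping.keys p" "i \<in> Poly_Mapping.keys t" for t i
    using assms that by (auto simp: vars_def)
  then show ?thesis unfolding ev_def by (simp cong: sum.cong prod.cong)
qed

text \<open>The predicate is typically membership in a subring, or a bound on the variables or the
  coefficients that is stable under the ring operations.\<close>

lemma ev_closed: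
  assumes "P 0" "\<And>a b. P a \<Longrightarrow> P b \<Longrightarrow> P (a + b)" "\<And>a b. P a \<Longrightarrow> P b \<Longrightarrow> P (a * b)" "P 1"
    and "\<And>c. c \<in> Poly_Mapping.range p \<Longrightarrow> P (\<phi> c)" "\<And>i. i \<in> vars p \<Longrightarrow> P (g i)"
  shows "P (ev \<phi> g p)"
proof -
  have sum: "(\<And>a. a \<in> A \<Longrightarrow> P (f a)) \<Longrightarrow> P (sum f A)" for A :: "(nat \<Rightarrow>\<^sub>0 nat) set" and f
    using assms by (induction A rule: infinite_finite_induct) auto
  have prod: "(\<And>a. a \<in> A \<Longrightarrow> P (f a)) \<Longrightarrow> P (prod f A)" for A :: "nat set" and f
    using assms by (induction A rule: infinite_finite_induct) auto
  have pow: "P a \<Longrightarrow> P (a ^ n)" for a n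
    using assms by (induction n) auto
  show ?thesis unfolding ev_def
    by (intro sum assms(3) prod pow) (use assms(5,6) in \<open>auto simp: vars_def\<close>)
qed

lemma vars_Const [simp]: "vars (Const c) = {}"
  by (auto simp: vars_def Const_def)

lemma vars_Var [simp]: "vars (Var i :: 'k::field mpoly) = {i}"
  by (auto simp: vars_def Var_def)

lemma vars_add: "vars (p + q) \<subseteq> vars p \<union> vars q"
  unfolding vars_def using keys_add[of p q] by auto

lemma vars_mult_subset: "vars (p * q) \<subseteq> vars p \<union> vars q"
proof
  fix i assume "i \<in> vars (p * q)"
  then obtain s t where "s \<in> Poly_Mapping.keys p" "t \<in> Poly_Mapping.keys q" "i \<in> Poly_Mapping.keys (s + t)"
    unfolding vars_def using keys_mult[of p q] by blast
  then show "i \<in> vars p \<union> vars q"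
    unfolding vars_def using keys_add[of s t] by blast
qed

lemma vars_0 [simp]: "vars 0 = {}" by (simp add: vars_def)
lemma vars_1 [simp]: "vars 1 = {}" using vars_Const[of 1] by (simp del: vars_Const add: Const.hom_one)

lemma vars_ev_subset:
  assumes "\<And>i. i \<in> vars p \<Longrightarrow> vars (g i) \<subseteq> V"
  shows "vars (ev Const g p) \<subseteq> V"
  by (rule ev_closed) (use assms vars_add vars_mult_subset in \<open>auto, blast+\<close>)

lemma vars_empty_iff: "vars p = {} \<longleftrightarrow> (\<exists>c. p = Const c)"
proof
  assume "vars p = {}"
  then have "ev Const Var p = ev Const (\<lambda>_. 0) p"
    by (intro ev_cong) auto
  moreover have "\<exists>c. ev Const (\<lambda>_. 0 :: 'a mpoly) p = Const c"
    by (rule ev_closed) (metis Const.hom_zero Const.hom_one Const.hom_add Const.hom_mult)+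
  ultimately show "\<exists>c. p = Const c" by simp
qed auto

section \<open>Grading and distinguished variables\<close>

text \<open>The polynomial as a univariate one in the variable \<open>x\<^sub>n\<close>, with coefficients among the polynomials
  that do not involve \<open>x\<^sub>n\<close>. Keeping these coefficients inside the full polynomial ring allows an
  induction on the set of variables without changing types.\<close>

definition upoly :: "nat \<Rightarrow> 'k::field mpoly \<Rightarrow> 'k mpoly poly" where
  "upoly n = ev (\<lambda>c. [:Const c:]) (\<lambda>i. if i = n then [:0, 1:] else [:Var i:])"

text \<open>The homogeneous component of degree \<open>k\<close> is the coefficient of index \<open>k\<close>. The map is a ring
  homomorphism into an integral domain, which makes total degrees additive and shows that factors
  of forms are forms.\<close>

definition graded :: "'k::field mpoly \<Rightarrow> 'k mpoly poly" where
  "graded = ev (\<lambda>c. [:Const c:]) (\<lambda>i. [:0, Var i:])"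

abbreviation vdeg :: "nat \<Rightarrow> 'k::field mpoly \<Rightarrow> nat" where
  "vdeg n p \<equiv> Polynomial.degree (upoly n p)"

abbreviation tdeg :: "'k::field mpoly \<Rightarrow> nat" where
  "tdeg p \<equiv> Polynomial.degree (graded p)"

lemma comm_ring_hom_const_poly: "comm_ring_hom (\<lambda>c::'a::comm_ring_1. [:c:])"
  by unfold_locales simp_all

lemma comm_ring_hom_poly: "comm_ring_hom (\<lambda>p. poly p (x::'a::comm_ring_1))"
  by unfold_locales simp_all

lemma comm_ring_hom_const_poly_Const: "comm_ring_hom (\<lambda>c::'k::field. [:Const c:])"
  by (rule comm_ring_hom_comp[OF comm_ring_hom_Const comm_ring_hom_const_poly])

lemma comm_ring_hom_upoly: "comm_ring_hom (upoly n)"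
  unfolding upoly_def by (rule comm_ring_hom_ev[OF comm_ring_hom_const_poly_Const])

lemma comm_ring_hom_graded: "comm_ring_hom graded"
  unfolding graded_def by (rule comm_ring_hom_ev[OF comm_ring_hom_const_poly_Const])

interpretation upoly: comm_ring_hom "upoly n"
  by (rule comm_ring_hom_upoly)

interpretation graded: comm_ring_hom graded
  by (rule comm_ring_hom_graded)

lemma poly_upoly: "poly (upoly n p) (Var n) = p"
proof -
  have "(\<lambda>i. poly (if i = n then [:0, 1:] else [:Var i:]) (Var n :: 'a mpoly)) = Var"
    by auto
  then show ?thesis
    unfolding upoly_def by (subst hom_ev[OF comm_ring_hom_poly]) simp
qed

lemma poly_graded_1: "poly (graded p) 1 = p"
  unfolding graded_def by (subst hom_ev[OF comm_ring_hom_poly]) simp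

lemma upoly_0_iff [simp]: "upoly n p = 0 \<longleftrightarrow> p = 0"
  by (metis poly_upoly poly_0 upoly.hom_zero)

lemma graded_0_iff [simp]: "graded p = 0 \<longleftrightarrow> p = 0"
  by (metis poly_graded_1 poly_0 graded.hom_zero)

lemma vars_sum: "(\<And>a. a \<in> A \<Longrightarrow> vars (f a) \<subseteq> V) \<Longrightarrow> vars (\<Sum>a\<in>A. f a) \<subseteq> V"
proof (induction A rule: infinite_finite_induct)
  case (insert x F)
  then show ?case using vars_add[of "f x" "sum f F"] by auto
qed auto

lemma vars_coeff_upoly: "vars (coeff (upoly n p) j) \<subseteq> vars p - {n}"
proof -
  have "\<forall>j. vars (coeff (upoly n p) j) \<subseteq> vars p - {n}"
    unfolding upoly_def
  proof (rule ev_closed)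
    fix a b :: "'a mpoly poly"
    assume a: "\<forall>j. vars (coeff a j) \<subseteq> vars p - {n}" and b: "\<forall>j. vars (coeff b j) \<subseteq> vars p - {n}"
    show "\<forall>j. vars (coeff (a + b) j) \<subseteq> vars p - {n}"
    proof
      fix j show "vars (coeff (a + b) j) \<subseteq> vars p - {n}"
        using vars_add[of "coeff a j" "coeff b j"] a[rule_format, of j] b[rule_format, of j]
        by (simp del: Diff_subset_conv) blast
    qed
    show "\<forall>j. vars (coeff (a * b) j) \<subseteq> vars p - {n}"
      unfolding coeff_mult
      by (intro allI vars_sum order.trans[OF vars_mult_subset] Un_least a[rule_format] b[rule_format])
  qed (auto simp: coeff_pCons split: nat.splits)
  then show ?thesis by blast
qed

lemma upoly_free: "n \<notin> vars p \<Longrightarrow> upoly n p = [:p:]"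
proof -
  assume n: "n \<notin> vars p"
  have "upoly n p = ev (\<lambda>c. [:Const c:]) (\<lambda>i. [:Var i:]) p"
    unfolding upoly_def by (rule ev_cong) (use n in auto)
  also have "\<dots> = [:ev Const Var p:]"
    by (rule hom_ev[OF comm_ring_hom_const_poly, symmetric])
  finally show ?thesis by simp
qed

lemma vdeg_0_iff: "vdeg n p = 0 \<longleftrightarrow> n \<notin> vars p"
proof
  assume "vdeg n p = 0"
  then obtain a where a: "upoly n p = [:a:]" by (metis degree_eq_zeroE)
  then have "p = a" using poly_upoly[of n p] by simp
  then show "n \<notin> vars p" using vars_coeff_upoly[of n p 0] a by auto
qed (simp add: upoly_free)

lemma vdeg_mult: "p \<noteq> 0 \<Longrightarrow> q \<noteq> 0 \<Longrightarrow> vdeg n (p * q) = vdeg n p + vdeg n q"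
  by (simp add: upoly.hom_mult degree_mult_eq)

lemma tdeg_mult: "p \<noteq> 0 \<Longrightarrow> q \<noteq> 0 \<Longrightarrow> tdeg (p * q) = tdeg p + tdeg q"
  by (simp add: graded.hom_mult degree_mult_eq)

text \<open>Divisors involve no new variables, so divisibility among polynomials in a given set of
  variables does not depend on the ambient set.\<close>

lemma vars_mult:
  assumes "p \<noteq> 0" "q \<noteq> 0"
  shows "vars (p * q) = vars p \<union> vars q"
proof -
  have "n \<in> vars (p * q) \<longleftrightarrow> n \<in> vars p \<or> n \<in> vars q" for n
    using vdeg_mult[OF assms, of n] vdeg_0_iff[of n p] vdeg_0_iff[of n q] vdeg_0_iff[of n "p * q"]
    by auto
  then show ?thesis by auto
qed

lemma ev_Const_0: "\<exists>c. ev Const (\<lambda>_. 0) p = Const c"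
  by (rule ev_closed) (metis Const.hom_zero Const.hom_one Const.hom_add Const.hom_mult)+

lemma tdeg_0_iff: "tdeg p = 0 \<longleftrightarrow> (\<exists>c. p = Const c)"
proof
  assume "tdeg p = 0"
  then obtain a where a: "graded p = [:a:]" by (metis degree_eq_zeroE)
  have "poly (graded p) 0 = ev Const (\<lambda>_. 0) p"
    unfolding graded_def by (subst hom_ev[OF comm_ring_hom_poly]) simp
  then show "\<exists>c. p = Const c"
    using a poly_graded_1[of p] ev_Const_0[of p] by simp
qed (auto simp: graded_def comm_ring_hom_const_poly_Const)

lemma unit_iff: "p dvd 1 \<longleftrightarrow> (\<exists>c. c \<noteq> 0 \<and> p = Const c)"
proof
  assume "p dvd 1"
  then obtain q where q: "1 = p * q" by (elim dvdE)
  then have nz: "p \<noteq> 0" "q \<noteq> 0" by auto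
  have "tdeg (1::'a mpoly) = 0" by (simp add: graded.hom_one)
  then have "tdeg p = 0" using tdeg_mult[OF nz] q by simp
  then show "\<exists>c. c \<noteq> 0 \<and> p = Const c" using nz by (auto simp: tdeg_0_iff)
next
  assume "\<exists>c. c \<noteq> 0 \<and> p = Const c"
  then obtain c where c: "c \<noteq> 0" "p = Const c" by auto
  then have "1 = p * Const (1 / c)" by (simp flip: Const.hom_mult add: Const.hom_one)
  then show "p dvd 1" by (rule dvdI)
qed

lemma tdeg_pos: "p \<noteq> 0 \<Longrightarrow> \<not> p dvd 1 \<Longrightarrow> tdeg p > 0"
  using tdeg_0_iff[of p] by (auto simp: unit_iff)

section \<open>Unique factorization\<close>

lemma irreducible_factor:
  assumes "p \<noteq> 0" "\<not> p dvd 1"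
  shows "\<exists>q. Factorial_Ring.irreducible q \<and> q dvd (p :: 'k::field mpoly)"
  using assms
proof (induction "tdeg p" arbitrary: p rule: less_induct)
  case less
  show ?case
  proof (cases "Factorial_Ring.irreducible p")
    case False
    then obtain a b where ab: "p = a * b" "\<not> a dvd 1" "\<not> b dvd 1"
      using less.prems unfolding Factorial_Ring.irreducible_def by blast
    then have nz: "a \<noteq> 0" "b \<noteq> 0" using less.prems by auto
    have "tdeg a < tdeg p" using tdeg_mult[OF nz] tdeg_pos[OF nz(2) ab(3)] ab by simp
    then obtain q where "Factorial_Ring.irreducible q" "q dvd a"
      using less.hyps nz ab by blast
    then show ?thesis using ab by auto
  qed auto
qed

text \<open>Primality tested only against polynomials in the variables from \<open>V\<close>: the property that
  is proved by induction on the finite set \<open>V\<close>.\<close>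

definition rel_prime :: "nat set \<Rightarrow> 'k::field mpoly \<Rightarrow> bool" where
  "rel_prime V q \<longleftrightarrow> (\<forall>a b. vars a \<subseteq> V \<longrightarrow> vars b \<subseteq> V \<longrightarrow> q dvd a * b \<longrightarrow> q dvd a \<or> q dvd b)"

lemma dvd_iff_coeff_upoly:
  assumes "n \<notin> vars c"
  shows "c dvd a \<longleftrightarrow> (\<forall>i. c dvd coeff (upoly n a) i)"
proof -
  have "c dvd a \<longleftrightarrow> [:c:] dvd upoly n a"
  proof
    assume "c dvd a"
    then obtain b where "a = c * b" by (elim dvdE)
    then show "[:c:] dvd upoly n a"
      using upoly_free[OF assms] by (metis dvd_triv_left upoly.hom_mult)
  next
    assume "[:c:] dvd upoly n a"
    then obtain b where "upoly n a = [:c:] * b" by (elim dvdE)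
    then have "a = c * poly b (Var n)" using poly_upoly[of n a] by simp
    then show "c dvd a" by simp
  qed
  then show ?thesis by (simp add: const_poly_dvd_iff)
qed

text \<open>Gauss's argument: in a product of two univariate polynomials, the coefficient at the sum of
  the first indices at which \<open>c\<close> does not divide is itself not divisible by \<open>c\<close>.\<close>

lemma rel_prime_insert:
  assumes c: "vars c \<subseteq> V" "n \<notin> V" "rel_prime V c"
  shows "rel_prime (insert n V) c"
  unfolding rel_prime_def
proof (intro allI impI, rule ccontr)
  fix a b assume ab: "vars a \<subseteq> insert n V" "vars b \<subseteq> insert n V" "c dvd a * b"
    and neg: "\<not> (c dvd a \<or> c dvd b)"
  have nc: "n \<notin> vars c" using c by auto
  define A where "A = upoly n a"
  define B where "B = upoly n b"
  define i where "i = (LEAST i. \<not> c dvd coeff A i)"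
  define j where "j = (LEAST j. \<not> c dvd coeff B j)"
  have i: "\<not> c dvd coeff A i"
    unfolding i_def by (rule LeastI_ex) (use neg dvd_iff_coeff_upoly[OF nc, of a] A_def in auto)
  have j: "\<not> c dvd coeff B j"
    unfolding j_def by (rule LeastI_ex) (use neg dvd_iff_coeff_upoly[OF nc, of b] B_def in auto)
  have "c dvd coeff (A * B) (i + j)"
    using ab(3) dvd_iff_coeff_upoly[OF nc, of "a * b"] by (simp add: upoly.hom_mult A_def B_def)
  also have "coeff (A * B) (i + j) = coeff A i * coeff B j + 
      (\<Sum>k\<in>{..i+j} - {i}. coeff A k * coeff B (i + j - k))"
    unfolding coeff_mult by (subst sum.remove[of _ i]) auto
  finally have "c dvd coeff A i * coeff B j + (\<Sum>k\<in>{..i+j} - {i}. coeff A k * coeff B (i + j - k))" .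
  moreover have rest: "c dvd (\<Sum>k\<in>{..i+j} - {i}. coeff A k * coeff B (i + j - k))"
  proof (rule dvd_sum)
    fix k assume k: "k \<in> {..i + j} - {i}"
    show "c dvd coeff A k * coeff B (i + j - k)"
    proof (cases "k < i")
      case True
      then show ?thesis unfolding i_def using not_less_Least by (metis dvd_mult2)
    next
      case False
      then have "i + j - k < j" using k by auto
      then show ?thesis unfolding j_def using not_less_Least by (metis dvd_mult)
    qed
  qed
  ultimately have "c dvd coeff A i * coeff B j" by (simp only: dvd_add_left_iff[OF rest])
  moreover have "vars (coeff A i) \<subseteq> V" "vars (coeff B j) \<subseteq> V"
    using vars_coeff_upoly[of n a i] vars_coeff_upoly[of n b j] ab(1,2) unfolding A_def B_def by blast+
  ultimately show False using c(3) i j unfolding rel_prime_def by blast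
qed

text \<open>Division with remainder in \<open>x\<^sub>n\<close> after multiplying the dividend by a power of the leading
  coefficient; the point is that quotient and remainder stay within the given variables.\<close>

lemma pseudo_division:
  assumes r: "r \<noteq> 0" "vars r \<subseteq> V" and n: "n \<in> V" and x: "vars x \<subseteq> V"
  shows "\<exists>k s t. lead_coeff (upoly n r) ^ k * x = s * r + t \<and> (t = 0 \<or> vdeg n t < vdeg n r)
    \<and> vars s \<subseteq> V \<and> vars t \<subseteq> V"
  using x
proof (induction "vdeg n x" arbitrary: x rule: less_induct)
  case less
  let ?l = "lead_coeff (upoly n r)"
  show ?case
  proof (cases "vdeg n x < vdeg n r")
    case True
    then show ?thesis
      by (intro exI[of _ 0] exI[of _ "0 :: 'a mpoly"] exI[of _ x]) (use less.prems in auto)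
  next
    case False
    define d e where "d = vdeg n x" and "e = vdeg n r"
    define a where "a = lead_coeff (upoly n x)"
    define y where "y = a * Var n ^ (d - e)"
    define x' where "x' = ?l * x - y * r"
    have free: "n \<notin> vars ?l" "n \<notin> vars a"
      using vars_coeff_upoly[of n r] vars_coeff_upoly[of n x] unfolding a_def by blast+
    have lV: "vars ?l \<subseteq> V" and aV: "vars a \<subseteq> V"
      using vars_coeff_upoly[of n r] vars_coeff_upoly[of n x] less.prems r unfolding a_def by blast+
    have powV: "vars (Var n ^ k :: 'a mpoly) \<subseteq> V" for k
    proof (induction k)
      case (Suc k)
      then show ?case using n vars_mult_subset[of "Var n :: 'a mpoly" "Var n ^ k"] by auto
    qed auto
    have yV: "vars y \<subseteq> V"
      unfolding y_def using vars_mult_subset[of a "Var n ^ (d - e)"] aV powV[of "d-e"] by auto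
    have x'V: "vars x' \<subseteq> V"
      using vars_add[of "?l * x" "(- y) * r"] vars_mult_subset[of ?l x]
         vars_mult_subset[of "- y" r] vars_mult_subset[of "- 1" y] lV yV r less.prems
         vars_Const[of "- 1 :: 'a"]
      unfolding x'_def by (simp add: Const.hom_uminus Const.hom_one) blast
    have upoly_Var: "upoly n (Var n :: 'a mpoly) = [:0, 1:]"
      by (simp add: upoly_def comm_ring_hom_const_poly_Const)
    have ux': "upoly n x' = [:?l:] * upoly n x - [:a:] * [:0, 1:] ^ (d - e) * upoly n r"
      using free by (simp add: x'_def y_def upoly.hom_minus upoly.hom_mult upoly.hom_power upoly_free upoly_Var)
    have mon: "[:a:] * [:0, 1:] ^ (d - e) = Polynomial.monom a (d - e)"
      by (simp add: monom_altdef)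
    have "Polynomial.degree (upoly n x') \<le> d"
      unfolding ux' mon
      by (rule degree_diff_le)
         (use False in \<open>auto simp: d_def e_def degree_monom_eq intro!: order.trans[OF degree_mult_le] 
             order.trans[OF add_mono[OF degree_monom_le order_refl]]\<close>)
    moreover have "coeff (upoly n x') d = 0"
    proof -
      have "coeff ([:?l:] * upoly n x) d = ?l * a" by (simp add: a_def d_def)
      moreover have "coeff (Polynomial.monom a (d - e) * upoly n r) d = a * ?l"
        using False by (simp add: coeff_monom_mult d_def e_def)
      ultimately show ?thesis unfolding ux' mon by (simp only: coeff_diff mult.commute[of a] diff_self)
    qed
    ultimately have deg: "x' = 0 \<or> vdeg n x' < d"
      by (metis le_neq_implies_less leading_coeff_0_iff upoly_0_iff)
    have "\<exists>k s t. ?l ^ k * x' = s * r + t \<and> (t = 0 \<or> vdeg n t < vdeg n r) \<and> vars s \<subseteq> V \<and> vars t \<subseteq> V"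
    proof (cases "x' = 0")
      case True
      then show ?thesis 
        by (intro exI[of _ 0] exI[of _ "0 :: 'a mpoly"]) auto
    next
      case False
      then show ?thesis using deg less.hyps[of x'] x'V d_def by blast
    qed
    then obtain k s t where *: "?l ^ k * x' = s * r + t" "t = 0 \<or> vdeg n t < vdeg n r"
      "vars s \<subseteq> V" "vars t \<subseteq> V" by blast
    have "?l ^ Suc k * x = (s + ?l ^ k * y) * r + t"
      using *(1) unfolding x'_def by (simp add: algebra_simps)
    moreover have "vars (s + ?l ^ k * y) \<subseteq> V"
    proof -
      have "vars (?l ^ k) \<subseteq> V"
      proof (induction k)
        case (Suc k)
        then show ?case using lV vars_mult_subset[of ?l "?l ^ k"] by auto
      qed auto
      then show ?thesis
        using vars_add[of s "?l ^ k * y"] vars_mult_subset[of "?l ^ k" y] *(3) yV by blast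
    qed
    ultimately show ?thesis using * by blast
  qed
qed

lemma irreducible_not_unit: "Factorial_Ring.irreducible q \<Longrightarrow> \<not> q dvd 1"
  and irreducible_nonzero: "Factorial_Ring.irreducible q \<Longrightarrow> q \<noteq> 0"
  by (auto simp: Factorial_Ring.irreducible_def)

text \<open>The induction step: primality of irreducible polynomials passes from the variables \<open>V\<close> to the
  variables \<open>insert n V\<close>.\<close>

context
  fixes V :: "nat set" and n :: nat
  assumes IH: "\<And>p :: 'k::field mpoly. Factorial_Ring.irreducible p \<Longrightarrow> vars p \<subseteq> V \<Longrightarrow> rel_prime V p"
    and n: "n \<notin> V"
begin

text \<open>Peel off the irreducible factors of \<open>c\<close> one at a time; each remains prime with the additional variable
  and does not divide the primitive polynomial \<open>g\<close>.\<close>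

lemma primitive_cancel:
  fixes c :: "'k mpoly"
  assumes g: "vars g \<subseteq> insert n V"
      "\<And>p. Factorial_Ring.irreducible p \<Longrightarrow> vars p \<subseteq> V \<Longrightarrow> \<not> p dvd g"
    and "c \<noteq> 0" "vars c \<subseteq> V" "vars s \<subseteq> insert n V" "c dvd g * s"
  shows "c dvd s"
  using assms(3-6)
proof (induction "tdeg c" arbitrary: c s rule: less_induct)
  case less
  show ?case
  proof (cases "c dvd 1 \<or> s = 0")
    case True
    then show ?thesis by (auto intro: dvd_trans)
  next
    case False
    then obtain p where p: "Factorial_Ring.irreducible p" "p dvd c"
      using irreducible_factor less.prems by blast
    then obtain c' where c': "c = p * c'" by (elim dvdE)
    have nz: "p \<noteq> 0" "c' \<noteq> 0" using less.prems c' by auto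
    have V: "vars p \<subseteq> V" "vars c' \<subseteq> V" using vars_mult[OF nz] c' less.prems by auto
    have "rel_prime (insert n V) p" by (rule rel_prime_insert[OF V(1) n IH[OF p(1) V(1)]])
    moreover have "p dvd g * s" using p(2) less.prems(4) by (rule dvd_trans)
    ultimately have "p dvd s" 
      using g(2)[OF p(1) V(1)] g(1) less.prems(3) unfolding rel_prime_def by blast
    then obtain s' where s': "s = p * s'" by (elim dvdE)
    then have s'nz: "s' \<noteq> 0" using False by auto
    have "c' dvd g * s'" using less.prems(4) nz unfolding c' s' 
      by (simp add: mult.left_commute[of g])
    moreover have "tdeg c' < tdeg c" 
      using tdeg_mult[OF nz] tdeg_pos[OF nz(1) irreducible_not_unit[OF p(1)]] c' by simp
    ultimately have "c' dvd s'"
      using less.hyps[of c' s'] nz V vars_mult[OF nz(1) s'nz] less.prems(3) s' by auto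
    then show ?thesis unfolding c' s' by simp
  qed
qed

lemma primitive_part:
  fixes r :: "'k mpoly"
  assumes "r \<noteq> 0"
  shows "\<exists>c r0. r = c * r0 \<and> vars c \<subseteq> V \<and> (\<forall>p. Factorial_Ring.irreducible p \<longrightarrow> vars p \<subseteq> V \<longrightarrow> \<not> p dvd r0)"
  using assms
proof (induction "tdeg r" arbitrary: r rule: less_induct)
  case less
  show ?case
  proof (cases "\<exists>p. Factorial_Ring.irreducible p \<and> vars p \<subseteq> V \<and> p dvd r")
    case True
    then obtain p r' where p: "Factorial_Ring.irreducible p" "vars p \<subseteq> V" "r = p * r'"
      by (auto simp: dvd_def)
    then have nz: "p \<noteq> 0" "r' \<noteq> 0" using less.prems by auto
    have "tdeg r' < tdeg r" 
      using tdeg_mult[OF nz] tdeg_pos[OF nz(1) irreducible_not_unit[OF p(1)]] p(3) by simp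
    then obtain c r0 where *: "r' = c * r0" "vars c \<subseteq> V" 
        "\<forall>p. Factorial_Ring.irreducible p \<longrightarrow> vars p \<subseteq> V \<longrightarrow> \<not> p dvd r0"
      using less.hyps[of r'] nz by blast
    then show ?thesis
      by (intro exI[of _ "p * c"] exI[of _ r0])
         (use p vars_mult_subset[of p c] in \<open>auto simp: mult_ac\<close>)
  next
    case False
    then show ?thesis by (intro exI[of _ 1] exI[of _ r]) auto
  qed
qed

text \<open>A nonzero element of the ideal \<open>(q, a)\<close> of least degree in \<open>x\<^sub>n\<close> divides, up to content, both \<open>q\<close>
  and \<open>a\<close>. If its degree were positive, its primitive part would be a common divisor that is not a unit.\<close>

lemma bezout_rel:
  fixes q :: "'k mpoly"
  assumes q: "Factorial_Ring.irreducible q" "vars q \<subseteq> insert n V"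
    and a: "vars a \<subseteq> insert n V" "\<not> q dvd a"
  shows "\<exists>u s. u * q + s * a \<noteq> 0 \<and> vars (u * q + s * a) \<subseteq> V"
proof -
  define I where "I = {r. r \<noteq> 0 \<and> vars r \<subseteq> insert n V \<and> (\<exists>u s. r = u * q + s * a)}"
  have "q \<in> I"
  proof -
    have "q = 1 * q + 0 * a" by simp
    then show ?thesis unfolding I_def using q irreducible_nonzero[OF q(1)] by blast
  qed
  then obtain r where r: "r \<in> I" and min: "\<And>r'. r' \<in> I \<Longrightarrow> vdeg n r \<le> vdeg n r'"
    using ex_has_least_nat[of "\<lambda>r. r \<in> I" q "vdeg n"] by blast
  from r obtain u s where rus: "r = u * q + s * a" and rnz: "r \<noteq> 0" and rV: "vars r \<subseteq> insert n V"
    unfolding I_def by blast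
  have "vdeg n r = 0"
  proof (rule ccontr)
    assume pos: "vdeg n r \<noteq> 0"
    obtain c r0 where r0: "r = c * r0" "vars c \<subseteq> V" 
        "\<And>p. Factorial_Ring.irreducible p \<Longrightarrow> vars p \<subseteq> V \<Longrightarrow> \<not> p dvd r0"
      using primitive_part[OF rnz] by blast
    have nz: "c \<noteq> 0" "r0 \<noteq> 0" using r0(1) rnz by auto
    have r0V: "vars r0 \<subseteq> insert n V" using vars_mult[OF nz] r0 rV by auto
    have r0n: "n \<in> vars r0" 
      using pos vars_mult[OF nz] r0(1,2) n vdeg_0_iff[of n r] by auto
    have dvd: "r0 dvd x" if xI: "\<exists>u s. x = u * q + s * a" and xV: "vars x \<subseteq> insert n V" for x
    proof -
      let ?l = "lead_coeff (upoly n r)"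
      obtain k s' t where div: "?l ^ k * x = s' * r + t" "t = 0 \<or> vdeg n t < vdeg n r" 
        "vars s' \<subseteq> insert n V" "vars t \<subseteq> insert n V"
        using pseudo_division[OF rnz rV insertI1 xV] by blast
      from xI obtain u' w where x: "x = u' * q + w * a" by blast
      have "t = (?l ^ k * u' - s' * u) * q + (?l ^ k * w - s' * s) * a"
        using div(1) unfolding x rus by (simp add: algebra_simps)
      then have "t = 0" using min[of t] div(2,4) unfolding I_def by fastforce
      then have eq: "?l ^ k * x = r0 * (s' * c)" using div(1) r0(1) by (simp add: mult_ac)
      have lV: "vars ?l \<subseteq> V" using vars_coeff_upoly[of n r] rV by blast
      have "vars (?l ^ k) \<subseteq> V"
      proof (induction k)
        case (Suc k)
        then show ?case using lV vars_mult_subset[of ?l "?l ^ k"] by auto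
      qed auto
      moreover have lnz: "?l ^ k \<noteq> 0" using rnz by simp
      moreover have "vars (s' * c) \<subseteq> insert n V"
        using vars_mult_subset[of s' c] div(3) r0(2) by blast
      ultimately have "?l ^ k dvd s' * c"
        using primitive_cancel[OF r0V r0(3)] eq by (metis dvd_triv_left)
      then obtain y where "s' * c = ?l ^ k * y" by (elim dvdE)
      then have "?l ^ k * x = ?l ^ k * (r0 * y)" using eq by (simp add: mult_ac)
      then have "x = r0 * y" using lnz by auto
      then show ?thesis by simp
    qed
    have "q = 1 * q + 0 * a" "a = 0 * q + 1 * a" by simp_all
    then have "r0 dvd q" "r0 dvd a" using dvd q(2) a(1) by blast+
    from \<open>r0 dvd q\<close> obtain y where y: "q = r0 * y" by (elim dvdE)
    have "\<not> r0 dvd 1" using r0n unfolding unit_iff by auto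
    then have "y dvd 1" using q(1) y Factorial_Ring.irreducibleD by blast
    then have "q dvd r0" unfolding y using mult_dvd_mono[OF dvd_refl, of y 1 r0] by simp
    then show False using a(2) \<open>r0 dvd a\<close> dvd_trans by blast
  qed
  then have "vars r \<subseteq> V" using rV vdeg_0_iff[of n r] by auto
  then show ?thesis using rnz rus by blast
qed

lemma rel_prime_step:
  fixes q :: "'k mpoly"
  assumes q: "Factorial_Ring.irreducible q" "vars q \<subseteq> insert n V"
  shows "rel_prime (insert n V) q"
proof (cases "n \<in> vars q")
  case False
  then have "vars q \<subseteq> V" using q by auto
  then show ?thesis using rel_prime_insert IH q n by blast
next
  case True
  show ?thesis unfolding rel_prime_def
  proof (intro allI impI)
    fix a b assume ab: "vars a \<subseteq> insert n V" "vars b \<subseteq> insert n V" "q dvd a * b"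
    show "q dvd a \<or> q dvd b"
    proof (rule ccontr)
      assume neg: "\<not> (q dvd a \<or> q dvd b)"
      obtain u s where us: "u * q + s * a \<noteq> 0" "vars (u * q + s * a) \<subseteq> V"
        using bezout_rel[OF q ab(1)] neg by blast
      define r where "r = u * q + s * a"
      have "r * b = q * (u * b) + s * (a * b)" unfolding r_def by (simp add: algebra_simps)
      then have "q dvd r * b" using ab(3) by simp
      then obtain y where y: "r * b = q * y" by (elim dvdE)
      have bnz: "b \<noteq> 0" and rnz: "r \<noteq> 0" using neg us r_def by auto
      then have ynz: "y \<noteq> 0" using y by auto
      have "vars y \<subseteq> insert n V"
        using vars_mult[OF rnz bnz] vars_mult[OF irreducible_nonzero[OF q(1)] ynz] y us(2) ab(2)
        unfolding r_def by auto
      moreover have "\<not> p dvd q" if p: "Factorial_Ring.irreducible p" "vars p \<subseteq> V" for p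
      proof
        assume "p dvd q"
        then obtain w where w: "q = p * w" by (elim dvdE)
        then have "w dvd 1" using Factorial_Ring.irreducibleD[OF q(1) w] irreducible_not_unit[OF p(1)] by auto
        then have "vars w = {}" unfolding unit_iff by auto
        then show False using True w vars_mult_subset[of p w] p(2) n by auto
      qed
      ultimately have "r dvd y"
        using primitive_cancel[OF q(2), of r y] rnz us(2) y unfolding r_def by (metis dvd_triv_left)
      then obtain z where "y = r * z" by (elim dvdE)
      then have "r * b = r * (q * z)" using y by (simp add: mult_ac)
      then have "b = q * z" using rnz by simp
      then show False using neg by simp
    qed
  qed
qed

end

lemma irreducible_rel_prime:
  assumes "finite V" "Factorial_Ring.irreducible q" "vars q \<subseteq> V"
  shows "rel_prime V (q :: 'k::field mpoly)"
  using assms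
proof (induction V arbitrary: q rule: finite_induct)
  case empty
  then obtain c where "q = Const c" using vars_empty_iff[of q] by auto
  then have False using irreducible_not_unit[OF empty(1)] irreducible_nonzero[OF empty(1)]
    by (auto simp: unit_iff)
  then show ?case ..
next
  case (insert n V)
  then show ?case using rel_prime_step[of V n] by blast
qed

theorem irreducible_imp_prime:
  fixes q :: "'k::field mpoly"
  assumes "Factorial_Ring.irreducible q"
  shows "Factorial_Ring.prime_elem q"
proof (rule prime_elemI)
  fix a b assume "q dvd a * b"
  then show "q dvd a \<or> q dvd b"
    using irreducible_rel_prime[of "vars q \<union> vars a \<union> vars b" q] assms unfolding rel_prime_def by auto
qed (use irreducible_nonzero[OF assms] irreducible_not_unit[OF assms] in auto)

text \<open>Elimination of one variable: the substitute for a resultant of \<open>q\<close> and \<open>a\<close>.\<close>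

lemma bezout:
  fixes q :: "'k::field mpoly"
  assumes "Factorial_Ring.irreducible q" "\<not> q dvd a"
  shows "\<exists>u s. u * q + s * a \<noteq> 0 \<and> n \<notin> vars (u * q + s * a)"
  using bezout_rel[of "vars q \<union> vars a - {n}" n q a] irreducible_rel_prime[of "vars q \<union> vars a - {n}"] assms
  by auto

lemma prime_factor:
  assumes "p \<noteq> 0" "\<not> p dvd 1"
  shows "\<exists>q. Factorial_Ring.prime_elem q \<and> q dvd (p :: 'k::field mpoly)"
  using irreducible_factor[OF assms] irreducible_imp_prime by blast

text \<open>Each prime factor of \<open>c\<close> misses some \<open>g i\<close>, hence divides \<open>v\<close> and can be cancelled.\<close>

lemma dvd_of_common_multiple:
  fixes c :: "'k::field mpoly"
  assumes g: "\<And>q. Factorial_Ring.prime_elem q \<Longrightarrow> \<exists>i\<in>I. \<not> q dvd g i"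
    and "c \<noteq> 0" "\<And>i. i \<in> I \<Longrightarrow> c dvd g i * v"
  shows "c dvd v"
  using assms(2,3)
proof (induction "tdeg c" arbitrary: c v rule: less_induct)
  case less
  show ?case
  proof (cases "c dvd 1")
    case True
    then show ?thesis by (rule dvd_trans) simp
  next
    case False
    then obtain p c' where p: "Factorial_Ring.prime_elem p" and c: "c = p * c'"
      using prime_factor less.prems(1) by (metis dvdE)
    then have nz: "p \<noteq> 0" "c' \<noteq> 0" using less.prems(1) by auto
    obtain i where i: "i \<in> I" "\<not> p dvd g i" using g p by blast
    have "p dvd g i * v" using less.prems(2)[OF i(1)] c by (metis dvd_mult_left)
    then have "p dvd v" using prime_elem_dvd_multD[OF p] i(2) by blast
    then obtain v' where v: "v = p * v'" by (elim dvdE)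
    have "c' dvd g i * v'" if "i \<in> I" for i
      using less.prems(2)[OF that] nz unfolding c v by (simp add: mult.left_commute[of "g i"])
    moreover have "tdeg c' < tdeg c"
      using tdeg_mult[OF nz] tdeg_pos[OF nz(1) prime_elem_not_unit[OF p]] c by simp
    ultimately have "c' dvd v'" using less.hyps nz by blast
    then show ?thesis unfolding c v by simp
  qed
qed

lemma no_common_factor_iff:
  assumes "\<exists>i\<le>m. g i \<noteq> 0"
  shows "no_common_factor m g \<longleftrightarrow> (\<forall>q. Factorial_Ring.prime_elem q \<longrightarrow> (\<exists>i\<le>m. \<not> q dvd g i))"
proof
  assume *: "\<forall>q. Factorial_Ring.prime_elem q \<longrightarrow> (\<exists>i\<le>m. \<not> q dvd g i)"
  show "no_common_factor m g" unfolding no_common_factor_def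
  proof (intro allI impI, rule ccontr)
    fix p assume p: "\<forall>i\<le>m. p dvd g i" "\<not> p dvd 1"
    have "p \<noteq> 0" using p(1) assms by auto
    then obtain q where "Factorial_Ring.prime_elem q" "q dvd p" using prime_factor p(2) by blast
    then show False using * p(1) dvd_trans by blast
  qed
qed (unfold no_common_factor_def, use prime_elem_not_unit in blast)

text \<open>A tuple without common factor divides every tuple that is proportional to it. Hence
  reduced representatives of a rational map are unique up to constants, and the degree is well defined.\<close>

lemma reduced_multiple:
  assumes g: "no_common_factor m g" "\<exists>i\<le>m. g i \<noteq> 0"
    and gh: "\<And>i j. i \<le> m \<Longrightarrow> j \<le> m \<Longrightarrow> g i * h j = g j * h i"
  shows "\<exists>s. \<forall>i\<le>m. h i = s * g i"
proof -
  obtain j where j: "j \<le> m" "g j \<noteq> 0" using g by blast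
  have "g j dvd h j"
  proof (rule dvd_of_common_multiple[of "{..m}" g])
    show "\<exists>i\<in>{..m}. \<not> q dvd g i" if "Factorial_Ring.prime_elem q" for q
      using no_common_factor_iff[OF g(2)] g(1) that by (metis atMost_iff)
    show "g j dvd g i * h j" if "i \<in> {..m}" for i
      using gh[of i j] that j(1) by (metis atMost_iff dvd_triv_left)
  qed (fact j(2))
  then obtain s where s: "h j = g j * s" by (elim dvdE)
  have "h i = s * g i" if "i \<le> m" for i
  proof -
    have "g j * h i = g j * (s * g i)" using gh[OF that j(1)] s by (metis mult.left_commute mult.commute)
    then show ?thesis by (simp only: mult_left_cancel[OF j(2)])
  qed
  then show ?thesis by blast
qed

section \<open>Homogeneous polynomials\<close>

abbreviation mdeg :: "(nat \<Rightarrow>\<^sub>0 nat) \<Rightarrow> nat" where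
  "mdeg t \<equiv> (\<Sum>i\<in>Poly_Mapping.keys t. Poly_Mapping.lookup t i)"

lemma graded_single: "graded (Poly_Mapping.single t c) = Polynomial.monom (Poly_Mapping.single t c) (mdeg t)"
proof -
  have "[:0, Var i:] ^ n = Polynomial.monom (Var i ^ n :: 'a mpoly) n" for i n
  proof -
    have "[:0, Var i:] = Polynomial.monom (Var i :: 'a mpoly) 1" by (simp add: monom_altdef)
    then show ?thesis by (simp add: monom_power)
  qed
  moreover have "(\<Prod>i\<in>I. Polynomial.monom (f i) (n i)) = Polynomial.monom (\<Prod>i\<in>I. f i) (\<Sum>i\<in>I. n i)"
    for I :: "nat set" and f :: "nat \<Rightarrow> 'a mpoly" and n
    by (induction I rule: infinite_finite_induct) (simp_all add: mult_monom monom_0)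
  moreover have "Const c * (\<Prod>i\<in>Poly_Mapping.keys t. Var i ^ Poly_Mapping.lookup t i) = Poly_Mapping.single t c"
    using ev_Const_Var[of "Poly_Mapping.single t c"] by (simp add: ev_single[OF comm_ring_hom_Const])
  ultimately show ?thesis
    unfolding graded_def by (simp add: ev_single[OF comm_ring_hom_const_poly_Const] smult_monom)
qed

lemma graded_expand:
  "graded p = (\<Sum>t\<in>Poly_Mapping.keys p. Polynomial.monom (Poly_Mapping.single t (Poly_Mapping.lookup p t)) (mdeg t))"
proof -
  have "graded p = graded (\<Sum>t\<in>Poly_Mapping.keys p. Poly_Mapping.single t (Poly_Mapping.lookup p t))"
    by (simp flip: mpoly_expand)
  then show ?thesis by (simp add: graded.hom_sum graded_single)
qed

lemma lookup_coeff_graded: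
  "Poly_Mapping.lookup (coeff (graded p) k) t = (if mdeg t = k then Poly_Mapping.lookup p t else 0)"
proof -
  have "Poly_Mapping.lookup (coeff (graded p) k) t =
    (\<Sum>s\<in>Poly_Mapping.keys p. if s = t then if mdeg t = k then Poly_Mapping.lookup p t else 0 else 0)"
    unfolding graded_expand coeff_sum lookup_sum by (rule sum.cong) (auto simp: lookup_single when_def)
  then show ?thesis by (auto simp: in_keys_iff)
qed

lemma homogeneous_iff:
  "homogeneous m d p \<longleftrightarrow> vars p \<subseteq> {..m} \<and> graded p = Polynomial.monom p d"
proof -
  have "graded p = Polynomial.monom p d \<longleftrightarrow> (\<forall>t\<in>Poly_Mapping.keys p. mdeg t = d)"
  proof
    assume eq: "graded p = Polynomial.monom p d"
    show "\<forall>t\<in>Poly_Mapping.keys p. mdeg t = d"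
    proof (rule ballI, rule ccontr)
      fix t assume t: "t \<in> Poly_Mapping.keys p" "mdeg t \<noteq> d"
      then show False using lookup_coeff_graded[of p "mdeg t" t] unfolding eq by (auto simp: in_keys_iff)
    qed
  next
    assume *: "\<forall>t\<in>Poly_Mapping.keys p. mdeg t = d"
    show "graded p = Polynomial.monom p d"
      by (intro poly_eqI poly_mapping_eqI) (use * in \<open>auto simp: lookup_coeff_graded in_keys_iff\<close>)
  qed
  then show ?thesis unfolding homogeneous_def vars_def by blast
qed

lemma homogeneous_0 [simp]: "homogeneous m d 0"
  by (simp add: homogeneous_def)

lemma homogeneous_add: "homogeneous m d p \<Longrightarrow> homogeneous m d q \<Longrightarrow> homogeneous m d (p + q)"
  unfolding homogeneous_iff using vars_add[of p q] by (auto simp: graded.hom_add add_monom)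

lemma homogeneous_sum: "(\<And>i. i \<in> A \<Longrightarrow> homogeneous m d (f i)) \<Longrightarrow> homogeneous m d (\<Sum>i\<in>A. f i)"
  by (induction A rule: infinite_finite_induct) (auto intro: homogeneous_add)

lemma homogeneous_mult: "homogeneous m a p \<Longrightarrow> homogeneous m b q \<Longrightarrow> homogeneous m (a + b) (p * q)"
  unfolding homogeneous_iff using vars_mult_subset[of p q] by (auto simp: graded.hom_mult mult_monom)

lemma homogeneous_Const: "homogeneous m 0 (Const c)"
  by (simp add: homogeneous_iff graded_def comm_ring_hom_const_poly_Const monom_0)

lemma homogeneous_Var: "i \<le> m \<Longrightarrow> homogeneous m 1 (Var i)"
  by (simp add: homogeneous_iff graded_def comm_ring_hom_const_poly_Const monom_altdef)

lemma homogeneous_degree_unique: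
  "homogeneous m a p \<Longrightarrow> homogeneous m b p \<Longrightarrow> p \<noteq> 0 \<Longrightarrow> a = b"
  unfolding homogeneous_iff by (metis degree_monom_eq)

lemma homogeneous_degree_0: "homogeneous m 0 p \<Longrightarrow> \<exists>c. p = Const c"
  unfolding homogeneous_iff tdeg_0_iff[symmetric] by (metis degree_monom_le le_zero_eq)

text \<open>The order at \<open>0\<close> and the degree are both additive and agree on the product, so they agree on each
  factor.\<close>

lemma monom_factor:
  fixes P Q :: "'a::idom poly"
  assumes "P * Q = Polynomial.monom c d" "c \<noteq> 0"
  shows "P = Polynomial.monom (lead_coeff P) (Polynomial.degree P)"
proof -
  have PQ: "P * Q \<noteq> 0" using assms by simp
  then have nz: "P \<noteq> 0" "Q \<noteq> 0" by auto
  have le: "Polynomial.order 0 R \<le> Polynomial.degree R" if "R \<noteq> 0" for R :: "'a poly"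
    by (rule order_degree[OF that])
  have "Polynomial.order 0 (P * Q) = d"
  proof -
    have "Polynomial.monom c d = Polynomial.smult c ([:- 0, 1:] ^ d)" by (simp add: monom_altdef)
    then show ?thesis using assms by (simp add: order_smult order_power_n_n[of 0 d, simplified])
  qed
  then have "Polynomial.order 0 P + Polynomial.order 0 Q = Polynomial.degree P + Polynomial.degree Q"
    using order_mult[OF PQ, of 0] degree_mult_eq[OF nz] assms by (simp add: degree_monom_eq)
  then have "Polynomial.order 0 P = Polynomial.degree P" using le[OF nz(1)] le[OF nz(2)] by linarith
  then have "[:0, 1:] ^ Polynomial.degree P dvd P" using order_1[of 0 P] by simp
  then have *: "Polynomial.monom 1 (Polynomial.degree P) dvd P" by (simp add: monom_altdef)
  show ?thesis
  proof (rule poly_eqI)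
    fix i
    show "coeff P i = coeff (Polynomial.monom (lead_coeff P) (Polynomial.degree P)) i"
      using * by (cases i "Polynomial.degree P" rule: linorder_cases)
        (auto simp: monom_1_dvd_iff' coeff_eq_0)
  qed
qed

lemma homogeneous_factor:
  assumes "homogeneous m d (p * q)" "p \<noteq> 0" "q \<noteq> 0"
  shows "homogeneous m (tdeg p) p"
proof -
  have "graded p * graded q = Polynomial.monom (p * q) d"
    using assms(1) by (simp add: homogeneous_iff graded.hom_mult)
  then have g: "graded p = Polynomial.monom (lead_coeff (graded p)) (tdeg p)"
    using monom_factor assms by (metis no_zero_divisors)
  then have "p = lead_coeff (graded p)" using poly_graded_1[of p] by (metis poly_monom power_one mult.right_neutral)
  then show ?thesis using g assms vars_mult[of p q] unfolding homogeneous_iff by auto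
qed

lemma ev_scale:
  assumes "homogeneous m d p"
  shows "ev \<phi> (\<lambda>i. x * g i) p = x ^ d * ev \<phi> g p"
proof -
  have "(\<Prod>i\<in>Poly_Mapping.keys t. (x * g i) ^ Poly_Mapping.lookup t i) =
      x ^ d * (\<Prod>i\<in>Poly_Mapping.keys t. g i ^ Poly_Mapping.lookup t i)" if "t \<in> Poly_Mapping.keys p" for t
    using assms that
    by (auto simp: homogeneous_def power_mult_distrib prod.distrib simp flip: power_sum)
  then show ?thesis
    unfolding ev_def sum_distrib_left by (intro sum.cong) (auto simp: mult_ac)
qed

lemma homogeneous_subst:
  assumes p: "homogeneous m a p" and g: "\<And>i. i \<le> m \<Longrightarrow> homogeneous m b (g i)"
  shows "homogeneous m (a * b) (subst g p)"
proof -
  have vp: "vars p \<subseteq> {..m}" using p by (simp add: homogeneous_iff)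
  have "graded (subst g p) = ev (\<lambda>c. graded (Const c)) (\<lambda>i. graded (g i)) p"
    unfolding subst_eq_ev by (rule hom_ev[OF comm_ring_hom_graded])
  also have "\<dots> = ev (\<lambda>c. [:Const c:]) (\<lambda>i. Polynomial.monom 1 b * [:g i:]) p"
  proof -
    have c: "(\<lambda>c. graded (Const c)) = (\<lambda>c :: 'a. [:Const c:])"
      by (simp add: fun_eq_iff graded_def comm_ring_hom_const_poly_Const)
    have v: "graded (g i) = Polynomial.monom 1 b * [:g i:]" if "i \<in> vars p" for i
    proof -
      have "i \<le> m" using that vp by auto
      then show ?thesis using g[of i] by (simp add: homogeneous_iff smult_monom)
    qed
    show ?thesis unfolding c by (rule ev_cong) (rule v)
  qed
  also have "\<dots> = Polynomial.monom 1 b ^ a * ev (\<lambda>c. [:Const c:]) (\<lambda>i. [:g i:]) p"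
    by (rule ev_scale[OF p])
  also have "ev (\<lambda>c. [:Const c:]) (\<lambda>i. [:g i:]) p = [:subst g p:]"
    unfolding subst_eq_ev by (rule hom_ev[OF comm_ring_hom_const_poly, symmetric])
  finally have "graded (subst g p) = Polynomial.monom (subst g p) (a * b)"
    by (simp add: monom_power smult_monom mult.commute)
  moreover have "vars (subst g p) \<subseteq> {..m}"
    unfolding subst_eq_ev by (rule vars_ev_subset) (use g vp in \<open>auto simp: homogeneous_iff\<close>)
  ultimately show ?thesis by (simp add: homogeneous_iff)
qed

lemma comm_ring_hom_subst: "comm_ring_hom (subst g)"
  unfolding subst_eq_ev by (rule comm_ring_hom_ev[OF comm_ring_hom_Const])

interpretation subst: comm_ring_hom "subst g" for g
  by (rule comm_ring_hom_subst)

lemma subst_Const [simp]: "subst g (Const c) = Const c"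
  and subst_Var [simp]: "subst g (Var i) = g i"
  and subst_Var_right [simp]: "subst Var p = p"
  by (simp_all add: subst_eq_ev comm_ring_hom_Const)

lemma subst_subst: "subst g (subst f p) = subst (\<lambda>i. subst g (f i)) p"
  unfolding subst_eq_ev using hom_ev[OF comm_ring_hom_ev[OF comm_ring_hom_Const], of g Const f p]
  by (simp add: comm_ring_hom_Const)

lemma subst_cong: "(\<And>i. i \<in> vars p \<Longrightarrow> g i = g' i) \<Longrightarrow> subst g p = subst g' p"
  unfolding subst_eq_ev by (rule ev_cong)

lemma subst_scale:
  assumes "homogeneous m d p" "\<And>i. i \<le> m \<Longrightarrow> g i = x * h i"
  shows "subst g p = x ^ d * subst h p"
proof -
  have "subst g p = subst (\<lambda>i. x * h i) p"
    by (rule subst_cong) (use assms in \<open>auto simp: homogeneous_iff\<close>)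
  then show ?thesis by (simp add: subst_eq_ev ev_scale[OF assms(1)])
qed

section \<open>Rational maps and their degrees\<close>

lemma hom_tuplesE:
  assumes "g \<in> hom_tuples m"
  obtains d j where "\<And>i. i \<le> m \<Longrightarrow> homogeneous m d (g i)" "j \<le> m" "g j \<noteq> 0" "g \<in> hom_tuples_deg m d"
  using assms unfolding hom_tuples_def hom_tuples_deg_def by blast

lemma equiv_proj_rel: "equiv (hom_tuples m) (proj_rel m :: ((nat \<Rightarrow> 'k::field mpoly) \<times> _) set)"
  (is "equiv ?A ?R")
proof (rule equivI)
  show "refl_on ?A ?R" "sym ?R" "?R \<subseteq> ?A \<times> ?A"
    unfolding refl_on_def proj_rel_def sym_def by (auto simp: mult.commute)
  show "trans ?R"
  proof (rule transI)
    fix g h k :: "nat \<Rightarrow> 'k mpoly"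
    assume gh: "(g, h) \<in> proj_rel m" and hk: "(h, k) \<in> proj_rel m"
    then obtain j where j: "j \<le> m" "h j \<noteq> 0" unfolding proj_rel_def by (auto elim: hom_tuplesE)
    have "g i * k l = g l * k i" if "i \<le> m" "l \<le> m" for i l
    proof -
      have e: "g i * h j = g j * h i" "h i * k l = h l * k i" "g j * h l = g l * h j"
        using gh hk that j(1) unfolding proj_rel_def by blast+
      have "h j * (g i * k l) = (g i * h j) * k l" by (simp only: mult_ac)
      also have "\<dots> = g j * (h i * k l)" unfolding e(1) by (simp only: mult.assoc)
      also have "\<dots> = (g j * h l) * k i" unfolding e(2) by (simp only: mult.assoc)
      also have "\<dots> = h j * (g l * k i)" unfolding e(3) by (simp only: mult_ac)
      finally show ?thesis by (simp only: mult_left_cancel[OF j(2)])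
    qed
    then show "(g, k) \<in> proj_rel m" using gh hk unfolding proj_rel_def by blast
  qed
qed

lemma proj_rel_refl: "g \<in> hom_tuples m \<Longrightarrow> (g, g) \<in> proj_rel m"
  by (simp add: proj_rel_def mult.commute)

lemma proj_rel_sym: "(g, h) \<in> proj_rel m \<Longrightarrow> (h, g) \<in> proj_rel m"
  using equiv_proj_rel[of m] by (meson equivE symE)

lemma proj_rel_trans: "(g, h) \<in> proj_rel m \<Longrightarrow> (h, k) \<in> proj_rel m \<Longrightarrow> (g, k) \<in> proj_rel m"
  using equiv_proj_rel[of m] by (meson equivE transE)

lemma class_eqI: "(g, h) \<in> proj_rel m \<Longrightarrow> proj_rel m `` {g} = proj_rel m `` {h}"
  by (rule equiv_class_eq[OF equiv_proj_rel])

lemma rational_map_class: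
  assumes "F \<in> rational_maps m" "g \<in> F"
  shows "F = proj_rel m `` {g}" "g \<in> hom_tuples m"
proof -
  obtain h where h: "F = proj_rel m `` {h}" using assms unfolding rational_maps_def by (auto elim: quotientE)
  then have hg: "(h, g) \<in> proj_rel m" using assms(2) by simp
  show "F = proj_rel m `` {g}" using class_eqI[OF hg] h by simp
  show "g \<in> hom_tuples m" using hg unfolding proj_rel_def by simp
qed

text \<open>A representative of least degree is reduced: a common factor of forms is a form, and dividing
  by it lowers the degree.\<close>

lemma reduced_representative:
  assumes "F \<in> rational_maps m"
  shows "\<exists>g d. g \<in> F \<and> g \<in> hom_tuples_deg m d \<and> no_common_factor m g"
proof -
  obtain g0 where g0: "g0 \<in> F" using assms unfolding rational_maps_def
    by (metis ex_in_conv equiv_proj_rel in_quotient_imp_non_empty)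
  then obtain d0 where "g0 \<in> hom_tuples_deg m d0" using rational_map_class[OF assms g0] by (auto elim: hom_tuplesE)
  then have ex: "\<exists>d. \<exists>g\<in>F. g \<in> hom_tuples_deg m d" using g0 by blast
  define d where "d = (LEAST d. \<exists>g\<in>F. g \<in> hom_tuples_deg m d)"
  obtain g where g: "g \<in> F" "g \<in> hom_tuples_deg m d"
    using LeastI_ex[OF ex] unfolding d_def by blast
  have "no_common_factor m g" unfolding no_common_factor_def
  proof (intro allI impI, rule ccontr)
    fix p assume p: "\<forall>i\<le>m. p dvd g i" "\<not> p dvd 1"
    then obtain k where k: "\<And>i. i \<le> m \<Longrightarrow> g i = p * k i" unfolding dvd_def by metis
    obtain j where j: "j \<le> m" "g j \<noteq> 0" and hom: "\<And>i. i \<le> m \<Longrightarrow> homogeneous m d (g i)"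
      using g(2) unfolding hom_tuples_deg_def by blast
    have pnz: "p \<noteq> 0" using j k by auto
    have deg: "tdeg p + tdeg (k i) = d \<and> homogeneous m (tdeg (k i)) (k i)" if "i \<le> m" "k i \<noteq> 0" for i
    proof -
      have *: "homogeneous m d (p * k i)" "homogeneous m d (k i * p)"
        using hom[OF that(1)] k[OF that(1)] by (simp_all add: mult.commute)
      have "homogeneous m (tdeg p + tdeg (k i)) (p * k i)"
        using homogeneous_factor[OF *(1) pnz that(2)] homogeneous_factor[OF *(2) that(2) pnz]
        by (rule homogeneous_mult)
      then show ?thesis
        using homogeneous_degree_unique[OF _ *(1)] homogeneous_factor[OF *(2) that(2) pnz] pnz that by simp
    qed
    have "tdeg p > 0" using tdeg_pos[OF pnz p(2)] .
    have kj: "k j \<noteq> 0" using j k by auto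
    define e where "e = d - tdeg p"
    have "e < d" using deg[OF j(1) kj] \<open>tdeg p > 0\<close> e_def by linarith
    have "homogeneous m e (k i)" if "i \<le> m" for i
      using deg[OF that] e_def by (cases "k i = 0") auto
    then have k_tuple: "k \<in> hom_tuples_deg m e" unfolding hom_tuples_deg_def using j kj by blast
    have "(g, k) \<in> proj_rel m"
      using g(2) k_tuple k unfolding proj_rel_def hom_tuples_def by (auto simp: mult_ac)
    then have "k \<in> F" using rational_map_class[OF assms g(1)] by blast
    then show False using not_less_Least[of e "\<lambda>d. \<exists>g\<in>F. g \<in> hom_tuples_deg m d"] \<open>e < d\<close> k_tuple
      unfolding d_def by blast
  qed
  then show ?thesis using g by blast
qed

lemma rat_degree_eq:
  assumes g: "g \<in> hom_tuples_deg m d" "no_common_factor m g"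
  shows "rat_degree m (proj_rel m `` {g}) = d"
  unfolding rat_degree_def
proof (rule the_equality)
  have gt: "g \<in> hom_tuples m" using g unfolding hom_tuples_def by blast
  then show "\<exists>h\<in>proj_rel m `` {g}. h \<in> hom_tuples_deg m d \<and> no_common_factor m h"
    using g proj_rel_refl by blast
  fix e assume "\<exists>h\<in>proj_rel m `` {g}. h \<in> hom_tuples_deg m e \<and> no_common_factor m h"
  then obtain h where h: "(g, h) \<in> proj_rel m" "h \<in> hom_tuples_deg m e" "no_common_factor m h" by blast
  have gnz: "\<exists>i\<le>m. g i \<noteq> 0" and hnz: "\<exists>i\<le>m. h i \<noteq> 0"
    using g(1) h(2) unfolding hom_tuples_deg_def by blast+
  obtain s where s: "\<forall>i\<le>m. h i = s * g i"
    using reduced_multiple[OF g(2) gnz, of h] h(1) unfolding proj_rel_def by blast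
  obtain s' where s': "\<forall>i\<le>m. g i = s' * h i"
    using reduced_multiple[OF h(3) hnz, of g] proj_rel_sym[OF h(1)] unfolding proj_rel_def by blast
  obtain j where j: "j \<le> m" "g j \<noteq> 0" using gnz by blast
  have "g j * 1 = g j * (s * s')" using s s' j by (metis mult.commute mult.left_commute mult.right_neutral)
  then have "1 = s * s'" using j by (metis mult_left_cancel)
  then have "s dvd 1" by (rule dvdI)
  then obtain c where c: "c \<noteq> 0" "s = Const c" unfolding unit_iff by blast
  have "homogeneous m (0 + d) (h j)"
    using homogeneous_mult[OF homogeneous_Const, of m d "g j" c] g(1) s j c unfolding hom_tuples_deg_def by simp
  moreover have "homogeneous m e (h j)" "h j \<noteq> 0"
    using h(2) s c j unfolding hom_tuples_deg_def by auto
  ultimately show "e = d" using homogeneous_degree_unique by fastforce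
qed

lemma subst_tuple:
  assumes "f \<in> hom_tuples_deg m a" "g \<in> hom_tuples_deg m b" "\<exists>i\<le>m. subst g (f i) \<noteq> 0"
  shows "(\<lambda>i. subst g (f i)) \<in> hom_tuples_deg m (a * b)"
  using assms homogeneous_subst unfolding hom_tuples_deg_def by blast

text \<open>With \<open>j\<close> such that \<open>g j \<noteq> 0\<close>, homogeneity turns the proportionality of \<open>g\<close> and \<open>g'\<close> into
  \<open>(g j)\<^sup>a f(g') = (g' j)\<^sup>a f(g)\<close>, where \<open>a\<close> is the degree of \<open>f\<close>. In particular the second composite
  cannot vanish.\<close>

lemma comp_right:
  assumes g: "(g, g') \<in> proj_rel m" and f: "f \<in> hom_tuples m"
    and nz: "\<exists>i\<le>m. subst g (f i) \<noteq> 0"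
  shows "((\<lambda>i. subst g (f i)), (\<lambda>i. subst g' (f i))) \<in> proj_rel m"
proof -
  obtain a where a: "\<And>i. i \<le> m \<Longrightarrow> homogeneous m a (f i)" "f \<in> hom_tuples_deg m a" by (rule hom_tuplesE[OF f]) blast
  obtain b j where b: "j \<le> m" "g j \<noteq> 0" "g \<in> hom_tuples_deg m b"
    using g unfolding proj_rel_def by (auto elim: hom_tuplesE)
  obtain b' j' where b': "j' \<le> m" "g' j' \<noteq> 0" "g' \<in> hom_tuples_deg m b'"
    using g unfolding proj_rel_def by (auto elim: hom_tuplesE)
  have cross: "g i * g' k = g k * g' i" if "i \<le> m" "k \<le> m" for i k
    using g that unfolding proj_rel_def by blast
  have "g' j \<noteq> 0" using cross[OF b(1) b'(1)] b b' by auto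
  have scale: "g j ^ a * subst g' (f i) = g' j ^ a * subst g (f i)" if "i \<le> m" for i
  proof -
    have "subst (\<lambda>i. g j * g' i) (f i) = g j ^ a * subst g' (f i)" by (rule subst_scale[OF a(1)[OF that]]) simp
    moreover have "subst (\<lambda>i. g j * g' i) (f i) = g' j ^ a * subst g (f i)"
      by (rule subst_scale[OF a(1)[OF that]]) (use cross b in \<open>metis mult.commute\<close>)
    ultimately show ?thesis by simp
  qed
  then have nz': "\<exists>i\<le>m. subst g' (f i) \<noteq> 0" using nz \<open>g' j \<noteq> 0\<close> b(2) by (metis mult_eq_0_iff power_not_zero)
  have "subst g (f i) * subst g' (f k) = subst g (f k) * subst g' (f i)" if "i \<le> m" "k \<le> m" for i k
  proof -
    have "g j ^ a * (subst g (f i) * subst g' (f k)) = g j ^ a * (subst g (f k) * subst g' (f i))"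
      using scale[OF that(1)] scale[OF that(2)] by (simp add: mult.left_commute)
    moreover have "g j ^ a \<noteq> 0" using b(2) by simp
    ultimately show ?thesis by (metis mult_left_cancel)
  qed
  then show ?thesis
    using subst_tuple[OF a(2) b(3) nz] subst_tuple[OF a(2) b'(3) nz'] unfolding proj_rel_def hom_tuples_def by blast
qed

text \<open>Here the second composite may vanish, because \<open>f'\<close> can differ from \<open>f\<close> by a factor that
  vanishes on the image of \<open>g\<close>; so both composites are assumed to be nonzero.\<close>

lemma comp_left:
  assumes f: "(f, f') \<in> proj_rel m" and g: "g \<in> hom_tuples m"
    and nz: "\<exists>i\<le>m. subst g (f i) \<noteq> 0" "\<exists>i\<le>m. subst g (f' i) \<noteq> 0"
  shows "((\<lambda>i. subst g (f i)), (\<lambda>i. subst g (f' i))) \<in> proj_rel m"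
proof -
  obtain b where b: "g \<in> hom_tuples_deg m b" by (rule hom_tuplesE[OF g]) blast
  obtain a a' where a: "f \<in> hom_tuples_deg m a" "f' \<in> hom_tuples_deg m a'"
    using f unfolding proj_rel_def hom_tuples_def by blast
  have "subst g (f i) * subst g (f' k) = subst g (f k) * subst g (f' i)" if "i \<le> m" "k \<le> m" for i k
    using f that unfolding proj_rel_def by (simp flip: subst.hom_mult)
  then show ?thesis
    using subst_tuple[OF a(1) b nz(1)] subst_tuple[OF a(2) b nz(2)] unfolding proj_rel_def hom_tuples_def by blast
qed

lemma rat_comp_class:
  assumes f: "f \<in> hom_tuples m" and g: "g \<in> hom_tuples m" and nz: "\<exists>i\<le>m. subst g (f i) \<noteq> 0"
  shows "rat_comp m (proj_rel m `` {f}) (proj_rel m `` {g}) = proj_rel m `` {\<lambda>i. subst g (f i)}"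
proof (intro Set.set_eqI iffI)
  fix h assume "h \<in> proj_rel m `` {\<lambda>i. subst g (f i)}"
  then show "h \<in> rat_comp m (proj_rel m `` {f}) (proj_rel m `` {g})"
    unfolding rat_comp_def using proj_rel_refl f g by blast
next
  fix h assume "h \<in> rat_comp m (proj_rel m `` {f}) (proj_rel m `` {g})"
  then obtain f' g' where f': "(f, f') \<in> proj_rel m" and g': "(g, g') \<in> proj_rel m"
    and h: "((\<lambda>i. subst g' (f' i)), h) \<in> proj_rel m" unfolding rat_comp_def by blast
  have 1: "((\<lambda>i. subst g (f i)), (\<lambda>i. subst g' (f i))) \<in> proj_rel m" by (rule comp_right[OF g' f nz])
  have 2: "((\<lambda>i. subst g' (f i)), (\<lambda>i. subst g' (f' i))) \<in> proj_rel m"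
    using comp_left[OF f', of g'] 1 h g' unfolding proj_rel_def by (auto elim!: hom_tuplesE)
  show "h \<in> proj_rel m `` {\<lambda>i. subst g (f i)}" using proj_rel_trans[OF 1 proj_rel_trans[OF 2 h]] by simp
qed

lemma Var_nonzero [simp]: "Var i \<noteq> (0 :: 'k::field mpoly)"
  using vars_Var[of i, where 'k='k] by (metis empty_not_insert vars_0)

section \<open>Iterates and common factors\<close>

text \<open>The order of substitution follows the powers in a monoid, where the new factor is
  multiplied on the right.\<close>

primrec iterate :: "(nat \<Rightarrow> 'k::field mpoly) \<Rightarrow> nat \<Rightarrow> nat \<Rightarrow> 'k mpoly" where
  "iterate \<Phi> 0 = Var"
| "iterate \<Phi> (Suc n) = (\<lambda>i. subst \<Phi> (iterate \<Phi> n i))"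

lemma homogeneous_iterate:
  assumes "\<And>i. i \<le> m \<Longrightarrow> homogeneous m d (\<Phi> i)" "i \<le> m"
  shows "homogeneous m (d ^ n) (iterate \<Phi> n i)"
proof (induction n)
  case (Suc n)
  then show ?case using homogeneous_subst[OF Suc assms(1)] by (simp add: mult.commute)
qed (use homogeneous_Var assms in simp)

lemma subst_scaled_id:
  assumes "\<And>i. i \<le> m \<Longrightarrow> subst \<Phi> (\<Psi> i) = P * Var i" "homogeneous m a p"
  shows "subst \<Phi> (subst \<Psi> p) = P ^ a * p"
  using subst_scale[OF assms(2), of "\<lambda>i. subst \<Phi> (\<Psi> i)" P Var] assms(1) by (simp add: subst_subst)

text \<open>Suppose the prime \<open>q\<close> divides all coordinates of an iterate and the previous iterate \<open>H\<close> is reduced.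
  Substituting \<open>\<Psi>\<close> shows that \<open>q(\<Psi>)\<close> divides \<open>Q\<^sup>N H\<close>, hence divides \<open>Q\<^sup>N\<close>. Substituting \<open>\<Phi>\<close> back
  turns \<open>q(\<Psi>)\<close> into a multiple of \<open>q\<close> and \<open>Q\<close> into \<open>P\<^sup>d\<close>. So \<open>q\<close> divides \<open>P\<close>, which the last assumption
  excludes. Geometrically, \<open>q = 0\<close> would have to be a hypersurface contracted by \<open>\<Phi>\<close>.\<close>

lemma iterate_reduced:
  fixes \<Phi> \<Psi> :: "nat \<Rightarrow> 'k::field mpoly"
  assumes \<Phi>: "\<And>i. i \<le> m \<Longrightarrow> homogeneous m d (\<Phi> i)" "\<exists>i\<le>m. \<Phi> i \<noteq> 0" "no_common_factor m \<Phi>"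
    and inv: "\<And>i. i \<le> m \<Longrightarrow> subst \<Phi> (\<Psi> i) = P * Var i" "\<And>i. i \<le> m \<Longrightarrow> subst \<Psi> (\<Phi> i) = Q * Var i"
    and nz: "P \<noteq> 0" "Q \<noteq> 0"
    and avoid: "\<And>q n. Factorial_Ring.prime_elem q \<Longrightarrow> q dvd P \<Longrightarrow> \<exists>i\<le>m. \<not> q dvd iterate \<Phi> (Suc n) i"
  shows "(\<exists>i\<le>m. iterate \<Phi> (Suc n) i \<noteq> 0) \<and> no_common_factor m (iterate \<Phi> (Suc n))"
proof (induction n)
  case 0
  then show ?case using \<Phi>(2,3) by (simp add: no_common_factor_def)
next
  case (Suc n)
  let ?H = "iterate \<Phi> (Suc n)"
  define N where "N = d ^ Suc n"
  have hom: "homogeneous m N (?H i)" if "i \<le> m" for i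
    unfolding N_def by (rule homogeneous_iterate[OF \<Phi>(1) that])
  have pull: "subst \<Psi> (iterate \<Phi> (Suc (Suc n)) i) = Q ^ N * ?H i" if "i \<le> m" for i
    using subst_scaled_id[OF inv(2) hom[OF that]] by simp
  obtain j where j: "j \<le> m" "?H j \<noteq> 0" using Suc.IH by blast
  then have j': "iterate \<Phi> (Suc (Suc n)) j \<noteq> 0"
    using pull[OF j(1)] nz(2) by (metis mult_eq_0_iff power_not_zero subst.hom_zero)
  then have ex: "\<exists>i\<le>m. iterate \<Phi> (Suc (Suc n)) i \<noteq> 0" using j(1) by blast
  have "\<exists>i\<le>m. \<not> q dvd iterate \<Phi> (Suc (Suc n)) i" if q: "Factorial_Ring.prime_elem q" for q
  proof (rule ccontr)
    assume "\<not> ?thesis"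
    then have dvd: "\<And>i. i \<le> m \<Longrightarrow> q dvd iterate \<Phi> (Suc (Suc n)) i" by blast
    then have qP: "\<not> q dvd P" using avoid[OF q] by blast
    have qnz: "q \<noteq> 0" using q by auto
    obtain w where w: "iterate \<Phi> (Suc (Suc n)) j = q * w" using dvd[OF j(1)] by (elim dvdE)
    have "homogeneous m (d ^ Suc (Suc n)) (q * w)"
      using homogeneous_iterate[of m d \<Phi> j "Suc (Suc n)", OF \<Phi>(1) j(1)] by (simp only: w)
    then have homq: "homogeneous m (tdeg q) q"
      by (rule homogeneous_factor[OF _ qnz]) (use j' w in auto)
    have pull_q: "subst \<Phi> (subst \<Psi> q) = P ^ tdeg q * q" by (rule subst_scaled_id[OF inv(1) homq])
    have "subst \<Psi> q dvd Q ^ N"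
    proof (rule dvd_of_common_multiple[of "{..m}" ?H])
      show "\<exists>i\<in>{..m}. \<not> p dvd ?H i" if "Factorial_Ring.prime_elem p" for p
        using no_common_factor_iff[of m ?H] Suc.IH that by (metis atMost_iff)
      show "subst \<Psi> q \<noteq> 0" using pull_q qnz nz(1) by (metis mult_eq_0_iff power_not_zero subst.hom_zero)
      show "subst \<Psi> q dvd ?H i * Q ^ N" if "i \<in> {..m}" for i
      proof -
        have "subst \<Psi> q dvd subst \<Psi> (iterate \<Phi> (Suc (Suc n)) i)"
          using dvd[of i] that by (auto simp: subst.hom_mult simp del: iterate.simps elim!: dvdE)
        then show ?thesis using pull[of i] that by (simp add: mult.commute)
      qed
    qed
    then have "P ^ tdeg q * q dvd subst \<Phi> Q ^ N"
      unfolding pull_q[symmetric] by (metis subst.hom_mult subst.hom_power dvd_def)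
    moreover have "subst \<Phi> Q = P ^ d"
    proof -
      obtain l where l: "l \<le> m" "\<Phi> l \<noteq> 0" using \<Phi>(2) by blast
      have "\<Phi> l * subst \<Phi> Q = \<Phi> l * P ^ d"
        using subst_scaled_id[OF inv(1) \<Phi>(1)[OF l(1)]] inv(2)[OF l(1)] by (simp add: subst.hom_mult mult.commute)
      then show ?thesis by (simp only: mult_left_cancel[OF l(2)])
    qed
    ultimately have "q dvd P ^ (d * N)" by (metis dvd_mult_right power_mult)
    then show False using prime_elem_dvd_power[OF q] qP by blast
  qed
  then show ?case using no_common_factor_iff[OF ex] ex by blast
qed

section \<open>Invertible matrices and the projective linear group\<close>

definition lin_comb :: "nat \<Rightarrow> (nat \<Rightarrow> nat \<Rightarrow> 'k::field) \<Rightarrow> (nat \<Rightarrow> 'k mpoly) \<Rightarrow> nat \<Rightarrow> 'k mpoly" where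
  "lin_comb m \<mu> a i = (\<Sum>j\<le>m. Const (\<mu> i j) * a j)"

text \<open>Matrices are functions on indices here; only the entries with both indices at most \<open>m\<close>
  matter.\<close>

definition inverse_to :: "nat \<Rightarrow> (nat \<Rightarrow> nat \<Rightarrow> 'k::field) \<Rightarrow> (nat \<Rightarrow> nat \<Rightarrow> 'k) \<Rightarrow> bool" where
  "inverse_to m \<mu> \<nu> \<longleftrightarrow> (\<forall>i\<le>m. \<forall>k\<le>m. (\<Sum>j\<le>m. \<mu> i j * \<nu> j k) = (if i = k then 1 else 0))"

lemma subst_lin_comb: "subst g (lin_comb m \<mu> a i) = lin_comb m \<mu> (\<lambda>j. subst g (a j)) i"
  by (simp add: lin_comb_def subst.hom_sum subst.hom_mult)

lemma lin_comb_cong: "(\<And>j. j \<le> m \<Longrightarrow> a j = b j) \<Longrightarrow> lin_comb m \<mu> a i = lin_comb m \<mu> b i"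
  by (simp add: lin_comb_def)

lemma lin_comb_inverse:
  assumes "inverse_to m \<mu> \<nu>" "i \<le> m"
  shows "lin_comb m \<mu> (lin_comb m \<nu> a) i = a i"
proof -
  have "lin_comb m \<mu> (lin_comb m \<nu> a) i = (\<Sum>k\<le>m. Const (\<Sum>j\<le>m. \<mu> i j * \<nu> j k) * a k)"
    unfolding lin_comb_def sum_distrib_left Const.hom_sum sum_distrib_right
    by (subst sum.swap) (simp add: Const.hom_mult mult_ac)
  also have "\<dots> = (\<Sum>k\<le>m. if k = i then a k else 0)"
    by (rule sum.cong) (use assms in \<open>auto simp: inverse_to_def Const.hom_one\<close>)
  finally show ?thesis using assms(2) by simp
qed

lemma homogeneous_lin_comb:
  "(\<And>j. j \<le> m \<Longrightarrow> homogeneous m d (a j)) \<Longrightarrow> homogeneous m d (lin_comb m \<mu> a i)"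
  unfolding lin_comb_def
  by (intro homogeneous_sum) (use homogeneous_mult[OF homogeneous_Const, of m d] in auto)

lemma lin_comb_nonzero:
  assumes "inverse_to m \<nu> \<mu>" "\<exists>i\<le>m. a i \<noteq> 0"
  shows "\<exists>i\<le>m. lin_comb m \<mu> a i \<noteq> 0"
proof (rule ccontr)
  assume "\<not> ?thesis"
  then have "lin_comb m \<nu> (lin_comb m \<mu> a) i = lin_comb m \<nu> (\<lambda>_. 0) i" for i
    by (intro lin_comb_cong) auto
  then show False using lin_comb_inverse[OF assms(1), of _ a] assms(2) by (auto simp: lin_comb_def)
qed

lemma lin_comb_no_common_factor:
  assumes "inverse_to m \<nu> \<mu>" "no_common_factor m a"
  shows "no_common_factor m (lin_comb m \<mu> a)"
  unfolding no_common_factor_def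
proof (intro allI impI)
  fix p assume p: "\<forall>i\<le>m. p dvd lin_comb m \<mu> a i"
  have "p dvd a i" if "i \<le> m" for i
  proof -
    have "p dvd lin_comb m \<nu> (lin_comb m \<mu> a) i"
      unfolding lin_comb_def[of m \<nu>] by (intro dvd_sum dvd_mult) (use p in auto)
    then show ?thesis using lin_comb_inverse[OF assms(1) that, of a] by simp
  qed
  then show "p dvd 1" using assms(2) unfolding no_common_factor_def by blast
qed

text \<open>The tuple \<open>\<Psi>\<close> represents the inverse of the twisted map. The factor \<open>P\<close>, which cuts out the
  contracted hypersurfaces, is the same for every matrix \<open>\<mu>\<close>.\<close>

lemma twist_inverse:
  assumes F: "\<And>i. i \<le> m \<Longrightarrow> homogeneous m d (F i)" and G: "\<And>i. i \<le> m \<Longrightarrow> homogeneous m e (G i)"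
    and inv: "\<And>i. i \<le> m \<Longrightarrow> subst F (G i) = P * Var i" "\<And>i. i \<le> m \<Longrightarrow> subst G (F i) = Q * Var i"
    and nz: "Q \<noteq> 0" and \<mu>: "inverse_to m \<mu> \<nu>" "inverse_to m \<nu> \<mu>"
  defines "\<Phi> \<equiv> lin_comb m \<mu> F" and "\<Psi> \<equiv> \<lambda>i. subst (lin_comb m \<nu> Var) (G i)"
  shows "\<And>i. i \<le> m \<Longrightarrow> subst \<Phi> (\<Psi> i) = P * Var i"
    and "\<exists>Q'. Q' \<noteq> 0 \<and> (\<forall>i\<le>m. subst \<Psi> (\<Phi> i) = Q' * Var i)"
proof -
  fix i assume i: "i \<le> m"
  have "subst \<Phi> (\<Psi> i) = subst (\<lambda>j. subst \<Phi> (lin_comb m \<nu> Var j)) (G i)"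
    unfolding \<Psi>_def by (rule subst_subst)
  also have "\<dots> = subst F (G i)"
  proof (rule subst_cong)
    fix j assume "j \<in> vars (G i)"
    then have "j \<le> m" using G[OF i] by (auto simp: homogeneous_iff)
    then show "subst \<Phi> (lin_comb m \<nu> Var j) = F j"
      using lin_comb_inverse[OF \<mu>(2), of j F] by (simp add: subst_lin_comb \<Phi>_def)
  qed
  finally show "subst \<Phi> (\<Psi> i) = P * Var i" using inv(1)[OF i] by simp
next
  let ?\<nu> = "lin_comb m \<nu> Var" and ?\<mu> = "lin_comb m \<mu> Var"
  define Q' where "Q' = subst ?\<nu> Q"
  have "subst \<Psi> (\<Phi> i) = Q' * Var i" if i: "i \<le> m" for i
  proof -
    have "subst \<Psi> (F j) = Q' * ?\<nu> j" if "j \<le> m" for j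
    proof -
      have "subst \<Psi> (F j) = subst ?\<nu> (subst G (F j))" unfolding \<Psi>_def by (rule subst_subst[symmetric])
      then show ?thesis using inv(2)[OF that] by (simp add: subst.hom_mult Q'_def)
    qed
    then have "subst \<Psi> (\<Phi> i) = lin_comb m \<mu> (\<lambda>j. Q' * ?\<nu> j) i"
      unfolding \<Phi>_def subst_lin_comb by (rule lin_comb_cong)
    also have "\<dots> = Q' * lin_comb m \<mu> ?\<nu> i"
      unfolding lin_comb_def[of m \<mu>] sum_distrib_left by (simp add: mult.left_commute)
    finally show ?thesis using lin_comb_inverse[OF \<mu>(1) i, of Var] by simp
  qed
  moreover have "Q' \<noteq> 0"
  proof -
    have "homogeneous m (d * e) (Q * Var 0)"
      using homogeneous_subst[OF F[of 0], of e G] G inv(2)[of 0] by simp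
    then have "vars (Q * Var 0) \<subseteq> {..m}" by (simp add: homogeneous_iff)
    then have "vars Q \<subseteq> {..m}" using vars_mult[OF nz, of "Var 0"] by auto
    then have "subst ?\<mu> Q' = Q"
      unfolding Q'_def subst_subst subst_lin_comb
      using subst_cong[of Q "lin_comb m \<nu> ?\<mu>" Var] lin_comb_inverse[OF \<mu>(2)] by (auto simp: subset_iff)
    then show ?thesis using nz by auto
  qed
  ultimately show "\<exists>Q'. Q' \<noteq> 0 \<and> (\<forall>i\<le>m. subst \<Psi> (\<Phi> i) = Q' * Var i)" by blast
qed

lemma linear_class_in_PGL:
  fixes \<mu> \<nu> :: "nat \<Rightarrow> nat \<Rightarrow> 'k::field"
  assumes \<mu>: "inverse_to m \<mu> \<nu>" "inverse_to m \<nu> \<mu>"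
  shows "\<exists>A\<in>carrier (PGL (Suc m)). proj_aut m A = proj_rel m `` {lin_comb m \<mu> Var}"
proof -
  define n where "n = Suc m"
  define M where "M = mat n n (\<lambda>(i, j). \<mu> i j)"
  define N where "N = mat n n (\<lambda>(i, j). \<nu> i j)"
  have carr: "M \<in> carrier_mat n n" "N \<in> carrier_mat n n" by (simp_all add: M_def N_def)
  have prod: "mat n n (\<lambda>(i, j). \<alpha> i j) * mat n n (\<lambda>(i, j). \<beta> i j) = 1\<^sub>m n"
    if "inverse_to m \<alpha> \<beta>" for \<alpha> \<beta> :: "nat \<Rightarrow> nat \<Rightarrow> 'k"
  proof (rule eq_matI)
    fix i k assume "i < dim_row (1\<^sub>m n :: 'k mat)" "k < dim_col (1\<^sub>m n :: 'k mat)"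
    then have ik: "i < n" "k < n" by auto
    have "{0..<n} = {..m}" by (auto simp: n_def)
    then have "(\<Sum>j = 0..<n. \<alpha> i j * \<beta> j k) = (if i = k then 1 else 0)"
      using that ik unfolding inverse_to_def n_def by simp
    then show "(mat n n (\<lambda>(i, j). \<alpha> i j) * mat n n (\<lambda>(i, j). \<beta> i j)) $$ (i, k) = 1\<^sub>m n $$ (i, k)"
      using ik by (simp add: scalar_prod_def)
  qed auto
  have MGL: "M \<in> carrier (GL n)"
    using carr prod[OF \<mu>(1)] prod[OF \<mu>(2)]
    unfolding GL_def units_of_def Units_def M_def N_def by (auto simp: ring_mat_def)
  define A where "A = r_coset (GL n) {c \<cdot>\<^sub>m 1\<^sub>m n | c. c \<noteq> 0} M"
  have A: "A = {c \<cdot>\<^sub>m M | c. c \<noteq> 0}"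
  proof -
    have "A = (\<Union>c\<in>{c. c \<noteq> 0}. {(c \<cdot>\<^sub>m 1\<^sub>m n) * M})"
      unfolding A_def r_coset_def GL_def units_of_def by (auto simp: ring_mat_def)
    moreover have "(c \<cdot>\<^sub>m 1\<^sub>m n) * M = c \<cdot>\<^sub>m M" for c
      using carr by (simp add: smult_mat_def[symmetric] mult_smult_assoc_mat[of _ n n])
    ultimately show ?thesis by auto
  qed
  have lin: "lin_comb m \<mu> Var \<in> hom_tuples m"
  proof -
    have "(Var 0 :: 'k mpoly) \<noteq> 0" by simp
    then show ?thesis
      using lin_comb_nonzero[OF \<mu>(2), of Var] homogeneous_lin_comb[of m 1 Var \<mu>, OF homogeneous_Var]
      unfolding hom_tuples_def hom_tuples_deg_def by fastforce
  qed
  have "proj_rel m `` {linear_tuple m (c \<cdot>\<^sub>m M)} = proj_rel m `` {lin_comb m \<mu> Var}" if "c \<noteq> 0" for c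
  proof -
    have eq: "linear_tuple m (c \<cdot>\<^sub>m M) i = Const c * lin_comb m \<mu> Var i" if "i \<le> m" for i
      using that unfolding linear_tuple_def lin_comb_def sum_distrib_left
      by (intro sum.cong) (auto simp: M_def n_def Const.hom_mult mult.assoc)
    have "linear_tuple m (c \<cdot>\<^sub>m M) \<in> hom_tuples m"
    proof -
      obtain d j where d: "\<And>i. i \<le> m \<Longrightarrow> homogeneous m d (lin_comb m \<mu> Var i)" "j \<le> m" "lin_comb m \<mu> Var j \<noteq> 0"
        using lin by (rule hom_tuplesE) blast
      have "homogeneous m (0 + d) (linear_tuple m (c \<cdot>\<^sub>m M) i)" if "i \<le> m" for i
        unfolding eq[OF that] by (rule homogeneous_mult[OF homogeneous_Const d(1)[OF that]])
      moreover have "linear_tuple m (c \<cdot>\<^sub>m M) j \<noteq> 0" using eq[OF d(2)] d(3) \<open>c \<noteq> 0\<close> by simp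
      ultimately show ?thesis using d(2) unfolding hom_tuples_def hom_tuples_deg_def by blast
    qed
    then have "(linear_tuple m (c \<cdot>\<^sub>m M), lin_comb m \<mu> Var) \<in> proj_rel m"
      using lin eq unfolding proj_rel_def by (auto simp: mult_ac)
    then show ?thesis by (rule class_eqI)
  qed
  note cls = this
  have "proj_aut m A = (\<Union>c\<in>{c. c \<noteq> 0}. proj_rel m `` {linear_tuple m (c \<cdot>\<^sub>m M)})"
    unfolding proj_aut_def A by blast
  also have "\<dots> = (\<Union>c\<in>{c :: 'k. c \<noteq> 0}. proj_rel m `` {lin_comb m \<mu> Var})"
    by (rule SUP_cong[OF refl]) (rule cls, simp)
  also have "\<dots> = proj_rel m `` {lin_comb m \<mu> Var}"
    using one_neq_zero[where 'a='k] by blast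
  finally have "proj_aut m A = proj_rel m `` {lin_comb m \<mu> Var}" .
  moreover have "A \<in> carrier (PGL (Suc m))"
    using MGL unfolding PGL_def FactGroup_def RCOSETS_def A_def n_def by auto
  ultimately show ?thesis by blast
qed

section \<open>Birational maps and their powers\<close>

lemma Var_no_common_factor:
  assumes "m \<ge> 1"
  shows "no_common_factor m (Var :: nat \<Rightarrow> 'k::field mpoly)"
  unfolding no_common_factor_def
proof (intro allI impI)
  fix p :: "'k mpoly" assume p: "\<forall>i\<le>m. p dvd Var i"
  have sub: "vars p \<subseteq> {i}" if i: "i \<le> m" for i
  proof -
    obtain q where q: "Var i = p * q" using p i by (auto elim: dvdE)
    have "(Var i :: 'k mpoly) \<noteq> 0" by simp
    then have "p \<noteq> 0" "q \<noteq> 0" using q by auto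
    then show ?thesis using vars_mult[of p q] q[symmetric] by auto
  qed
  have "vars p = {}" using sub[of 0] sub[of 1] assms by auto
  then obtain c where c: "p = Const c" using vars_empty_iff by blast
  have "c \<noteq> 0" using p[rule_format, of 0] c by (auto simp: Const.hom_zero)
  then show "p dvd 1" unfolding unit_iff using c by blast
qed

lemma Var_hom_tuples: "Var \<in> hom_tuples_deg m 1"
  unfolding hom_tuples_deg_def using homogeneous_Var by auto

text \<open>Some representatives compose to a multiple of the identity tuple. As \<open>F\<close> is reduced, every
  representative of its class is a multiple of \<open>F\<close>, so the composite with \<open>F\<close> itself is defined as well. The
  assumption \<open>m \<ge> 1\<close> makes the tuple of variables reduced.\<close>

lemma rat_comp_eq_id:
  assumes m: "m \<ge> 1" and F: "F \<in> hom_tuples m" "no_common_factor m F" and G: "G \<in> hom_tuples m"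
    and id: "rat_comp m (proj_rel m `` {F}) (proj_rel m `` {G}) = rat_id m"
  shows "\<exists>Q. Q \<noteq> 0 \<and> (\<forall>i\<le>m. subst G (F i) = Q * Var i)"
proof -
  have Var: "Var \<in> hom_tuples m" using Var_hom_tuples unfolding hom_tuples_def by blast
  then have "Var \<in> rat_comp m (proj_rel m `` {F}) (proj_rel m `` {G})"
    unfolding id rat_id_def using proj_rel_refl by blast
  then obtain f g where f: "(F, f) \<in> proj_rel m" and g: "(G, g) \<in> proj_rel m"
    and fg: "((\<lambda>i. subst g (f i)), Var) \<in> proj_rel m" unfolding rat_comp_def by blast
  have Fnz: "\<exists>i\<le>m. F i \<noteq> 0" using F(1) by (auto elim: hom_tuplesE)
  obtain s where s: "\<forall>i\<le>m. f i = s * F i"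
    using reduced_multiple[OF F(2) Fnz, of f] f unfolding proj_rel_def by blast
  have nz1: "\<exists>i\<le>m. subst g (f i) \<noteq> 0" using fg unfolding proj_rel_def by (auto elim: hom_tuplesE)
  then have nz2: "\<exists>i\<le>m. subst g (F i) \<noteq> 0" using s by (auto simp: subst.hom_mult)
  have gt: "g \<in> hom_tuples m" using g unfolding proj_rel_def by blast
  have "((\<lambda>i. subst g (F i)), Var) \<in> proj_rel m"
    using comp_left[OF f gt nz2 nz1] fg by (rule proj_rel_trans)
  moreover have "((\<lambda>i. subst g (F i)), (\<lambda>i. subst G (F i))) \<in> proj_rel m"
    by (rule comp_right[OF proj_rel_sym[OF g] F(1) nz2])
  ultimately have rel: "(Var, (\<lambda>i. subst G (F i))) \<in> proj_rel m"
    using proj_rel_sym proj_rel_trans by blast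
  have "\<exists>i\<le>m. (Var i :: 'a mpoly) \<noteq> 0" by auto
  then obtain Q where Q: "\<forall>i\<le>m. subst G (F i) = Q * Var i"
    using reduced_multiple[OF Var_no_common_factor[OF m], of "\<lambda>i. subst G (F i)"] rel
    unfolding proj_rel_def by blast
  moreover have "Q \<noteq> 0" using Q rel unfolding proj_rel_def by (auto elim: hom_tuplesE)
  ultimately show ?thesis by blast
qed

lemma birational_pair:
  assumes f: "f \<in> carrier (Bir m)" and F: "f = proj_rel m `` {F}" "F \<in> hom_tuples_deg m d" "no_common_factor m F"
    and m: "m \<ge> 1"
  shows "\<exists>G e P Q. G \<in> hom_tuples_deg m e \<and> P \<noteq> 0 \<and> Q \<noteq> 0 \<and>
    (\<forall>i\<le>m. subst F (G i) = P * Var i) \<and> (\<forall>i\<le>m. subst G (F i) = Q * Var i)"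
proof -
  obtain g where g: "g \<in> rational_maps m" "rat_comp m f g = rat_id m" "rat_comp m g f = rat_id m"
    using f unfolding Bir_def by auto
  obtain G e where G: "G \<in> g" "G \<in> hom_tuples_deg m e" "no_common_factor m G"
    using reduced_representative[OF g(1)] by blast
  have gG: "g = proj_rel m `` {G}" and Gt: "G \<in> hom_tuples m" using rational_map_class[OF g(1) G(1)] by auto
  have Ft: "F \<in> hom_tuples m" using F(2) unfolding hom_tuples_def by blast
  show ?thesis
    using rat_comp_eq_id[OF m Ft F(3) Gt g(2)[unfolded F(1) gG]]
      rat_comp_eq_id[OF m Gt G(3) Ft g(3)[unfolded F(1) gG]] G(2) by blast
qed

lemma power_class:
  assumes \<Phi>: "\<Phi> \<in> hom_tuples_deg m d" and nz: "\<And>n. \<exists>i\<le>m. iterate \<Phi> n i \<noteq> 0"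
  shows "(proj_rel m `` {\<Phi>}) [^]\<^bsub>Bir m\<^esub> n = proj_rel m `` {iterate \<Phi> n}"
proof (induction n)
  case 0
  then show ?case by (simp add: Bir_def rat_id_def)
next
  case (Suc n)
  have "iterate \<Phi> n \<in> hom_tuples m"
    using homogeneous_iterate[of m d \<Phi>] \<Phi> nz[of n] unfolding hom_tuples_def hom_tuples_deg_def by blast
  moreover have "\<Phi> \<in> hom_tuples m" using \<Phi> unfolding hom_tuples_def by blast
  moreover have "\<exists>i\<le>m. subst \<Phi> (iterate \<Phi> n i) \<noteq> 0" using nz[of "Suc n"] by simp
  ultimately show ?case using rat_comp_class Suc.IH by (simp add: Bir_def)
qed

text \<open>Once all iterates of the twisted tuple are known to be reduced, they can be read off as the reduced
  representatives of the powers in the group.\<close>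

lemma degree_of_powers:
  assumes F: "F \<in> hom_tuples_deg m d" and \<mu>: "inverse_to m \<mu> \<nu>" "inverse_to m \<nu> \<mu>"
    and red: "\<And>n. (\<exists>i\<le>m. iterate (lin_comb m \<mu> F) (Suc n) i \<noteq> 0) \<and> 
      no_common_factor m (iterate (lin_comb m \<mu> F) (Suc n))"
  shows "\<exists>A\<in>carrier (PGL (Suc m)). \<forall>n\<ge>1.
    rat_degree m ((proj_aut m A \<otimes>\<^bsub>Bir m\<^esub> (proj_rel m `` {F})) [^]\<^bsub>Bir m\<^esub> (n::nat)) = d ^ n"
proof -
  let ?\<Phi> = "lin_comb m \<mu> F"
  obtain A where A: "A \<in> carrier (PGL (Suc m))" "proj_aut m A = proj_rel m `` {lin_comb m \<mu> Var}"
    using linear_class_in_PGL[OF \<mu>] by blast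
  have hom: "\<And>i. i \<le> m \<Longrightarrow> homogeneous m d (?\<Phi> i)"
    by (rule homogeneous_lin_comb) (use F in \<open>auto simp: hom_tuples_deg_def\<close>)
  have Fnz: "\<exists>i\<le>m. F i \<noteq> 0" using F unfolding hom_tuples_deg_def by blast
  have \<Phi>nz: "\<exists>i\<le>m. ?\<Phi> i \<noteq> 0" by (rule lin_comb_nonzero[OF \<mu>(2) Fnz])
  have \<Phi>: "?\<Phi> \<in> hom_tuples_deg m d" unfolding hom_tuples_deg_def using hom \<Phi>nz by blast
  have "\<exists>i\<le>m. (Var i :: 'a mpoly) \<noteq> 0" by auto
  then have lin: "lin_comb m \<mu> Var \<in> hom_tuples m"
    using lin_comb_nonzero[OF \<mu>(2), of Var] homogeneous_lin_comb[of m 1 Var \<mu>, OF homogeneous_Var]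
    unfolding hom_tuples_def hom_tuples_deg_def by blast
  have eq: "(\<lambda>i. subst F (lin_comb m \<mu> Var i)) = ?\<Phi>"
    by (simp add: fun_eq_iff subst_lin_comb)
  have "proj_aut m A \<otimes>\<^bsub>Bir m\<^esub> (proj_rel m `` {F}) = proj_rel m `` {?\<Phi>}"
    using rat_comp_class[OF lin, of F] F \<Phi>nz unfolding A(2) eq hom_tuples_def 
    by (auto simp: Bir_def subst_lin_comb)
  moreover have "rat_degree m ((proj_rel m `` {?\<Phi>}) [^]\<^bsub>Bir m\<^esub> n) = d ^ n" if n: "n \<ge> 1" for n
  proof -
    have nz: "\<exists>i\<le>m. iterate ?\<Phi> n i \<noteq> 0" for n
      using red[of "n - 1"] by (cases n) auto
    have "iterate ?\<Phi> n \<in> hom_tuples_deg m (d ^ n)"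
      using homogeneous_iterate[of m d ?\<Phi>, OF hom] nz[of n] unfolding hom_tuples_deg_def by blast
    moreover have "no_common_factor m (iterate ?\<Phi> n)" using red[of "n - 1"] n by simp
    ultimately show ?thesis using rat_degree_eq power_class[OF \<Phi> nz] by metis
  qed
  ultimately show ?thesis using A(1) by (intro bexI[of _ A]) simp_all
qed

section \<open>A valuation ring of the algebraic closure\<close>

definition is_subring :: "'a::field set \<Rightarrow> bool" where
  "is_subring R \<longleftrightarrow> 0 \<in> R \<and> 1 \<in> R \<and> (\<forall>a\<in>R. - a \<in> R) \<and> (\<forall>a\<in>R. \<forall>b\<in>R. a + b \<in> R \<and> a * b \<in> R)"

definition adjoin :: "'a::field set \<Rightarrow> 'a \<Rightarrow> 'a set" where
  "adjoin R x = {poly p x |p. \<forall>i. coeff p i \<in> R}"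

lemma
  assumes "is_subring R"
  shows subring_0: "0 \<in> R" and subring_1: "1 \<in> R"
    and subring_uminus: "a \<in> R \<Longrightarrow> - a \<in> R"
    and subring_add: "a \<in> R \<Longrightarrow> b \<in> R \<Longrightarrow> a + b \<in> R"
    and subring_mult: "a \<in> R \<Longrightarrow> b \<in> R \<Longrightarrow> a * b \<in> R"
    and subring_diff: "a \<in> R \<Longrightarrow> b \<in> R \<Longrightarrow> a - b \<in> R"
proof -
  show "a \<in> R \<Longrightarrow> b \<in> R \<Longrightarrow> a - b \<in> R"
    using assms unfolding is_subring_def by (metis add_uminus_conv_diff)
qed (use assms in \<open>auto simp: is_subring_def\<close>)

lemma subring_sum: "is_subring R \<Longrightarrow> (\<And>i. i \<in> A \<Longrightarrow> f i \<in> R) \<Longrightarrow> sum f A \<in> R"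
  by (induction A rule: infinite_finite_induct) (auto intro: subring_0 subring_add)

lemma subring_power: "is_subring R \<Longrightarrow> a \<in> R \<Longrightarrow> a ^ n \<in> R"
  by (induction n) (auto intro: subring_1 subring_mult)

lemma subring_poly: "is_subring R \<Longrightarrow> (\<And>i. coeff p i \<in> R) \<Longrightarrow> x \<in> R \<Longrightarrow> poly p x \<in> R"
  unfolding poly_altdef by (auto intro!: subring_sum subring_mult subring_power)

lemma is_subring_adjoin:
  assumes R: "is_subring R"
  shows "is_subring (adjoin R x)"
  unfolding is_subring_def
proof (intro conjI ballI)
  have c: "a \<in> R \<Longrightarrow> \<forall>i. coeff [:a:] i \<in> R" for a
    using subring_0[OF R] by (auto simp: coeff_pCons split: nat.splits)
  show "0 \<in> adjoin R x" unfolding adjoin_def using c[OF subring_0[OF R]] by (auto intro!: exI[of _ 0])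
  show "1 \<in> adjoin R x" unfolding adjoin_def using c[OF subring_1[OF R]] by (auto intro!: exI[of _ "[:1:]"])
  fix a b assume "a \<in> adjoin R x" "b \<in> adjoin R x"
  then obtain p q where p: "a = poly p x" "\<forall>i. coeff p i \<in> R" and q: "b = poly q x" "\<forall>i. coeff q i \<in> R"
    unfolding adjoin_def by auto
  show "a + b \<in> adjoin R x" unfolding adjoin_def
    using p q subring_add[OF R] by (auto intro!: exI[of _ "p + q"])
  show "a * b \<in> adjoin R x" unfolding adjoin_def
    using p q by (auto intro!: exI[of _ "p * q"] subring_sum[OF R] subring_mult[OF R] simp: coeff_mult)
next
  fix a assume "a \<in> adjoin R x"
  then obtain p where p: "a = poly p x" "\<forall>i. coeff p i \<in> R" unfolding adjoin_def by auto
  show "- a \<in> adjoin R x" unfolding adjoin_def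
    using p subring_uminus[OF R] by (auto intro!: exI[of _ "- p"])
qed

lemma subset_adjoin: "is_subring R \<Longrightarrow> R \<subseteq> adjoin R x"
proof
  fix a assume R: "is_subring R" and "a \<in> R"
  then have "\<forall>i. coeff [:a:] i \<in> R" using subring_0[OF R] by (auto simp: coeff_pCons split: nat.splits)
  then show "a \<in> adjoin R x" unfolding adjoin_def by (auto intro!: exI[of _ "[:a:]"])
qed

lemma in_adjoin: "is_subring R \<Longrightarrow> x \<in> adjoin R x"
  unfolding adjoin_def using subring_0[of R] subring_1[of R]
  by (auto intro!: exI[of _ "[:0, 1:]"] simp: coeff_pCons split: nat.splits)

text \<open>Multiplication with \<open>x\<^sup>k\<close> turns polynomial expressions in the inverse of \<open>x\<close> into polynomial
  expressions in \<open>x\<close> with the same coefficients.\<close>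

lemma reverse_poly:
  assumes R: "is_subring R" and r: "\<And>i. coeff r i \<in> R" "Polynomial.degree r \<le> k" and x: "x \<noteq> 0"
  shows "\<exists>s. (\<forall>i. coeff s i \<in> R) \<and> Polynomial.degree s \<le> k \<and> poly s x = x ^ k * poly r (inverse x)"
proof -
  define s where "s = (\<Sum>i\<le>k. Polynomial.monom (coeff r i) (k - i))"
  have "coeff s i \<in> R" for i
    unfolding s_def coeff_sum by (rule subring_sum[OF R]) (use r subring_0[OF R] in auto)
  moreover have "Polynomial.degree s \<le> k"
    unfolding s_def by (rule degree_sum_le) (auto intro: order.trans[OF degree_monom_le])
  moreover have "poly s x = x ^ k * poly r (inverse x)"
  proof -
    have "poly r (inverse x) = (\<Sum>i\<le>k. coeff r i * inverse x ^ i)"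
      unfolding poly_altdef by (rule sum.mono_neutral_left) (use r(2) in \<open>auto simp: coeff_eq_0\<close>)
    moreover have "coeff r i * x ^ (k - i) = x ^ k * (coeff r i * inverse x ^ i)" if "i \<le> k" for i
      using that x by (simp add: power_diff field_simps)
    ultimately show ?thesis
      unfolding s_def poly_sum poly_monom by (simp only: sum_distrib_left) (intro sum.cong, auto)
  qed
  ultimately show ?thesis by blast
qed

text \<open>A subring that is maximal among those containing \<open>t\<close> but not its inverse is a valuation
  ring. Adjoining an element outside of \<open>R\<close> produces the inverse of \<open>t\<close>, that is, a relation
  \<open>t p(x) = 1\<close>.\<close>

context
  fixes R :: "'a::field set" and t :: 'a
  assumes R: "is_subring R" and t: "t \<in> R" "t \<noteq> 0" "inverse t \<notin> R"
    and max: "\<And>S. is_subring S \<Longrightarrow> R \<subseteq> S \<Longrightarrow> inverse t \<notin> S \<Longrightarrow> S = R"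
begin

lemma not_t_mult: "a \<in> R \<Longrightarrow> t * a \<noteq> 1"
  using t by (metis inverse_unique)

lemma maximal_relation:
  assumes "x \<notin> R"
  shows "\<exists>p. (\<forall>i. coeff p i \<in> R) \<and> t * poly p x = 1"
proof -
  have "inverse t \<in> adjoin R x"
    using max[OF is_subring_adjoin[OF R] subset_adjoin[OF R], of x] in_adjoin[OF R, of x] assms by blast
  then obtain p where "inverse t = poly p x" "\<forall>i. coeff p i \<in> R" unfolding adjoin_def by blast
  then show ?thesis using t by (metis right_inverse)
qed

text \<open>If \<open>u = 1 - t b\<close> were not a unit, a relation for its inverse would give, after clearing
  denominators, that \<open>t\<close> divides a power of \<open>u\<close>; but powers of \<open>u\<close> are congruent to \<open>1\<close> modulo \<open>t\<close>.\<close>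

lemma maximal_unit:
  assumes b: "b \<in> R"
  shows "inverse (1 - t * b) \<in> R"
proof (rule ccontr)
  let ?u = "1 - t * b"
  assume "inverse ?u \<notin> R"
  then obtain p where p: "\<And>i. coeff p i \<in> R" "t * poly p (inverse ?u) = 1" using maximal_relation by blast
  have u: "?u \<in> R" "?u \<noteq> 0"
    using subring_diff[OF R subring_1[OF R] subring_mult[OF R t(1) b]] not_t_mult[OF b] by auto
  define N where "N = Polynomial.degree p"
  obtain s where s: "\<forall>i. coeff s i \<in> R" "poly s ?u = ?u ^ N * poly p (inverse ?u)"
    using reverse_poly[OF R p(1) order.refl u(2)] unfolding N_def by blast
  have "\<exists>b'\<in>R. ?u ^ n = 1 - t * b'" for n
  proof (induction n)
    case 0
    show ?case using subring_0[OF R] by (intro bexI[of _ 0]) auto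
  next
    case (Suc n)
    then obtain b' where b': "b' \<in> R" "?u ^ n = 1 - t * b'" by blast
    have "?u ^ Suc n = 1 - t * (b + b' - t * b * b')"
      unfolding power_Suc b'(2) by (simp add: algebra_simps)
    then show ?case using b b' t by (blast intro: subring_add[OF R] subring_diff[OF R] subring_mult[OF R])
  qed
  then obtain b' where b': "b' \<in> R" "?u ^ N = 1 - t * b'" by blast
  have "t * poly s ?u = ?u ^ N" using s(2) p(2) by (simp add: mult.left_commute)
  then have "t * (poly s ?u + b') = 1" using b'(2) by (simp add: algebra_simps)
  then show False using not_t_mult subring_add[OF R subring_poly[OF R _ u(1)] b'(1)] s(1) by blast
qed

text \<open>The relation for the inverse of \<open>x\<close> has constant term \<open>t b\<close>, and \<open>1 - t b\<close> is a unit. Solving it for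
  \<open>1\<close> expresses a power of \<open>x\<close> by lower powers, which removes the leading term of the relation for \<open>x\<close>.\<close>

lemma reduce_relation:
  assumes x: "x \<noteq> 0"
    and p: "\<And>i. coeff p i \<in> R" "t * poly p x = 1"
    and r: "\<And>i. coeff r i \<in> R" "t * poly r (inverse x) = 1"
    and le: "Polynomial.degree r \<le> Polynomial.degree p" and pos: "Polynomial.degree r > 0"
  shows "\<exists>p'. (\<forall>i. coeff p' i \<in> R) \<and> t * poly p' x = 1 \<and> Polynomial.degree p' < Polynomial.degree p"
proof -
  define n k where "n = Polynomial.degree p" and "k = Polynomial.degree r - 1"
  obtain b r' where rb: "r = pCons b r'" by (cases r)
  have r': "\<And>i. coeff r' i \<in> R" and b: "b \<in> R"
    using r(1)[of "Suc _"] r(1)[of 0] by (simp_all add: rb)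
  have degr': "Polynomial.degree r' \<le> k" and kn: "Suc k \<le> n"
    using pos le unfolding k_def n_def rb by (auto split: if_splits)
  define v where "v = inverse (1 - t * b)"
  have v: "v \<in> R" "v * (1 - t * b) = 1"
    unfolding v_def using maximal_unit[OF b] not_t_mult[OF b] by auto
  obtain s where s: "\<And>i. coeff s i \<in> R" "Polynomial.degree s \<le> k" "poly s x = x ^ k * poly r' (inverse x)"
    using reverse_poly[OF R r' degr' x] by blast
  have eq: "1 - t * b = t * (inverse x * poly r' (inverse x))"
    using r(2) unfolding rb by (simp add: algebra_simps)
  have "x ^ Suc k * inverse x = x ^ k" using x by simp
  moreover have "x ^ Suc k * (1 - t * b) = t * ((x ^ Suc k * inverse x) * poly r' (inverse x))"
    unfolding eq by (simp only: mult_ac)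
  ultimately have "x ^ Suc k * (1 - t * b) = t * poly s x" using s(3) by (simp only:)
  then have xk: "x ^ Suc k = v * t * poly s x" using v(2) by (metis mult.assoc mult.commute mult.right_neutral)
  define a where "a = coeff p n"
  define p0 where "p0 = p - Polynomial.monom a n"
  define p' where "p' = p0 + Polynomial.monom (a * v * t) (n - Suc k) * s"
  have "coeff p' i \<in> R" for i
    unfolding p'_def p0_def a_def coeff_add coeff_diff coeff_monom coeff_monom_mult
    using p(1) s(1) v(1) t(1) subring_0[OF R]
    by (auto intro!: subring_add[OF R] subring_diff[OF R] subring_mult[OF R])
  moreover have "t * poly p' x = 1"
  proof -
    have "x ^ n = x ^ (n - Suc k) * x ^ Suc k" using kn by (simp only: flip: power_add) simp
    then have "poly (Polynomial.monom (a * v * t) (n - Suc k) * s) x = a * x ^ n"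
      unfolding xk by (simp add: poly_monom mult_ac)
    then have "poly p' x = poly p x" by (simp add: p'_def p0_def poly_monom)
    then show ?thesis using p(2) by simp
  qed
  moreover have "Polynomial.degree p' < n"
  proof -
    have "Polynomial.degree p' \<le> n - 1"
    proof (rule degree_le, intro allI impI)
      fix i assume i: "n - 1 < i"
      have "coeff p0 i = 0" unfolding p0_def a_def using i by (auto simp: n_def coeff_eq_0)
      moreover have "coeff (Polynomial.monom (a * v * t) (n - Suc k) * s) i = 0"
        using i s(2) kn by (auto simp: coeff_monom_mult coeff_eq_0)
      ultimately show "coeff p' i = 0" by (simp add: p'_def)
    qed
    then show ?thesis using kn by simp
  qed
  ultimately show ?thesis unfolding n_def by blast
qed

text \<open>If both \<open>x\<close> and its inverse were missing, each would satisfy a relation, and the two relations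
  could be used to shorten each other until one of them is constant.\<close>

lemma maximal_valuation: "x \<in> R \<or> inverse x \<in> R"
proof (rule ccontr)
  assume neg: "\<not> ?thesis"
  then have x: "x \<noteq> 0" using subring_0[OF R] by auto
  have deg: "Polynomial.degree p > 0" if "\<forall>i. coeff p i \<in> R" "t * poly p y = 1" for p y
  proof (rule ccontr)
    assume "\<not> ?thesis"
    then obtain a where "p = [:a:]" by (metis degree_eq_zeroE gr0I)
    then show False using not_t_mult[of a] that(1)[rule_format, of 0] that(2) by simp
  qed
  have False if "\<forall>i. coeff p i \<in> R" "t * poly p x = 1" "\<forall>i. coeff r i \<in> R" "t * poly r (inverse x) = 1" for p r
    using that
  proof (induction "Polynomial.degree p + Polynomial.degree r" arbitrary: p r rule: less_induct)
    case less
    show ?case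
    proof (cases "Polynomial.degree r \<le> Polynomial.degree p")
      case True
      then obtain p' where "\<forall>i. coeff p' i \<in> R" "t * poly p' x = 1" "Polynomial.degree p' < Polynomial.degree p"
        using reduce_relation[of x p r] x less.prems deg[OF less.prems(3,4)] by blast
      then show False using less.hyps[of p' r] less.prems by simp
    next
      case False
      then obtain r' where "\<forall>i. coeff r' i \<in> R" "t * poly r' (inverse x) = 1" "Polynomial.degree r' < Polynomial.degree r"
        using reduce_relation[of "inverse x" r p] x less.prems deg[OF less.prems(1,2)] by auto
      then show False using less.hyps[of p r'] less.prems by simp
    qed
  qed
  then show False using maximal_relation[of x] maximal_relation[of "inverse x"] neg by blast
qed

end

lemma maximal_subring:
  assumes S: "is_subring S" "inverse t \<notin> S"
  shows "\<exists>R. is_subring R \<and> S \<subseteq> R \<and> inverse t \<notin> R \<and>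
    (\<forall>S'. is_subring S' \<longrightarrow> R \<subseteq> S' \<longrightarrow> inverse t \<notin> S' \<longrightarrow> S' = R)"
proof -
  define A where "A = {R. is_subring R \<and> S \<subseteq> R \<and> inverse t \<notin> R}"
  have "\<exists>R\<in>A. \<forall>U\<in>A. R \<subseteq> U \<longrightarrow> U = R"
  proof (rule subset_Zorn_nonempty)
    show "A \<noteq> {}" using S unfolding A_def by blast
    fix C assume C: "C \<noteq> {}" "subset.chain A C"
    then have CA: "C \<subseteq> A" and tot: "\<And>U W. U \<in> C \<Longrightarrow> W \<in> C \<Longrightarrow> U \<subseteq> W \<or> W \<subseteq> U"
      unfolding subset_chain_def by auto
    obtain R0 where R0: "R0 \<in> C" using C by blast
    have sub: "is_subring U" if "U \<in> C" for U using that CA unfolding A_def by blast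
    have "is_subring (\<Union>C)" unfolding is_subring_def
    proof (intro conjI ballI)
      show "0 \<in> \<Union>C" "1 \<in> \<Union>C" using R0 subring_0[OF sub[OF R0]] subring_1[OF sub[OF R0]] by blast+
      fix a b assume "a \<in> \<Union>C" "b \<in> \<Union>C"
      then obtain U where "U \<in> C" "a \<in> U" "b \<in> U" using tot by (metis UnionE subsetD)
      then show "a + b \<in> \<Union>C" "a * b \<in> \<Union>C" using subring_add[OF sub] subring_mult[OF sub] by blast+
    next
      fix a assume "a \<in> \<Union>C"
      then show "- a \<in> \<Union>C" using subring_uminus[OF sub] by blast
    qed
    then show "\<Union>C \<in> A" using CA R0 unfolding A_def by blast
  qed
  then obtain R where R: "R \<in> A" "\<And>U. U \<in> A \<Longrightarrow> R \<subseteq> U \<Longrightarrow> U = R" by blast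
  have "S' = R" if "is_subring S'" "R \<subseteq> S'" "inverse t \<notin> S'" for S'
    by (rule R(2)) (use that R(1) in \<open>auto simp: A_def\<close>)
  then show ?thesis using R(1) unfolding A_def by (intro exI[of _ R]) simp
qed

section \<open>Small elements of the base field\<close>

locale adic_ring =
  fixes t :: "'k::field" and R :: "'k alg_closure set"
  assumes subring: "is_subring R" and t_nonzero: "t \<noteq> 0" and t_in: "to_ac t \<in> R"
    and t_not_unit: "inverse (to_ac t) \<notin> R"
    and valuation: "x \<in> R \<or> inverse x \<in> R"
    and unit: "b \<in> R \<Longrightarrow> inverse (1 - to_ac t * b) \<in> R"
begin

lemmas R_0 = subring_0[OF subring]
lemmas R_1 = subring_1[OF subring]
lemmas R_add = subring_add[OF subring]
lemmas R_mult = subring_mult[OF subring]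
lemmas R_uminus = subring_uminus[OF subring]
lemmas R_power = subring_power[OF subring]
lemmas R_sum = subring_sum[OF subring]

text \<open>For each element of the base field, either it or its inverse lies in \<open>R\<close>; the product of
  the inverses that are needed is a common denominator.\<close>

lemma common_denominator:
  assumes "finite A"
  shows "\<exists>s. s \<noteq> 0 \<and> to_ac s \<in> R \<and> (\<forall>a\<in>A. to_ac (s * a) \<in> R)"
  using assms
proof (induction A rule: finite_induct)
  case empty
  then show ?case using R_1 by (intro exI[of _ 1]) simp
next
  case (insert a A)
  then obtain s where s: "s \<noteq> 0" "to_ac s \<in> R" "\<forall>a\<in>A. to_ac s * to_ac a \<in> R" by auto
  show ?case
  proof (cases "to_ac a \<in> R")
    case True
    then show ?thesis using s R_mult by (intro exI[of _ s]) auto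
  next
    case False
    then have a: "a \<noteq> 0" "inverse (to_ac a) \<in> R" using R_0 valuation by force+
    have "to_ac (s * inverse a * c) \<in> R" if "c \<in> insert a A" for c
    proof (cases "c = a")
      case True
      then have "s * inverse a * c = s" using a(1) by simp
      then show ?thesis using s(2) by (simp only:)
    next
      case False
      have "to_ac (s * inverse a * c) = inverse (to_ac a) * (to_ac s * to_ac c)" by (simp add: mult_ac)
      also have "\<dots> \<in> R" using that False s(3) a(2) R_mult by blast
      finally show ?thesis .
    qed
    moreover have "to_ac (s * inverse a) \<in> R" using s(2) a(2) R_mult by simp
    ultimately show ?thesis using s(1) a(1) by (intro exI[of _ "s * inverse a"]) simp
  qed
qed

text \<open>If \<open>c\<close> is not in \<open>R\<close>, its inverse \<open>w\<close> is. Take an algebraic equation of \<open>w\<close> over the base field with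
  nonzero constant term, scaled so that its coefficients lie in \<open>R\<close>. It shows that \<open>w\<close> divides the constant
  term, so the constant term, which lies in the base field, brings \<open>c\<close> into \<open>R\<close>.\<close>

lemma small_multiple:
  "\<exists>s. s \<noteq> 0 \<and> to_ac s \<in> R \<and> (\<exists>b\<in>R. to_ac s * c = to_ac t * b)"
proof (cases "c \<in> R")
  case True
  then show ?thesis using t_nonzero t_in by (intro exI[of _ t]) auto
next
  case False
  define w where "w = inverse c"
  have c: "c \<noteq> 0" using False R_0 by auto
  have w: "w \<in> R" "w \<noteq> 0" "w * c = 1" using False valuation[of c] c by (auto simp: w_def)
  obtain p :: "'k poly" where "p \<noteq> 0" "poly (map_poly to_ac p) w = 0" by (rule alg_closure_algebraic)
  then have "\<exists>q. coeff q 0 \<noteq> 0 \<and> poly (map_poly to_ac q) w = 0"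
  proof (induction p)
    case (pCons a p)
    show ?case
    proof (cases "a = 0")
      case True
      then have "poly (map_poly to_ac p) w = 0" "p \<noteq> 0" using pCons w by (auto simp: map_poly_pCons)
      then show ?thesis using pCons.IH by blast
    next
      case False
      then show ?thesis using pCons.prems by (intro exI[of _ "pCons a p"]) simp
    qed
  qed simp
  then obtain a q where q: "a \<noteq> 0" "poly (map_poly to_ac (pCons a q)) w = 0"
    by (metis coeff_pCons_0 pCons_cases)
  obtain s where s: "s \<noteq> 0" "to_ac s \<in> R" "\<forall>a\<in>range (coeff q). to_ac (s * a) \<in> R"
  proof -
    have "range (coeff q) \<subseteq> coeff q ` {..Polynomial.degree q} \<union> {0}" 
    proof
      fix c assume "c \<in> range (coeff q)"
      then obtain i where i: "c = coeff q i" by blast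
      show "c \<in> coeff q ` {..Polynomial.degree q} \<union> {0}"
        by (cases "i \<le> Polynomial.degree q") (auto simp: i coeff_eq_0)
    qed
    then have "finite (range (coeff q))" by (rule finite_subset) simp
    then show ?thesis using common_denominator that by blast
  qed
  define b where "b = - (to_ac s * poly (map_poly to_ac q) w)"
  have bR: "b \<in> R"
  proof -
    have "to_ac s * poly (map_poly to_ac q) w = (\<Sum>i\<le>Polynomial.degree (map_poly to_ac q). to_ac (s * coeff q i) * w ^ i)"
      unfolding poly_altdef sum_distrib_left by (rule sum.cong) (auto simp: coeff_map_poly mult_ac)
    also have "\<dots> \<in> R" using s(3) w(1) by (intro R_sum R_mult R_power) auto
    finally show ?thesis unfolding b_def by (rule R_uminus)
  qed
  have "to_ac a = - (w * poly (map_poly to_ac q) w)"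
    using q(2) by (simp add: map_poly_pCons eq_neg_iff_add_eq_0)
  then have sa: "to_ac (s * a) = w * b"
    unfolding to_ac_mult b_def by (simp add: mult_ac)
  show ?thesis
  proof (intro exI[of _ "t * (s * a)"] conjI bexI[of _ b])
    show "t * (s * a) \<noteq> 0" using t_nonzero s q by simp
    show "to_ac (t * (s * a)) \<in> R" unfolding to_ac_mult[of t] sa using t_in w bR R_mult by blast
    have "to_ac (t * (s * a)) * c = to_ac t * b * (w * c)"
      unfolding to_ac_mult[of t] sa by (simp only: mult_ac)
    then show "to_ac (t * (s * a)) * c = to_ac t * b" by (simp only: w(3) mult_1_right)
  qed (rule bR)
qed

lemma small_multiples:
  assumes "finite C"
  shows "\<exists>s. s \<noteq> 0 \<and> to_ac s \<in> R \<and> (\<forall>c\<in>C. \<exists>b\<in>R. to_ac s * c = to_ac t * b)"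
  using assms
proof (induction C rule: finite_induct)
  case empty
  then show ?case using R_1 by (intro exI[of _ 1]) simp
next
  case (insert c C)
  then obtain s where s: "s \<noteq> 0" "to_ac s \<in> R" "\<forall>c\<in>C. \<exists>b\<in>R. to_ac s * c = to_ac t * b" by blast
  obtain s' b' where s': "s' \<noteq> 0" "to_ac s' \<in> R" "b' \<in> R" "to_ac s' * c = to_ac t * b'" using small_multiple by blast
  have "\<exists>b\<in>R. to_ac (s * s') * d = to_ac t * b" if "d \<in> insert c C" for d
  proof (cases "d = c")
    case True
    have "to_ac (s * s') * d = to_ac s * (to_ac s' * c)" using True by (simp add: mult.assoc)
    also have "\<dots> = to_ac t * (to_ac s * b')" unfolding s'(4) by (simp only: mult_ac)
    finally show ?thesis using R_mult[OF s(2) s'(3)] by (rule bexI)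
  next
    case False
    then have "d \<in> C" using that by simp
    from bspec[OF s(3) this] obtain b where b: "b \<in> R" "to_ac s * d = to_ac t * b"
      by (elim bexE) (rule that)
    have "to_ac (s * s') * d = to_ac s' * (to_ac s * d)" by (simp only: to_ac_mult mult_ac)
    also have "\<dots> = to_ac t * (to_ac s' * b)" unfolding b(2) by (simp only: mult_ac)
    finally show ?thesis using R_mult[OF s'(2) b(1)] by (rule bexI)
  qed
  moreover have "s * s' \<noteq> 0" "to_ac (s * s') \<in> R" using s(1,2) s'(1,2) R_mult by simp_all
  ultimately show ?case by (intro exI[of _ "s * s'"] conjI ballI)
qed

lemma t_powers_distinct: "inj (\<lambda>i. t ^ i)"
proof (rule injI, rule ccontr)
  fix i j :: nat assume eq: "t ^ i = t ^ j" and "i \<noteq> j"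
  have False if "t ^ a = t ^ b" "a < b" for a b
  proof -
    have "t ^ b = t ^ a * t ^ (b - a)" using that(2) by (metis le_add_diff_inverse less_imp_le power_add)
    then have "t ^ a * t ^ (b - a) = t ^ a * 1" using that(1) by simp
    then have one: "t ^ (b - a) = 1" using t_nonzero by simp
    have "Suc (b - a - 1) = b - a" using that(2) by simp
    then have "t * t ^ (b - a - 1) = 1" using one power_Suc[of t "b - a - 1"] by simp
    then have "to_ac (t * t ^ (b - a - 1)) = to_ac 1" by (rule arg_cong)
    then have "to_ac t * to_ac t ^ (b - a - 1) = 1" by simp
    then have "inverse (to_ac t) = to_ac t ^ (b - a - 1)" by (rule inverse_unique)
    then show False using t_not_unit R_power[OF t_in] by simp
  qed
  then show False using eq \<open>i \<noteq> j\<close> by (metis linorder_neqE_nat)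
qed

lemma infinite_t_powers: "infinite (range (\<lambda>i. t ^ i))"
  using t_powers_distinct by (metis finite_imageD infinite_UNIV_nat)

end

text \<open>Excluding all relations \<open>t p(t) = 1\<close> with integral coefficients ensures that \<open>t\<close> is not a unit
  in the subring it generates. In the uncountable case the countably many integral polynomials have only
  countably many roots.\<close>

lemma transcendental_or_two:
  assumes "uncountable (UNIV :: 'k::field set) \<or> CHAR('k) = 0"
  shows "\<exists>t::'k. t \<noteq> 0 \<and> (\<forall>p. (\<forall>i. coeff p i \<in> \<int>) \<longrightarrow> t * poly p t \<noteq> 1)"
proof (cases "CHAR('k) = 0")
  case True
  have "(2 :: 'k) \<noteq> 0"
    using of_nat_eq_0_iff_char_dvd[of 2, where 'a='k] True by simp
  moreover have "2 * poly p 2 \<noteq> (1 :: 'k)" if "\<forall>i. coeff p i \<in> \<int>" for p :: "'k poly"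
  proof
    assume eq: "2 * poly p 2 = (1 :: 'k)"
    have "poly p 2 \<in> (\<int> :: 'k set)" unfolding poly_altdef using that by (auto intro!: Ints_sum Ints_mult Ints_power)
    then obtain z where z: "poly p 2 = of_int z" by (auto elim: Ints_cases)
    then have "of_int (2 * z - 1) = (0 :: 'k)" using eq by simp
    then have "int CHAR('k) dvd 2 * z - 1" by (simp only: of_int_eq_0_iff_char_dvd)
    then show False using True by simp presburger
  qed
  ultimately show ?thesis by blast
next
  case False
  define Z where "Z = {p :: 'k poly. \<forall>i. coeff p i \<in> \<int>}"
  have "Z \<subseteq> range (\<lambda>zs :: int list. Poly (map of_int zs))"
  proof
    fix p assume p: "p \<in> Z"
    have "\<forall>i. \<exists>z. coeff p i = of_int z" using p unfolding Z_def Ints_def by blast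
    then obtain z where z: "\<And>i. coeff p i = of_int (z i)" by metis
    have "p = Poly (map of_int (map z [0..<Suc (Polynomial.degree p)]))"
      by (rule poly_eqI) (auto simp: nth_default_def coeff_eq_0 less_Suc_eq_le simp flip: z simp del: upt_Suc)
    then show "p \<in> range (\<lambda>zs :: int list. Poly (map of_int zs))" by blast
  qed
  then have "countable Z" by (rule countable_subset) simp
  moreover have "finite {x. x * poly p x = 1}" for p :: "'k poly"
  proof -
    have "[:0, 1:] * p - 1 \<noteq> 0"
    proof
      assume "[:0, 1:] * p - 1 = 0"
      then have "poly ([:0, 1:] * p - 1) 0 = 0" by simp
      then show False by simp
    qed
    then have "finite {x. poly ([:0, 1:] * p - 1) x = 0}" by (rule poly_roots_finite)
    then show ?thesis by simp
  qed
  ultimately have "countable (insert 0 (\<Union>p\<in>Z. {x. x * poly p x = 1}))"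
    by (auto intro: countable_finite)
  then have "\<exists>t. t \<notin> insert 0 (\<Union>p\<in>Z. {x. x * poly p x = 1})"
    using assms False by (metis UNIV_eq_I)
  then show ?thesis unfolding Z_def by blast
qed

lemma exists_adic_ring:
  assumes "uncountable (UNIV :: 'k::field set) \<or> CHAR('k) = 0"
  shows "\<exists>(t::'k) R. adic_ring t R"
proof -
  obtain t :: 'k where t: "t \<noteq> 0" "\<And>p. (\<forall>i. coeff p i \<in> \<int>) \<Longrightarrow> t * poly p t \<noteq> 1"
    using transcendental_or_two[OF assms] by blast
  let ?Z = "\<int> :: 'k alg_closure set"
  have Z: "is_subring ?Z" unfolding is_subring_def by auto
  define S where "S = adjoin ?Z (to_ac t)"
  have S: "is_subring S" "to_ac t \<in> S" unfolding S_def by (rule is_subring_adjoin[OF Z], rule in_adjoin[OF Z])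
  have "inverse (to_ac t) \<notin> S"
  proof
    assume "inverse (to_ac t) \<in> S"
    then obtain p where p: "inverse (to_ac t) = poly p (to_ac t)" "\<forall>i. coeff p i \<in> \<int>"
      unfolding S_def adjoin_def by blast
    have "\<forall>i. \<exists>z. coeff p i = of_int z" using p(2) unfolding Ints_def by blast
    then obtain z where z: "\<And>i. coeff p i = of_int (z i)" by metis
    define q :: "'k poly" where "q = (\<Sum>i\<le>Polynomial.degree p. Polynomial.monom (of_int (z i)) i)"
    have "poly p (to_ac t) = to_ac (poly q t)"
      unfolding poly_altdef[of p] q_def by (simp add: z poly_sum poly_monom to_ac_sum)
    then have "to_ac (t * poly q t) = to_ac t * inverse (to_ac t)" using p(1) by simp
    also have "\<dots> = to_ac 1" using t(1) by simp
    finally have "t * poly q t = 1" by (simp only: to_ac_eq_iff)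
    moreover have "\<forall>i. coeff q i \<in> \<int>" unfolding q_def coeff_sum by (auto intro!: Ints_sum)
    ultimately show False using t(2) by blast
  qed
  then obtain R where R: "is_subring R" "S \<subseteq> R" "inverse (to_ac t) \<notin> R"
    "\<And>S'. is_subring S' \<Longrightarrow> R \<subseteq> S' \<Longrightarrow> inverse (to_ac t) \<notin> S' \<Longrightarrow> S' = R"
    using maximal_subring[OF S(1)] by blast
  have tR: "to_ac t \<in> R" "to_ac t \<noteq> 0" using R(2) S(2) t(1) by auto
  have "adic_ring t R"
  proof
    show "x \<in> R \<or> inverse x \<in> R" for x by (rule maximal_valuation[OF R(1) tR R(3,4)])
    show "inverse (1 - to_ac t * b) \<in> R" if "b \<in> R" for b by (rule maximal_unit[OF R(1) tR R(3,4) that])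
  qed (use R tR t in auto)
  then show ?thesis by blast
qed

lemma prime_imp_irreducible:
  fixes p :: "'k::field mpoly"
  assumes p: "Factorial_Ring.prime_elem p"
  shows "Factorial_Ring.irreducible p"
proof (rule Factorial_Ring.irreducibleI)
  have unit: "b dvd 1" if ab: "p = a * b" "p dvd a" for a b
  proof -
    obtain c where c: "a = p * c" using ab(2) by (elim dvdE)
    have "p * 1 = p * (c * b)" using ab(1) unfolding c mult.assoc by (simp only: mult_1_right)
    then have "1 = c * b" using p by (metis mult_left_cancel prime_elem_not_zeroI)
    then show ?thesis by (metis dvd_triv_right)
  qed
  fix a b assume ab: "p = a * b"
  then have "p dvd a \<or> p dvd b" using prime_elem_dvd_multD[OF p] by (metis dvd_refl)
  then show "a dvd 1 \<or> b dvd 1" using unit[OF ab] unit[of b a] ab by (auto simp: mult.commute)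
qed (use p prime_elem_not_unit in auto)

section \<open>Points off and on hypersurfaces\<close>

text \<open>All coordinates but one are specialized; what remains is a univariate polynomial in that
  coordinate.\<close>

lemma ev_fun_upd:
  assumes \<phi>: "comm_ring_hom \<phi>"
  shows "ev \<phi> (z(n := y)) p = poly (map_poly (ev \<phi> z) (upoly n p)) y"
proof -
  let ?z = "z(n := y)"
  interpret h: comm_ring_hom "ev \<phi> ?z" by (rule comm_ring_hom_ev[OF \<phi>])
  have "ev \<phi> ?z p = ev \<phi> ?z (poly (upoly n p) (Var n))" by (simp only: poly_upoly)
  also have "\<dots> = (\<Sum>i\<le>vdeg n p. ev \<phi> ?z (coeff (upoly n p) i) * y ^ i)"
    unfolding poly_altdef by (simp add: h.hom_sum h.hom_mult h.hom_power \<phi>)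
  also have "\<dots> = (\<Sum>i\<le>vdeg n p. ev \<phi> z (coeff (upoly n p) i) * y ^ i)"
  proof (rule sum.cong[OF refl])
    fix i
    have "ev \<phi> ?z (coeff (upoly n p) i) = ev \<phi> z (coeff (upoly n p) i)"
      by (rule ev_cong) (use vars_coeff_upoly[of n p i] in auto)
    then show "ev \<phi> ?z (coeff (upoly n p) i) * y ^ i = ev \<phi> z (coeff (upoly n p) i) * y ^ i" by simp
  qed
  also have "\<dots> = (\<Sum>i\<le>vdeg n p. coeff (map_poly (ev \<phi> z) (upoly n p)) i * y ^ i)"
    by (simp add: coeff_map_poly)
  also have "\<dots> = poly (map_poly (ev \<phi> z) (upoly n p)) y"
    unfolding poly_altdef
    by (rule sum.mono_neutral_right)
       (use map_poly_degree_leq[of "ev \<phi> z" "upoly n p"] in \<open>auto simp: coeff_eq_0\<close>)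
  finally show ?thesis .
qed

lemma nonvanishing_point:
  fixes \<phi> :: "'k::field \<Rightarrow> 'b::field"
  assumes \<phi>: "comm_ring_hom \<phi>" and S: "infinite S" and p: "p \<noteq> 0"
  shows "\<exists>z. (\<forall>i. z i \<in> S) \<and> ev \<phi> z p \<noteq> 0"
  using p
proof (induction "card (vars p)" arbitrary: p rule: less_induct)
  case less
  interpret comm_ring_hom \<phi> by (rule \<phi>)
  show ?case
  proof (cases "vars p = {}")
    case True
    then obtain c where c: "p = Const c" using vars_empty_iff by blast
    then have "c \<noteq> 0" using less.prems by auto
    then have "\<phi> c * \<phi> (inverse c) = 1" by (simp add: hom_one flip: hom_mult)
    then have "\<phi> c \<noteq> 0" by auto
    moreover obtain s where "s \<in> S" using S by (metis ex_in_conv finite.emptyI)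
    ultimately show ?thesis using c \<phi> by (intro exI[of _ "\<lambda>_. s"]) simp
  next
    case False
    then obtain n where n: "n \<in> vars p" by blast
    define l where "l = lead_coeff (upoly n p)"
    have l: "l \<noteq> 0" "vars l \<subseteq> vars p - {n}"
      using less.prems vars_coeff_upoly[of n p] unfolding l_def by simp_all
    have "card (vars l) < card (vars p)" by (rule psubset_card_mono) (use l n in auto)
    then obtain z where z: "\<forall>i. z i \<in> S" "ev \<phi> z l \<noteq> 0" using less.hyps l(1) by blast
    have "coeff (map_poly (ev \<phi> z) (upoly n p)) (vdeg n p) \<noteq> 0"
      using z(2) by (simp add: coeff_map_poly l_def)
    then have "map_poly (ev \<phi> z) (upoly n p) \<noteq> 0" by auto
    then have "finite {y. poly (map_poly (ev \<phi> z) (upoly n p)) y = 0}" by (rule poly_roots_finite)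
    then obtain y where "y \<in> S" "poly (map_poly (ev \<phi> z) (upoly n p)) y \<noteq> 0"
      using S by (metis (mono_tags, lifting) finite_subset mem_Collect_eq subsetI)
    then show ?thesis using z(1) by (intro exI[of _ "z(n := y)"]) (simp add: ev_fun_upd[OF \<phi>])
  qed
qed

text \<open>By elimination \<open>u q + s w\<close> is free of a variable \<open>x\<^sub>n\<close> occurring in \<open>q\<close>. Choose the other
  coordinates such that neither this combination nor the leading coefficient of \<open>q\<close> vanishes, and let the
  last coordinate be a root of \<open>q\<close>. Then \<open>s w\<close>, and so \<open>w\<close>, does not vanish.\<close>

lemma zero_point:
  fixes q :: "'k::field mpoly"
  assumes q: "Factorial_Ring.prime_elem q" "\<not> q dvd w" and inf: "infinite (UNIV :: 'k alg_closure set)"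
  shows "\<exists>z. ev to_ac z q = 0 \<and> ev to_ac z w \<noteq> 0"
proof -
  note hom = comm_ring_hom_to_ac
  have qnz: "q \<noteq> 0" using q by auto
  have irr: "Factorial_Ring.irreducible q" by (rule prime_imp_irreducible[OF q(1)])
  have "vars q \<noteq> {}"
    using qnz prime_elem_not_unit[OF q(1)] vars_empty_iff[of q] unit_iff[of q] by auto
  then obtain n where n: "n \<in> vars q" by blast
  obtain u s where us: "u * q + s * w \<noteq> 0" "n \<notin> vars (u * q + s * w)" using bezout[OF irr q(2)] by blast
  define l where "l = lead_coeff (upoly n q)"
  have "(u * q + s * w) * l \<noteq> 0" using us(1) qnz by (simp add: l_def)
  then obtain z where z: "ev to_ac z ((u * q + s * w) * l) \<noteq> 0"
    using nonvanishing_point[OF hom inf] by blast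
  then have z1: "ev to_ac z (u * q + s * w) \<noteq> 0" and z2: "ev to_ac z l \<noteq> 0"
    unfolding ev_mult[OF hom] by simp_all
  define Q where "Q = map_poly (ev to_ac z) (upoly n q)"
  have "coeff Q (vdeg n q) \<noteq> 0" unfolding Q_def using z2 by (simp add: coeff_map_poly l_def)
  then have "vdeg n q \<le> Polynomial.degree Q" by (rule le_degree)
  moreover have "vdeg n q > 0" using n vdeg_0_iff[of n q] by simp
  ultimately obtain y where y: "poly Q y = 0" using alg_closed_imp_poly_has_root[of Q] by auto
  define z' where "z' = z(n := y)"
  have zq: "ev to_ac z' q = 0" unfolding z'_def ev_fun_upd[OF hom] using y by (simp add: Q_def)
  have "ev to_ac z' (u * q + s * w) = ev to_ac z (u * q + s * w)"
    unfolding z'_def by (rule ev_cong) (use us(2) in auto)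
  then have "ev to_ac z' w \<noteq> 0" using z1 zq by (auto simp: ev_add[OF hom] ev_mult[OF hom])
  then show ?thesis using zq by blast
qed

lemma finitely_many_primes:
  assumes "P \<noteq> (0 :: 'k::field mpoly)"
  shows "\<exists>B. finite B \<and> (\<forall>b\<in>B. Factorial_Ring.prime_elem b) \<and>
    (\<forall>q. Factorial_Ring.prime_elem q \<longrightarrow> q dvd P \<longrightarrow> (\<exists>b\<in>B. b dvd q))"
  using assms
proof (induction "tdeg P" arbitrary: P rule: less_induct)
  case less
  show ?case
  proof (cases "P dvd 1")
    case True
    then show ?thesis using prime_elem_not_unit dvd_trans by (intro exI[of _ "{}"]) blast
  next
    case False
    then obtain p P' where p: "Factorial_Ring.prime_elem p" and P: "P = p * P'"
      using prime_factor less.prems by (metis dvdE)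
    then have nz: "p \<noteq> 0" "P' \<noteq> 0" using less.prems by auto
    have smaller: "tdeg P' < tdeg P"
      using tdeg_mult[OF nz] tdeg_pos[OF nz(1) prime_elem_not_unit[OF p]] P by simp
    then obtain B where B: "finite B" "\<forall>b\<in>B. Factorial_Ring.prime_elem b"
      "\<forall>q. Factorial_Ring.prime_elem q \<longrightarrow> q dvd P' \<longrightarrow> (\<exists>b\<in>B. b dvd q)"
      using less.hyps[OF smaller nz(2)] by blast
    have "\<exists>b\<in>insert p B. b dvd q" if q: "Factorial_Ring.prime_elem q" "q dvd P" for q
    proof -
      consider "q dvd p" | "q dvd P'" using prime_elem_dvd_multD[OF q(1)] q(2) P by blast
      then show ?thesis
      proof cases
        case 1
        then obtain w where w: "p = q * w" by (elim dvdE)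
        then have "w dvd 1"
          using Factorial_Ring.irreducibleD[OF prime_imp_irreducible[OF p] w] prime_elem_not_unit[OF q(1)] by blast
        then have "p dvd q" using mult_dvd_mono[OF dvd_refl, of w 1 q] w by simp
        then show ?thesis by blast
      next
        case 2
        then show ?thesis using B(3) q(1) by blast
      qed
    qed
    then show ?thesis using B p by (intro exI[of _ "insert p B"]) simp
  qed
qed

section \<open>Attraction to a point\<close>

text \<open>The matrix \<open>s I + v l\<^sup>T\<close>.\<close>

definition rank_one_perturbation :: "'k::field \<Rightarrow> (nat \<Rightarrow> 'k) \<Rightarrow> (nat \<Rightarrow> 'k) \<Rightarrow> nat \<Rightarrow> nat \<Rightarrow> 'k" where
  "rank_one_perturbation s v l i j = (if i = j then s else 0) + v i * l j"

text \<open>The Sherman--Morrison formula for the inverse.\<close>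

lemma rank_one_perturbation_invertible:
  fixes s :: "'k::field"
  assumes s: "s \<noteq> 0" "s + (\<Sum>j\<le>m. l j * v j) \<noteq> 0"
  defines "\<nu> \<equiv> rank_one_perturbation (1 / s) v (\<lambda>j. - l j / (s * (s + (\<Sum>j\<le>m. l j * v j))))"
  shows "inverse_to m (rank_one_perturbation s v l) \<nu>" "inverse_to m \<nu> (rank_one_perturbation s v l)"
proof -
  have prod: "inverse_to m (rank_one_perturbation a v f) (rank_one_perturbation b v g)"
    if "a * b = 1" "\<And>j. a * g j + b * f j + (\<Sum>j\<le>m. f j * v j) * g j = 0" for a b f g
    unfolding inverse_to_def
  proof (intro allI impI)
    fix i k assume ik: "i \<le> m" "k \<le> m"
    have "(\<Sum>j\<le>m. rank_one_perturbation a v f i j * rank_one_perturbation b v g j k) =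
      (\<Sum>j\<le>m. (if j = i then (if j = k then a * b else 0) + a * v j * g k else 0) +
        ((if j = k then v i * f j * b else 0) + v i * (f j * v j) * g k))"
      by (rule sum.cong) (auto simp: rank_one_perturbation_def algebra_simps)
    also have "\<dots> = (if i = k then a * b else 0) + a * v i * g k + (v i * f k * b + v i * (\<Sum>j\<le>m. f j * v j) * g k)"
      using ik by (simp add: sum.distrib sum_distrib_left sum_distrib_right)
    also have "\<dots> = (if i = k then a * b else 0) + v i * (a * g k + b * f k + (\<Sum>j\<le>m. f j * v j) * g k)"
      by (simp add: algebra_simps)
    finally show "(\<Sum>j\<le>m. rank_one_perturbation a v f i j * rank_one_perturbation b v g j k) = (if i = k then 1 else 0)"
      using that by simp
  qed
  define w where "w = (\<Sum>j\<le>m. l j * v j)"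
  have w: "s + w \<noteq> 0" using s by (simp add: w_def)
  have sum: "(\<Sum>j\<le>m. - l j / (s * (s + w)) * v j) = - w / (s * (s + w))"
    unfolding w_def by (simp add: sum_divide_distrib sum_negf[symmetric])
  show "inverse_to m (rank_one_perturbation s v l) \<nu>"
    unfolding \<nu>_def w_def[symmetric]
  proof (rule prod)
    show "s * (- l j / (s * (s + w))) + 1 / s * l j + (\<Sum>j\<le>m. l j * v j) * (- l j / (s * (s + w))) = 0" for j
      unfolding w_def[symmetric] using s(1) w by (simp add: divide_simps) (simp add: algebra_simps)
  qed (use s in simp)
  show "inverse_to m \<nu> (rank_one_perturbation s v l)"
    unfolding \<nu>_def w_def[symmetric]
  proof (rule prod)
    show "1 / s * l j + s * (- l j / (s * (s + w))) + (\<Sum>j\<le>m. - l j / (s * (s + w)) * v j) * l j = 0" for j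
      unfolding sum using s(1) w by (simp add: divide_simps) (simp add: algebra_simps)
  qed (use s in simp)
qed

context adic_ring
begin

lemma ev_in_R:
  assumes "\<And>c. c \<in> Poly_Mapping.range p \<Longrightarrow> to_ac c \<in> R" "\<And>i. i \<in> vars p \<Longrightarrow> y i \<in> R"
  shows "ev to_ac y p \<in> R"
  by (rule ev_closed) (use assms R_0 R_1 R_add R_mult in auto)

text \<open>Taylor expansion to first order: evaluate on \<open>y + X e\<close> and compare the values at \<open>X = 0\<close>
  and \<open>X = \<delta>\<close>.\<close>

lemma ev_congruence:
  assumes p: "\<And>c. c \<in> Poly_Mapping.range p \<Longrightarrow> to_ac c \<in> R"
    and y: "\<And>i. i \<in> vars p \<Longrightarrow> y i \<in> R" "\<And>i. i \<in> vars p \<Longrightarrow> e i \<in> R" and \<delta>: "\<delta> \<in> R"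
  shows "\<exists>b\<in>R. ev to_ac (\<lambda>i. y i + \<delta> * e i) p = ev to_ac y p + \<delta> * b"
proof -
  define W where "W = ev (\<lambda>c. [:to_ac c:]) (\<lambda>i. [:y i, e i:]) p"
  have W: "\<forall>i. coeff W i \<in> R"
    unfolding W_def
    by (rule ev_closed)
       (use p y R_0 R_1 in \<open>auto simp: coeff_mult coeff_pCons split: nat.splits intro!: R_sum R_mult R_add\<close>)
  have poly_W: "poly W x = ev to_ac (\<lambda>i. y i + x * e i) p" for x
    unfolding W_def by (subst hom_ev[OF comm_ring_hom_poly]) simp
  obtain a W' where aW: "W = pCons a W'" by (cases W)
  have "poly W' \<delta> \<in> R"
    by (rule subring_poly[OF subring _ \<delta>]) (use W in \<open>metis aW coeff_pCons_Suc\<close>)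
  moreover have "poly W \<delta> = poly W 0 + \<delta> * poly W' \<delta>" by (simp add: aW)
  ultimately show ?thesis unfolding poly_W by auto
qed

text \<open>Write \<open>D = l(F(v))\<close>. The neighbourhood \<open>U\<close> of \<open>v\<close> consists of the nonzero multiples of vectors
  congruent to \<open>v\<close> modulo \<open>D t\<close>. On \<open>U\<close> the form \<open>l \<circ> F\<close> agrees with \<open>D\<close> up to a nonzero factor, so it does not
  vanish, and \<open>\<Phi>(y) = s F(y) + l(F(y)) v\<close> is proportional to \<open>v + (s / l(F(y))) F(y)\<close>, which is in \<open>U\<close> again as soon
  as \<open>s\<close> is divisible by \<open>D\<^sup>2 t\<close>. Likewise \<open>\<Phi>(z)\<close> is in \<open>U\<close> once \<open>s\<close> is small with respect to \<open>F(z)\<close>,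
  \<open>l(F(z))\<close> and \<open>D\<close>. These are finitely many conditions on \<open>s\<close>, independent of the number of iterations.\<close>

lemma attraction:
  fixes F :: "nat \<Rightarrow> 'k mpoly" and v l :: "nat \<Rightarrow> 'k" and Z :: "(nat \<Rightarrow> 'k alg_closure) set"
  assumes F: "\<And>i. i \<le> m \<Longrightarrow> homogeneous m d (F i)" "d \<ge> 1"
    and F_R: "\<And>i c. i \<le> m \<Longrightarrow> c \<in> Poly_Mapping.range (F i) \<Longrightarrow> to_ac c \<in> R"
    and v: "\<And>i. i \<le> m \<Longrightarrow> to_ac (v i) \<in> R" and l: "\<And>i. i \<le> m \<Longrightarrow> to_ac (l i) \<in> R"
    and Z: "finite Z"
    and nz: "\<And>z. z \<in> insert (\<lambda>i. to_ac (v i)) Z \<Longrightarrow> (\<Sum>j\<le>m. to_ac (l j) * ev to_ac z (F j)) \<noteq> 0"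
  shows "\<exists>s. s \<noteq> 0 \<and> s + (\<Sum>j\<le>m. l j * v j) \<noteq> 0 \<and>
    (\<forall>z\<in>Z. \<forall>n. \<exists>i\<le>m. ev to_ac z (iterate (lin_comb m (rank_one_perturbation s v l) F) (Suc n) i) \<noteq> 0)"
proof -
  note hom = comm_ring_hom_to_ac
  define E where "E y i = ev to_ac y (F i)" for y i
  define L where "L y = (\<Sum>j\<le>m. to_ac (l j) * E y j)" for y
  define v' where "v' i = to_ac (v i)" for i
  define \<tau> where "\<tau> = to_ac t"
  define D where "D = L v'"
  define w where "w = (\<Sum>j\<le>m. l j * v j)"
  have v'_eq: "v' = (\<lambda>i. to_ac (v i))" by (simp add: fun_eq_iff v'_def)
  have D0: "D \<noteq> 0" using nz[of v'] v'_eq by (simp add: D_def L_def E_def)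
  have Lnz: "L z \<noteq> 0" if "z \<in> Z" for z using nz[of z] that by (simp add: L_def E_def)
  have \<tau>: "\<tau> \<in> R" "inverse \<tau> \<notin> R" using t_in t_not_unit by (simp_all add: \<tau>_def)
  have vars_F: "j \<le> m" if "j \<in> vars (F i)" "i \<le> m" for i j
    using F(1)[OF that(2)] that(1) by (auto simp: homogeneous_iff)
  have E_R: "E y i \<in> R" if "i \<le> m" "\<And>j. j \<le> m \<Longrightarrow> y j \<in> R" for y i
    unfolding E_def by (rule ev_in_R) (use F_R that vars_F in auto)
  have L_R: "L y \<in> R" if "\<And>j. j \<le> m \<Longrightarrow> y j \<in> R" for y
    unfolding L_def by (intro R_sum R_mult) (use E_R l that in auto)
  have D_R: "D \<in> R" unfolding D_def by (rule L_R) (simp add: v'_def v)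

  \<comment> \<open>The entries demand that \<open>s\<close> be small for staying in \<open>U\<close>, for invertibility of the matrix, and for entering
    \<open>U\<close> from each point of \<open>Z\<close>.\<close>
  define C where "C = {inverse (D * D), inverse (to_ac w)} \<union> (\<lambda>(z, i). E z i * inverse (L z * D)) ` (Z \<times> {..m})"
  have "finite C" unfolding C_def using Z by simp
  from small_multiples[OF this, folded \<tau>_def] obtain s
    where s: "s \<noteq> 0" "\<forall>c\<in>C. \<exists>b\<in>R. to_ac s * c = \<tau> * b"
    by (elim exE conjE) (rule that)
  note approx = bspec[OF s(2)]
  define \<sigma> where "\<sigma> = to_ac s"
  define \<Phi> where "\<Phi> = lin_comb m (rank_one_perturbation s v l) F"
  have ev_\<Phi>: "ev to_ac y (\<Phi> i) = \<sigma> * E y i + v' i * L y" if "i \<le> m" for y i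
  proof -
    have "ev to_ac y (\<Phi> i) = (\<Sum>j\<le>m. to_ac (rank_one_perturbation s v l i j) * E y j)"
      unfolding \<Phi>_def lin_comb_def E_def by (simp add: ev_sum[OF hom] ev_mult[OF hom] hom)
    also have "\<dots> = (\<Sum>j\<le>m. (if j = i then \<sigma> * E y j else 0) + v' i * (to_ac (l j) * E y j))"
      by (rule sum.cong) (auto simp: rank_one_perturbation_def \<sigma>_def v'_def algebra_simps)
    also have "\<dots> = \<sigma> * E y i + v' i * L y"
      using that by (simp add: sum.distrib L_def sum_distrib_left)
    finally show ?thesis .
  qed

  define U where "U y \<longleftrightarrow> (\<exists>c e. c \<noteq> 0 \<and> (\<forall>i\<le>m. e i \<in> R \<and> y i = c * (v' i + D * \<tau> * e i)))" for y
  have U_props: "L y \<noteq> 0 \<and> U (\<lambda>i. ev to_ac y (\<Phi> i))" if "U y" for y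
  proof -
    obtain c e where c: "c \<noteq> 0" and e: "\<And>i. i \<le> m \<Longrightarrow> e i \<in> R" 
      and y: "\<And>i. i \<le> m \<Longrightarrow> y i = c * (v' i + D * \<tau> * e i)"
      using \<open>U y\<close> unfolding U_def by blast
    define y' where "y' i = v' i + D * \<tau> * e i" for i
    have y'_R: "y' i \<in> R" if "i \<le> m" for i
      unfolding y'_def v'_def by (intro R_add R_mult) (use that v e \<tau> D_R in auto)
    have Ey: "E y i = c ^ d * E y' i" if "i \<le> m" for i
    proof -
      have "E y i = ev to_ac (\<lambda>i. c * y' i) (F i)"
        unfolding E_def by (rule ev_cong) (use y vars_F that in \<open>auto simp: y'_def\<close>)
      then show ?thesis unfolding E_def using ev_scale[OF F(1)[OF that]] by simp
    qed
    have "\<forall>i\<in>{..m}. \<exists>b\<in>R. E y' i = E v' i + D * \<tau> * b"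
    proof
      fix i assume "i \<in> {..m}"
      then have i: "i \<le> m" by simp
      show "\<exists>b\<in>R. E y' i = E v' i + D * \<tau> * b"
        unfolding E_def y'_def
        by (rule ev_congruence) (use F_R[OF i] vars_F[OF _ i] v e R_mult[OF D_R \<tau>(1)] in \<open>auto simp: v'_def\<close>)
    qed
    then obtain g where g: "\<And>i. i \<le> m \<Longrightarrow> g i \<in> R" "\<And>i. i \<le> m \<Longrightarrow> E y' i = E v' i + D * \<tau> * g i"
      by (metis atMost_iff)
    define b where "b = - (\<Sum>j\<le>m. to_ac (l j) * g j)"
    have b: "b \<in> R" unfolding b_def by (intro R_uminus R_sum R_mult) (use l g in auto)
    \<comment> \<open>On \<open>U\<close> the form \<open>l \<circ> F\<close> is \<open>D\<close> times the unit \<open>u\<close>, up to the scaling of \<open>y\<close>.\<close>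
    define u where "u = 1 - \<tau> * b"
    have u: "inverse u \<in> R" "u \<noteq> 0"
    proof -
      show "inverse u \<in> R" unfolding u_def \<tau>_def by (rule unit[OF b])
      show "u \<noteq> 0"
      proof
        assume "u = 0"
        then have "\<tau> * b = 1" by (simp add: u_def)
        then show False using \<tau>(2) b by (metis inverse_unique)
      qed
    qed
    have "L y' = D + D * \<tau> * (\<Sum>j\<le>m. to_ac (l j) * g j)"
    proof -
      have "L y' = (\<Sum>j\<le>m. to_ac (l j) * E v' j + D * \<tau> * (to_ac (l j) * g j))"
        unfolding L_def by (rule sum.cong) (auto simp: g(2) algebra_simps)
      then show ?thesis by (simp add: sum.distrib sum_distrib_left D_def L_def)
    qed
    then have Ly': "L y' = D * u" by (simp add: u_def b_def algebra_simps)
    have Ly: "L y = c ^ d * (D * u)"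
    proof -
      have "L y = c ^ d * L y'"
        unfolding L_def sum_distrib_left by (rule sum.cong) (auto simp: Ey)
      then show ?thesis by (simp only: Ly')
    qed
    then have "L y \<noteq> 0" using c D0 u by simp
    obtain b1 where b1: "b1 \<in> R" "\<sigma> * inverse (D * D) = \<tau> * b1"
      using approx[of "inverse (D * D)"] unfolding C_def \<sigma>_def by auto
    have \<sigma>: "\<sigma> = D * D * (\<tau> * b1)" using b1(2) D0 by (simp add: field_simps)
    have step: "ev to_ac y (\<Phi> i) = c ^ d * D * u * (v' i + D * \<tau> * (b1 * E y' i * inverse u))"
      if i: "i \<le> m" for i
    proof -
      have "ev to_ac y (\<Phi> i) = \<sigma> * (c ^ d * E y' i) + v' i * (c ^ d * (D * u))"
        unfolding ev_\<Phi>[OF i] Ey[OF i] Ly ..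
      also have "\<dots> = c ^ d * D * u * v' i + D * D * (\<tau> * b1) * (c ^ d * E y' i) * (u * inverse u)"
        unfolding \<sigma> using u(2) by (simp add: algebra_simps)
      also have "\<dots> = c ^ d * D * u * (v' i + D * \<tau> * (b1 * E y' i * inverse u))"
        by (simp only: algebra_simps)
      finally show ?thesis .
    qed
    have "b1 * E y' i * inverse u \<in> R" if "i \<le> m" for i
      by (intro R_mult b1(1) u(1) E_R that y'_R)
    moreover have "c ^ d * D * u \<noteq> 0" using c D0 u by simp
    ultimately have "U (\<lambda>i. ev to_ac y (\<Phi> i))"
      unfolding U_def using step by (intro exI[of _ "c ^ d * D * u"] exI[of _ "\<lambda>i. b1 * E y' i * inverse u"]) simp
    then show ?thesis using \<open>L y \<noteq> 0\<close> by blast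
  qed
  have ev_iterate: "ev to_ac y (iterate \<Phi> (Suc n) i) = ev to_ac (\<lambda>i. ev to_ac y (\<Phi> i)) (iterate \<Phi> n i)" for y n i
    using hom_ev[OF comm_ring_hom_ev[OF hom], of y Const \<Phi> "iterate \<Phi> n i"]
    by (simp add: subst_eq_ev hom)
  have U_iterate: "U (\<lambda>i. ev to_ac y (iterate \<Phi> n i))" if "U y" for y n
    using that
  proof (induction n arbitrary: y)
    case 0
    then show ?case by (simp add: hom)
  next
    case (Suc n)
    show ?case unfolding ev_iterate by (rule Suc.IH) (use U_props[OF Suc.prems] in blast)
  qed
  have U_nonzero: "\<exists>i\<le>m. y i \<noteq> 0" if "U y" for y
  proof (rule ccontr)
    assume zero: "\<not> ?thesis"
    have "E y i = 0" if "i \<le> m" for i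
    proof -
      have "E y i = ev to_ac (\<lambda>i. 0 * y i) (F i)"
        unfolding E_def by (rule ev_cong) (use zero vars_F that in auto)
      then show ?thesis using ev_scale[OF F(1)[OF that], of to_ac 0 y] F(2) by simp
    qed
    then have "L y = 0" by (simp add: L_def)
    then show False using U_props[OF that] by blast
  qed
  have U_start: "U (\<lambda>i. ev to_ac z (\<Phi> i))" if z: "z \<in> Z" for z
  proof -
    have "\<forall>i\<in>{..m}. \<exists>b\<in>R. \<sigma> * (E z i * inverse (L z * D)) = \<tau> * b"
      unfolding \<sigma>_def by (intro ballI approx) (use z in \<open>auto simp: C_def\<close>)
    then obtain e where e: "\<And>i. i \<le> m \<Longrightarrow> e i \<in> R" "\<And>i. i \<le> m \<Longrightarrow> \<sigma> * (E z i * inverse (L z * D)) = \<tau> * e i"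
      by (metis atMost_iff)
    have "ev to_ac z (\<Phi> i) = L z * (v' i + D * \<tau> * e i)" if i: "i \<le> m" for i
    proof -
      have "L z * (v' i + D * \<tau> * e i) = L z * v' i + L z * D * (\<tau> * e i)" by (simp add: algebra_simps)
      also have "\<dots> = L z * v' i + \<sigma> * E z i * ((L z * D) * inverse (L z * D))"
        unfolding e(2)[OF i, symmetric] by (simp only: mult_ac)
      also have "\<dots> = ev to_ac z (\<Phi> i)" using Lnz[OF z] D0 by (simp add: ev_\<Phi>[OF i] mult_ac)
      finally show ?thesis ..
    qed
    then show ?thesis unfolding U_def using Lnz[OF z] e(1) by blast
  qed
  have "s + w \<noteq> 0"
  proof
    \<comment> \<open>Otherwise \<open>s / w = - 1\<close> would be divisible by \<open>t\<close>.\<close>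
    assume sw: "s + w = 0"
    then have w0: "w \<noteq> 0" and sw': "s = - w" using s(1) by (auto simp: eq_neg_iff_add_eq_0)
    obtain b where b: "b \<in> R" "to_ac s * inverse (to_ac w) = \<tau> * b"
      using approx[of "inverse (to_ac w)"] unfolding C_def by auto
    have "to_ac s * inverse (to_ac w) = - 1" unfolding sw' using w0 by simp
    then have "\<tau> * (- b) = 1" using b(2) by simp
    then show False using \<tau>(2) R_uminus[OF b(1)] by (metis inverse_unique)
  qed
  moreover have "\<exists>i\<le>m. ev to_ac z (iterate \<Phi> (Suc n) i) \<noteq> 0" if "z \<in> Z" for z n
    unfolding ev_iterate by (rule U_nonzero[OF U_iterate[OF U_start[OF that]]])
  ultimately show ?thesis using s(1) unfolding w_def \<Phi>_def by blast
qed

lemma integral_representative: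
  assumes F: "F \<in> hom_tuples_deg m d" "no_common_factor m F"
  shows "\<exists>F'. F' \<in> hom_tuples_deg m d \<and> no_common_factor m F' \<and> proj_rel m `` {F'} = proj_rel m `` {F} \<and>
    (\<forall>i\<le>m. \<forall>c\<in>Poly_Mapping.range (F' i). to_ac c \<in> R)"
proof -
  have "finite (\<Union>i\<le>m. Poly_Mapping.range (F i))" by simp
  then obtain s where s: "s \<noteq> 0" "\<forall>a\<in>(\<Union>i\<le>m. Poly_Mapping.range (F i)). to_ac (s * a) \<in> R"
    using common_denominator by blast
  define F' where "F' i = Const s * F i" for i
  have F'_deg: "F' \<in> hom_tuples_deg m d"
    using F(1) s(1) homogeneous_mult[OF homogeneous_Const, of m d _ s]
    unfolding hom_tuples_deg_def F'_def by auto
  moreover have "no_common_factor m F'"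
    unfolding no_common_factor_def
  proof (intro allI impI)
    fix p assume p: "\<forall>i\<le>m. p dvd F' i"
    have "p dvd F i" if "i \<le> m" for i
    proof -
      have "Const (inverse s) * F' i = F i"
        unfolding F'_def mult.assoc[symmetric] Const.hom_mult[symmetric] using s(1) by (simp add: Const.hom_one)
      then show ?thesis using p that by (metis dvd_mult)
    qed
    then show "p dvd 1" using F(2) unfolding no_common_factor_def by blast
  qed
  moreover have "(F', F) \<in> proj_rel m"
    using F(1) F'_deg unfolding proj_rel_def hom_tuples_def F'_def by (auto simp: mult_ac)
  moreover have "to_ac c \<in> R" if ic: "i \<le> m" "c \<in> Poly_Mapping.range (F' i)" for i c
  proof -
    have look: "Poly_Mapping.lookup (F' i) x = s * Poly_Mapping.lookup (F i) x" for x
      unfolding F'_def Const_def by (subst mult_map_scale_conv_mult[symmetric]) (simp add: map.rep_eq when_def)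
    obtain x where x: "c = Poly_Mapping.lookup (F' i) x" "c \<noteq> 0" using ic(2) by (auto simp: range.rep_eq)
    then have "c = s * Poly_Mapping.lookup (F i) x" "Poly_Mapping.lookup (F i) x \<noteq> 0" by (auto simp: look)
    then show ?thesis using s(2) ic(1) by (auto intro: in_keys_lookup_in_range simp: in_keys_iff)
  qed
  ultimately show ?thesis using class_eqI by blast
qed

text \<open>The coordinates are taken among the powers of \<open>t\<close>, which form an infinite subset of \<open>R\<close>. For \<open>l\<close> the
  coefficients \<open>1, x, x\<^sup>2, \<dots>\<close> suffice: each condition then excludes the finitely many roots of one
  polynomial in \<open>x\<close>.\<close>

lemma generic_point_and_form:
  fixes F :: "nat \<Rightarrow> 'k mpoly"
  assumes F: "\<exists>i\<le>m. F i \<noteq> 0" and Z: "finite Z" "\<And>z. z \<in> Z \<Longrightarrow> \<exists>i\<le>m. ev to_ac z (F i) \<noteq> 0"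
  shows "\<exists>v l. (\<forall>i. to_ac (v i) \<in> R) \<and> (\<forall>i. to_ac (l i) \<in> R) \<and>
    (\<forall>z\<in>insert (\<lambda>i. to_ac (v i)) Z. (\<Sum>j\<le>m. to_ac (l j) * ev to_ac z (F j)) \<noteq> 0)"
proof -
  let ?T = "range (\<lambda>i. t ^ i)"
  have T_R: "to_ac x \<in> R" if "x \<in> ?T" for x using that R_power[OF t_in] by auto
  obtain i0 where i0: "i0 \<le> m" "F i0 \<noteq> 0" using F by blast
  have id: "comm_ring_hom (\<lambda>x :: 'k. x)" by unfold_locales simp_all
  obtain v where v: "\<And>i. v i \<in> ?T" "ev (\<lambda>x. x) v (F i0) \<noteq> 0"
    using nonvanishing_point[OF id infinite_t_powers i0(2)] by blast
  have "ev to_ac (\<lambda>i. to_ac (v i)) (F i0) \<noteq> 0"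
    using hom_ev[OF comm_ring_hom_to_ac, of "\<lambda>x. x" v "F i0"] v(2) by (metis to_ac_eq_0_iff)
  then have Z': "\<exists>i\<le>m. ev to_ac z (F i) \<noteq> 0" if "z \<in> insert (\<lambda>i. to_ac (v i)) Z" for z
    using that Z(2) i0(1) by blast
  define Q where "Q z = (\<Sum>j\<le>m. Polynomial.monom (ev to_ac z (F j)) j)" for z
  have "Q z \<noteq> 0" if z: "z \<in> insert (\<lambda>i. to_ac (v i)) Z" for z
  proof -
    obtain i where i: "i \<le> m" "ev to_ac z (F i) \<noteq> 0" using Z'[OF z] by blast
    then have "coeff (Q z) i \<noteq> 0" by (simp add: Q_def coeff_sum)
    then show ?thesis by auto
  qed
  then have "finite (\<Union>z\<in>insert (\<lambda>i. to_ac (v i)) Z. {x. poly (Q z) x = 0})"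
    using Z(1) poly_roots_finite by (intro finite_UN_I) blast+
  moreover have "infinite (to_ac ` ?T)"
    using infinite_t_powers inj_to_ac by (metis finite_imageD inj_on_subset subset_UNIV)
  ultimately obtain x where x: "x \<in> ?T" "\<And>z. z \<in> insert (\<lambda>i. to_ac (v i)) Z \<Longrightarrow> poly (Q z) (to_ac x) \<noteq> 0"
    by (smt (verit, ccfv_threshold) UN_I finite_subset imageE mem_Collect_eq subsetI)
  have "(\<Sum>j\<le>m. to_ac (x ^ j) * ev to_ac z (F j)) = poly (Q z) (to_ac x)" for z
    by (simp add: Q_def poly_sum poly_monom mult.commute)
  moreover have "to_ac (x ^ j) \<in> R" for j using R_power[OF T_R[OF x(1)]] by simp
  ultimately show ?thesis using v(1) T_R x(2) by (intro exI[of _ v] exI[of _ "\<lambda>j. x ^ j"]) simp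
qed

end

section \<open>Generic degrees of iterates\<close>

lemma constant_iterates:
  assumes F: "F \<in> hom_tuples_deg m 0" and \<Phi>: "\<And>i. i \<le> m \<Longrightarrow> \<Phi> i = F i" and i: "i \<le> m"
  shows "iterate \<Phi> (Suc n) i = F i"
proof (induction n)
  case (Suc n)
  obtain c where "F i = Const c" using F i homogeneous_degree_0 unfolding hom_tuples_deg_def by blast
  then show ?case using Suc by simp
qed (use \<Phi>[OF i] in simp)

text \<open>In dimension zero the tuple of variables has a common factor and \<open>P\<close> is not available; but there
  reduced tuples are constant.\<close>

lemma degree_0_of_point:
  assumes "F \<in> hom_tuples_deg 0 d" "no_common_factor 0 F"
  shows "d = 0"
proof -
  have F: "homogeneous 0 d (F 0)" "F 0 \<noteq> 0" "F 0 dvd 1"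
    using assms unfolding hom_tuples_deg_def no_common_factor_def by auto
  then obtain c where "F 0 = Const c" unfolding unit_iff by blast
  then show ?thesis using homogeneous_degree_unique[OF F(1) _ F(2)] homogeneous_Const by metis
qed

theorem mainTheorem1:
  fixes f :: "(nat \<Rightarrow> 'k::field mpoly) set" and m :: nat
  assumes "uncountable (UNIV :: 'k set) \<or> CHAR('k) = 0"
    and "f \<in> carrier (Bir m)"
  shows "\<exists>A\<in>carrier (PGL (Suc m)). \<forall>n\<ge>1.
    rat_degree m ((proj_aut m A \<otimes>\<^bsub>Bir m\<^esub> f) [^]\<^bsub>Bir m\<^esub> (n::nat)) = rat_degree m f ^ n"
proof -
  obtain t :: 'k and R where "adic_ring t R" using exists_adic_ring[OF assms(1)] by blast
  then interpret adic_ring t R .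
  have f: "f \<in> rational_maps m" using assms(2) unfolding Bir_def by simp
  obtain F0 d where F0: "F0 \<in> f" "F0 \<in> hom_tuples_deg m d" "no_common_factor m F0"
    using reduced_representative[OF f] by blast
  obtain F where F: "F \<in> hom_tuples_deg m d" "no_common_factor m F" "f = proj_rel m `` {F}"
    and F_R: "\<And>i c. i \<le> m \<Longrightarrow> c \<in> Poly_Mapping.range (F i) \<Longrightarrow> to_ac c \<in> R"
    using integral_representative[OF F0(2,3)] rational_map_class(1)[OF f F0(1)] by blast
  have hom: "\<And>i. i \<le> m \<Longrightarrow> homogeneous m d (F i)" and Fnz: "\<exists>i\<le>m. F i \<noteq> 0"
    using F(1) unfolding hom_tuples_deg_def by blast+
  have deg: "rat_degree m f = d" unfolding F(3) by (rule rat_degree_eq[OF F(1,2)])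
  have "\<exists>\<mu> \<nu>. inverse_to m \<mu> \<nu> \<and> inverse_to m \<nu> \<mu> \<and>
    (\<forall>n. (\<exists>i\<le>m. iterate (lin_comb m \<mu> F) (Suc n) i \<noteq> 0) \<and>
      no_common_factor m (iterate (lin_comb m \<mu> F) (Suc n)))"
  proof (cases "d = 0")
    case True
    let ?I = "\<lambda>i j :: nat. if i = j then 1 else 0 :: 'k"
    have "(\<Sum>j\<le>m. ?I i j * ?I j k) = (\<Sum>j\<le>m. if j = i then ?I i k else 0)" for i k
      by (rule sum.cong) auto
    then have I: "inverse_to m ?I ?I" unfolding inverse_to_def by simp
    have lin: "lin_comb m ?I F i = F i" if "i \<le> m" for i
    proof -
      have "lin_comb m ?I F i = (\<Sum>j\<le>m. if j = i then F j else 0)"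
        unfolding lin_comb_def by (rule sum.cong) (auto simp: Const.hom_one)
      then show ?thesis using that by simp
    qed
    have const: "iterate (lin_comb m ?I F) (Suc n) i = F i" if "i \<le> m" for n i
      by (rule constant_iterates[OF _ lin that]) (use F(1) True in simp)
    have "(\<exists>i\<le>m. iterate (lin_comb m ?I F) (Suc n) i \<noteq> 0) \<and>
        no_common_factor m (iterate (lin_comb m ?I F) (Suc n))" for n
    proof
      show "\<exists>i\<le>m. iterate (lin_comb m ?I F) (Suc n) i \<noteq> 0"
        using Fnz const[of _ n] by (simp del: iterate.simps cong: conj_cong)
      show "no_common_factor m (iterate (lin_comb m ?I F) (Suc n))"
        using F(2) const[of _ n] unfolding no_common_factor_def by (simp del: iterate.simps)
    qed
    then show ?thesis using I by blast
  next
    case False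
    then have d: "d \<ge> 1" by simp
    have m: "m \<ge> 1" using degree_0_of_point F(1,2) False by (cases m) auto
    obtain G e P Q where G: "G \<in> hom_tuples_deg m e" and PQ: "P \<noteq> 0" "Q \<noteq> 0"
      and GF: "\<And>i. i \<le> m \<Longrightarrow> subst F (G i) = P * Var i" and FG: "\<And>i. i \<le> m \<Longrightarrow> subst G (F i) = Q * Var i"
      using birational_pair[OF assms(2) F(3,1,2) m] by blast
    have homG: "\<And>i. i \<le> m \<Longrightarrow> homogeneous m e (G i)" using G unfolding hom_tuples_deg_def by blast
    obtain B where B: "finite B" "\<And>b. b \<in> B \<Longrightarrow> Factorial_Ring.prime_elem b"
      "\<And>q. Factorial_Ring.prime_elem q \<Longrightarrow> q dvd P \<Longrightarrow> \<exists>b\<in>B. b dvd q"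
      using finitely_many_primes[OF PQ(1)] by blast
    have "infinite (UNIV :: 'k alg_closure set)"
      using infinite_t_powers inj_to_ac by (metis finite_imageD finite_subset inj_on_subset subset_UNIV)
    then have "\<forall>b\<in>B. \<exists>z. ev to_ac z b = 0 \<and> (\<exists>i\<le>m. ev to_ac z (F i) \<noteq> 0)"
      using zero_point B(2) no_common_factor_iff[OF Fnz] F(2) by metis
    then obtain z where z: "\<And>b. b \<in> B \<Longrightarrow> ev to_ac (z b) b = 0" 
      "\<And>b. b \<in> B \<Longrightarrow> \<exists>i\<le>m. ev to_ac (z b) (F i) \<noteq> 0" by metis
    obtain v l where vl: "\<And>i. to_ac (v i) \<in> R" "\<And>i. to_ac (l i) \<in> R"
      "\<And>y. y \<in> insert (\<lambda>i. to_ac (v i)) (z ` B) \<Longrightarrow> (\<Sum>j\<le>m. to_ac (l j) * ev to_ac y (F j)) \<noteq> 0"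
      using generic_point_and_form[OF Fnz, of "z ` B"] B(1) z(2) by blast
    have "\<exists>s. s \<noteq> 0 \<and> s + (\<Sum>j\<le>m. l j * v j) \<noteq> 0 \<and> (\<forall>y\<in>z ` B. \<forall>n. \<exists>i\<le>m.
        ev to_ac y (iterate (lin_comb m (rank_one_perturbation s v l) F) (Suc n) i) \<noteq> 0)"
    proof (rule attraction[where d = d])
      show "homogeneous m d (F i)" if "i \<le> m" for i using that by (rule hom)
      show "to_ac c \<in> R" if "i \<le> m" "c \<in> Poly_Mapping.range (F i)" for i c using that by (rule F_R)
      show "finite (z ` B)" using B(1) by simp
      show "(\<Sum>j\<le>m. to_ac (l j) * ev to_ac y (F j)) \<noteq> 0"
        if "y \<in> insert (\<lambda>i. to_ac (v i)) (z ` B)" for y using that by (rule vl(3))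
    qed (rule d vl)+
    then obtain s where s: "s \<noteq> 0" "s + (\<Sum>j\<le>m. l j * v j) \<noteq> 0"
      and escape: "\<forall>y\<in>z ` B. \<forall>n. \<exists>i\<le>m.
        ev to_ac y (iterate (lin_comb m (rank_one_perturbation s v l) F) (Suc n) i) \<noteq> 0"
      by (elim exE conjE) (rule that)
    define \<mu> where "\<mu> = rank_one_perturbation s v l"
    obtain \<nu> where \<mu>: "inverse_to m \<mu> \<nu>" "inverse_to m \<nu> \<mu>"
      using rank_one_perturbation_invertible[OF s] unfolding \<mu>_def by blast
    let ?\<Phi> = "lin_comb m \<mu> F"
    obtain Q' where Q': "Q' \<noteq> 0" "\<And>i. i \<le> m \<Longrightarrow> subst (\<lambda>i. subst (lin_comb m \<nu> Var) (G i)) (?\<Phi> i) = Q' * Var i"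
      using twist_inverse(2)[OF hom homG GF FG PQ(2) \<mu>] by blast
    have "(\<exists>i\<le>m. iterate ?\<Phi> (Suc n) i \<noteq> 0) \<and> no_common_factor m (iterate ?\<Phi> (Suc n))" for n
    proof (rule iterate_reduced[where d = d])
      show "homogeneous m d (?\<Phi> i)" if "i \<le> m" for i using hom by (rule homogeneous_lin_comb)
      show "\<exists>i\<le>m. ?\<Phi> i \<noteq> 0" by (rule lin_comb_nonzero[OF \<mu>(2) Fnz])
      show "no_common_factor m ?\<Phi>" by (rule lin_comb_no_common_factor[OF \<mu>(2) F(2)])
      show "subst ?\<Phi> (subst (lin_comb m \<nu> Var) (G i)) = P * Var i" if "i \<le> m" for i
        by (rule twist_inverse(1)[OF hom homG GF FG PQ(2) \<mu> that])
      show "subst (\<lambda>i. subst (lin_comb m \<nu> Var) (G i)) (?\<Phi> i) = Q' * Var i" if "i \<le> m" for i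
        by (rule Q'(2)[OF that])
      fix q n assume q: "Factorial_Ring.prime_elem q" "q dvd P"
      obtain b where b: "b \<in> B" "b dvd q" using B(3)[OF q] by blast
      obtain i where i: "i \<le> m" "ev to_ac (z b) (iterate ?\<Phi> (Suc n) i) \<noteq> 0"
        using bspec[OF escape imageI[OF b(1)], THEN spec, of n, folded \<mu>_def] by (elim exE conjE) (rule that)
      have "\<not> q dvd iterate ?\<Phi> (Suc n) i"
      proof
        assume "q dvd iterate ?\<Phi> (Suc n) i"
        then have "b dvd iterate ?\<Phi> (Suc n) i" using b(2) dvd_trans by blast
        then obtain w where "iterate ?\<Phi> (Suc n) i = b * w" by (elim dvdE)
        then show False using i(2) z(1)[OF b(1)] by (simp del: iterate.simps add: ev_mult[OF comm_ring_hom_to_ac])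
      qed
      then show "\<exists>i\<le>m. \<not> q dvd iterate ?\<Phi> (Suc n) i" using i(1) by blast
    qed (use PQ Q' in auto)
    then show ?thesis using \<mu> by blast
  qed
  then obtain \<mu> \<nu> where \<mu>: "inverse_to m \<mu> \<nu>" "inverse_to m \<nu> \<mu>"
    and red: "\<And>n. (\<exists>i\<le>m. iterate (lin_comb m \<mu> F) (Suc n) i \<noteq> 0) \<and>
      no_common_factor m (iterate (lin_comb m \<mu> F) (Suc n))" by blast
  show ?thesis unfolding deg unfolding F(3) by (rule degree_of_powers[OF F(1) \<mu> red])
qed

end
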